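(* Let $\tau$ be a finite relational type, $k$ a positive integer and $\varepsilon>0$. Then for every $n$ large enough (depending on $\tau$, $\varepsilon$ and $k$) there exists an $\varepsilon$-expander relational structure $\mathbf{S}$ of type $\tau$ with $|S|=n$, maximal degree at most $M=M_{\tau,\varepsilon}$ (a constant depending only on $\tau$ and $\varepsilon$) and girth at least $k$, and such an $\mathbf{S}$ can be constructed by a deterministic algorithm in time polynomial in $n$.
   Context: A relational type $\tau$ is a finite set of relation symbols, each with an arity. A structure $\mathbf{S}$ of type $\tau$ consists of a finite base set $S$ and, for each $r$-ary symbol $R\in\tau$, a set $R(\mathbf{S})\subseteq S^r$ of tuples. For an $r$-ary relation $R\subseteq S^r$ and subsets $S_1,\dots,S_r\subseteq S$, let $R(S_1,\dots,S_r)$ be the number of tuples $(x_1,\dots,x_r)\in R$ with $x_i\in S_i$ for all $i$. $R$ is an $\varepsilon$-expander relation if for all $S_1,\dots,S_r\subseteq S$: $\big|R(S_1,\dots,S_r)-|R|\prod_{i=1}^r|S_i|/|S|^r\big|<\varepsilon|R|$. A structure is an $\varepsilon$-expander if every relation of it of arity at least $2$ is an $\varepsilon$-expander relation. The degree of an element $x$ is the number of relational tuples (over all relations) containing $x$, counted with multiplicity; the maximal degree is the maximum over elements. A cycle is either a minimal sequence $x_0,r_1,x_1,\dots,r_t,x_t=x_0$ of distinct elements and distinct relational tuples with each $x_i$ a coordinate of both $r_i$ and $r_{i+1}$ (length $t$), or, degenerately, a single relational tuple with a repeated coordinate (length $1$). The girth is the minimum length of a cycle ($\infty$ if there is none). 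*)

theory Defs
  imports Complex_Main "HOL-Library.Extended_Nat" "HOL-Computational_Algebra.Polynomial"
begin

section \<open>Relational structures\<close>

text \<open>A relational type is a finite set \<open>\<tau>\<close> of symbols together with an arity function \<open>ar\<close>.
  Tuples are lists; the values of \<open>rel S\<close> outside \<open>\<tau>\<close> are irrelevant.\<close>

record ('r, 'a) rel_structure =
  base :: "'a set"
  rel :: "'r \<Rightarrow> 'a list set"

definition is_structure :: "'r set \<Rightarrow> ('r \<Rightarrow> nat) \<Rightarrow> ('r, 'a) rel_structure \<Rightarrow> bool" where
  "is_structure \<tau> ar S \<longleftrightarrow>
     finite (base S) \<and>
     (\<forall>R\<in>\<tau>. \<forall>xs\<in>rel S R. length xs = ar R \<and> set xs \<subseteq> base S)"

definition tuple_count :: "'a list set \<Rightarrow> 'a set list \<Rightarrow> nat" where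
  "tuple_count R As = card {xs \<in> R. list_all2 (\<in>) xs As}"

definition expander_relation :: "real \<Rightarrow> 'a set \<Rightarrow> nat \<Rightarrow> 'a list set \<Rightarrow> bool" where
  "expander_relation \<epsilon> A r R \<longleftrightarrow>
     (\<forall>As. length As = r \<and> (\<forall>B\<in>set As. B \<subseteq> A) \<longrightarrow>
        \<bar>real (tuple_count R As) -
          real (card R) * (\<Prod>B\<leftarrow>As. real (card B)) / real (card A) ^ r\<bar>
        < \<epsilon> * real (card R))"

definition expander :: "'r set \<Rightarrow> ('r \<Rightarrow> nat) \<Rightarrow> real \<Rightarrow> ('r, 'a) rel_structure \<Rightarrow> bool" where
  "expander \<tau> ar \<epsilon> S \<longleftrightarrow>
     (\<forall>R\<in>\<tau>. ar R \<ge> 2 \<longrightarrow> expander_relation \<epsilon> (base S) (ar R) (rel S R))"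

text \<open>Multiplicity: a tuple counts once for every relation it belongs to and once for every
  coordinate equal to \<open>x\<close>.\<close>

definition elem_degree :: "'r set \<Rightarrow> ('r, 'a) rel_structure \<Rightarrow> 'a \<Rightarrow> nat" where
  "elem_degree \<tau> S x = (\<Sum>R\<in>\<tau>. \<Sum>xs\<in>rel S R. count_list xs x)"

definition max_degree :: "'r set \<Rightarrow> ('r, 'a) rel_structure \<Rightarrow> nat" where
  "max_degree \<tau> S = Max (elem_degree \<tau> S ` base S)"

text \<open>A relational tuple carries its relation symbol: the same list in two relations gives two
  distinct relational tuples.\<close>

definition rel_tuples :: "'r set \<Rightarrow> ('r, 'a) rel_structure \<Rightarrow> ('r \<times> 'a list) set" where
  "rel_tuples \<tau> S = (SIGMA R:\<tau>. rel S R)"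

text \<open>With \<open>xs = [x\<^sub>0, \<dots>, x\<^bsub>t-1\<^esub>]\<close> and \<open>rs = [r\<^sub>1, \<dots>, r\<^sub>t]\<close>, the entry \<open>rs ! i\<close> is \<open>r\<^bsub>i+1\<^esub>\<close>, which has
  to contain \<open>x\<^sub>i\<close> and \<open>x\<^bsub>i+1\<^esub>\<close>, where \<open>x\<^sub>t = x\<^sub>0\<close>. For \<open>t = 1\<close> the condition would hold of every
  nonempty tuple, so cycles of length 1 are only the degenerate ones, treated separately.\<close>

definition closed_sequence ::
    "'r set \<Rightarrow> ('r, 'a) rel_structure \<Rightarrow> 'a list \<Rightarrow> ('r \<times> 'a list) list \<Rightarrow> bool" where
  "closed_sequence \<tau> S xs rs \<longleftrightarrow>
     length rs \<ge> 2 \<and> length xs = length rs \<and> distinct xs \<and> distinct rs \<and>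
     set rs \<subseteq> rel_tuples \<tau> S \<and>
     (\<forall>i<length rs. xs ! i \<in> set (snd (rs ! i)) \<and>
                    xs ! (Suc i mod length rs) \<in> set (snd (rs ! i)))"

definition proper_cycle ::
    "'r set \<Rightarrow> ('r, 'a) rel_structure \<Rightarrow> 'a list \<Rightarrow> ('r \<times> 'a list) list \<Rightarrow> bool" where
  "proper_cycle \<tau> S xs rs \<longleftrightarrow>
     closed_sequence \<tau> S xs rs \<and>
     \<not> (\<exists>ys ss. closed_sequence \<tau> S ys ss \<and> set ys \<subset> set xs \<and> set ss \<subset> set rs)"

definition cycle_lengths :: "'r set \<Rightarrow> ('r, 'a) rel_structure \<Rightarrow> nat set" where
  "cycle_lengths \<tau> S =
     {length rs | xs rs. proper_cycle \<tau> S xs rs} \<union>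
     {1 | R xs. (R, xs) \<in> rel_tuples \<tau> S \<and> \<not> distinct xs}"

definition girth :: "'r set \<Rightarrow> ('r, 'a) rel_structure \<Rightarrow> enat" where
  "girth \<tau> S = Inf (enat ` cycle_lengths \<tau> S)"

section \<open>Deterministic polynomial-time algorithms\<close>

text \<open>Algorithms are programs of the WHILE language of N. D. Jones (\<^emph>\<open>Computability and
  Complexity\<close>) over binary trees, whose polynomial-time functions are those of Turing machines.
  As with a logarithmic-cost measure, every evaluated subexpression is charged the size of its
  value, so no step is cheaper than writing down its result and sharing of subtrees gives no
  speed-up.\<close>

datatype tree = Leaf | Node tree tree

type_synonym state = "nat \<Rightarrow> tree"

datatype expr = VarE nat | NilE | ConsE expr expr | HdE expr | TlE expr

datatype com =
    Assign nat expr
  | Seq com com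
  | Cond expr com com
  | While expr com

fun hd_tree :: "tree \<Rightarrow> tree" where
  "hd_tree Leaf = Leaf"
| "hd_tree (Node a b) = a"

fun tl_tree :: "tree \<Rightarrow> tree" where
  "tl_tree Leaf = Leaf"
| "tl_tree (Node a b) = b"

primrec eval :: "expr \<Rightarrow> state \<Rightarrow> tree" where
  "eval (VarE x) s = s x"
| "eval NilE s = Leaf"
| "eval (ConsE e f) s = Node (eval e s) (eval f s)"
| "eval (HdE e) s = hd_tree (eval e s)"
| "eval (TlE e) s = tl_tree (eval e s)"

primrec eval_time :: "expr \<Rightarrow> state \<Rightarrow> nat" where
  "eval_time (VarE x) s = Suc (size (s x))"
| "eval_time NilE s = 1"
| "eval_time (ConsE e f) s =
     eval_time e s + eval_time f s + Suc (size (eval (ConsE e f) s))"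
| "eval_time (HdE e) s = eval_time e s + Suc (size (eval (HdE e) s))"
| "eval_time (TlE e) s = eval_time e s + Suc (size (eval (TlE e) s))"

text \<open>\<open>exec c s t s'\<close>: started in \<open>s\<close>, the program \<open>c\<close> halts in \<open>s'\<close> after time \<open>t\<close>. A test
  succeeds iff its value is not \<open>Leaf\<close>.\<close>

inductive exec :: "com \<Rightarrow> state \<Rightarrow> nat \<Rightarrow> state \<Rightarrow> bool" where
  Assign: "exec (Assign x e) s (Suc (eval_time e s)) (s(x := eval e s))"
| Seq: "exec c s t s' \<Longrightarrow> exec d s' u s'' \<Longrightarrow> exec (Seq c d) s (t + u) s''"
| CondTrue: "eval e s \<noteq> Leaf \<Longrightarrow> exec c s t s' \<Longrightarrow>
    exec (Cond e c d) s (Suc (eval_time e s) + t) s'"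
| CondFalse: "eval e s = Leaf \<Longrightarrow> exec d s t s' \<Longrightarrow>
    exec (Cond e c d) s (Suc (eval_time e s) + t) s'"
| WhileFalse: "eval e s = Leaf \<Longrightarrow> exec (While e c) s (Suc (eval_time e s)) s"
| WhileTrue: "eval e s \<noteq> Leaf \<Longrightarrow> exec c s t s' \<Longrightarrow> exec (While e c) s' u s'' \<Longrightarrow>
    exec (While e c) s (Suc (eval_time e s) + t + u) s''"

inductive_cases AssignE: "exec (Assign x e) s t s'"
inductive_cases SeqE: "exec (Seq c d) s t s'"
inductive_cases CondE: "exec (Cond e c d) s t s'"
inductive_cases WhileE: "exec (While e c) s t s'"

lemma exec_deterministic:
  "exec c s t s' \<Longrightarrow> exec c s u s'' \<Longrightarrow> t = u \<and> s' = s''"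
proof (induction arbitrary: u s'' rule: exec.induct)
  case (Assign x e s)
  from Assign.prems show ?case by (rule AssignE) simp
next
  case (Seq c s t s' d u' s2)
  from Seq.prems show ?case by (rule SeqE) (metis Seq.IH)
next
  case (CondTrue e s c t s' d)
  from CondTrue.prems show ?case by (rule CondE) (metis CondTrue.hyps(1) CondTrue.IH add_Suc)+
next
  case (CondFalse e s d t s' c)
  from CondFalse.prems show ?case by (rule CondE) (metis CondFalse.hyps(1) CondFalse.IH add_Suc)+
next
  case (WhileFalse e s c)
  from WhileFalse.prems show ?case by (rule WhileE) (use WhileFalse.hyps in simp_all)
next
  case (WhileTrue e s c t s' u' s2)
  from WhileTrue.prems show ?case by (rule WhileE) (metis WhileTrue.hyps(1) WhileTrue.IH add_Suc)+
qed

definition computes :: "com \<Rightarrow> tree \<Rightarrow> nat \<Rightarrow> tree \<Rightarrow> bool" where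
  "computes c v t w \<longleftrightarrow> (\<exists>s. exec c ((\<lambda>_. Leaf)(0 := v)) t s \<and> s 0 = w)"

subsection \<open>Encoding of inputs and outputs\<close>

primrec tree_of_list :: "tree list \<Rightarrow> tree" where
  "tree_of_list [] = Leaf"
| "tree_of_list (v # vs) = Node v (tree_of_list vs)"

text \<open>Numbers are coded in unary, so polynomial in the input size means polynomial in \<open>n\<close>.\<close>

definition tree_of_nat :: "nat \<Rightarrow> tree" where
  "tree_of_nat n = tree_of_list (replicate n Leaf)"

definition tree_of_tuple :: "nat list \<Rightarrow> tree" where
  "tree_of_tuple xs = tree_of_list (map tree_of_nat xs)"

text \<open>A structure is written down as a list of its elements followed by, for each symbol in the
  order given by \<open>syms\<close>, a list of the tuples in that relation.\<close>

definition encodes :: "'r list \<Rightarrow> tree \<Rightarrow> ('r, nat) rel_structure \<Rightarrow> bool" where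
  "encodes syms v S \<longleftrightarrow>
     (\<exists>xs tss. distinct xs \<and> set xs = base S \<and>
        list_all2 (\<lambda>R ts. distinct ts \<and> set ts = rel S R) syms tss \<and>
        v = Node (tree_of_tuple xs)
                 (tree_of_list (map (\<lambda>ts. tree_of_list (map tree_of_tuple ts)) tss)))"

definition poly_time_constructible ::
    "'r set \<Rightarrow> nat \<Rightarrow> (nat \<Rightarrow> ('r, nat) rel_structure) \<Rightarrow> bool" where
  "poly_time_constructible \<tau> N S \<longleftrightarrow>
     (\<exists>syms c. \<exists>p :: nat poly. distinct syms \<and> set syms = \<tau> \<and>
        (\<forall>n\<ge>N. \<exists>t v. computes c (tree_of_nat n) t v \<and> t \<le> poly p n \<and> encodes syms v (S n)))"

end

theory Submission
  imports Defs "HOL-Library.FuncSet" "HOL-Analysis.Convex"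
begin

text \<open>
  The structure is a lift of a fixed finite one. Let \<open>r\<close> bound the arities. On the torus
  \<open>(\<int>/m)\<^sup>2\<close> two translations and two shears have a spectral gap independent of \<open>m\<close>: the Fourier
  transform of an almost invariant function would be concentrated near \<open>0\<close> because of the
  translations and almost invariant under the dual shears, which is impossible since these play
  ping-pong on \<open>\<int>\<^sup>2 - {0}\<close>. Hence the tuples \<open>(v, w\<^sub>1 v, w\<^sub>2 w\<^sub>1 v, \<dots>)\<close>, with words \<open>w\<^sub>i\<close> of a
  fixed length in the generators, are nearly equidistributed; a list of such words is a colour.

  The probabilistic method yields, for every \<open>k\<close>, a single finite structure on \<open>{0..<q}\<close> with an
  \<open>r\<close>-ary expander relation for every pair of a symbol and a colour, degree bounded independently
  of \<open>k\<close>, and girth at least \<open>k\<close> (few tuples lie on short cycles or have an element of large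
  degree, and these are deleted). Lift a tuple \<open>(e\<^sub>1, \<dots>, e\<^sub>r)\<close> of colour \<open>w\<close> to all tuples
  \<open>((v, e\<^sub>1), (w\<^sub>1 v, e\<^sub>2), \<dots>)\<close>. The projection to the finite structure is a covering, so degree
  and girth do not get worse, and the lift is an expander because the finite relations equidistribute
  the fibres and the walks the base points. Since \<open>m\<^sup>2 q\<close> is asymptotic to \<open>n\<close> for
  \<open>m = \<lfloor>sqrt (n / q)\<rfloor>\<close>, the missing elements can be added as isolated points. The finite structure is
  a constant of the algorithm, so that the lift is computable in polynomial time.
\<close>

subsection \<open>The spectral gap of shears and translations on the torus\<close>

text \<open>The order of choices makes the degree bound independent of \<open>k\<close>. The walk
  length \<open>t\<close> depends only on \<epsilon> and the maximal arity, so the colours are fixed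
  by \<tau> and \<epsilon>; the density and the degree bound \<open>M\<close> of the random system
  are fixed next; only then is \<open>k\<close> given, and only the size of the finite structure
  grows with it. That structure is obtained by counting, with no fast way to find it, hence it must
  not depend on \<open>n\<close>. Every colour needs a mixing relation of its own: for each colour
  and base point, the sets to be hit in the fibres are arbitrary. The torus is not asked for any
  girth: lifted tuples over the same index that share an element at the same position are equal,
  since each point of a walk determines its start. The shears add twice the other coordinate because
  adding it once does not move all of the cone \<bar>b\<bar> < \<bar>a\<bar> out of itself. The
  generators are in general not closed under inverses, so the gap is used as a norm contraction on
  functions of mean zero and not through eigenvalues.\<close>

definition torus :: "nat \<Rightarrow> (nat \<times> nat) set" where
  "torus m = {..<m} \<times> {..<m}"

text \<open>The identity is one of the five generators so that averaging over them compares
  \<open>f v\<close> itself with its four images.\<close>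

definition gen :: "nat \<Rightarrow> nat \<Rightarrow> nat \<times> nat \<Rightarrow> nat \<times> nat" where
  "gen m a = (\<lambda>(x, y).
     if a = 0 then (x, y) else
     if a = 1 then ((x + 1) mod m, y) else
     if a = 2 then (x, (y + 1) mod m) else
     if a = 3 then ((x + (y + y)) mod m, y) else (x, (y + (x + x)) mod m))"

lemma finite_torus [simp]: "finite (torus m)"
  by (simp add: torus_def)

lemma card_torus: "card (torus m) = m * m"
  by (simp add: torus_def)

lemma add_mod_cancel:
  fixes x x' c m :: nat
  assumes "(x + c) mod m = (x' + c) mod m" "x < m" "x' < m"
  shows "x = x'"
proof -
  have "int x mod int m = int x' mod int m"
  proof -
    have "(int x + int c) mod int m = (int x' + int c) mod int m"
      using assms(1) by (metis of_nat_add of_nat_mod)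
    hence "((int x + int c) - int c) mod int m = ((int x' + int c) - int c) mod int m"
      by (rule mod_diff_cong) simp
    thus ?thesis by simp
  qed
  thus ?thesis using assms by simp
qed

lemma bij_betw_gen: "bij_betw (gen m a) (torus m) (torus m)"
proof -
  have "gen m a ` torus m \<subseteq> torus m"
    by (auto simp: gen_def torus_def split: if_splits)
  moreover have "inj_on (gen m a) (torus m)"
    unfolding gen_def torus_def
    by (auto simp: inj_on_def split: if_splits dest: add_mod_cancel)
       (metis add_mod_cancel Suc_eq_plus1)+
  ultimately show ?thesis
    by (simp add: bij_betw_def endo_inj_surj)
qed

lemma sum_gen: "(\<Sum>v\<in>torus m. h (gen m a v)) = sum h (torus m)"
  by (rule sum.reindex_bij_betw[OF bij_betw_gen])

section \<open>Characters and the Fourier transform on the torus\<close>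

definition om :: "nat \<Rightarrow> int \<Rightarrow> complex" where
  "om m j = cis (2 * pi * of_int j / of_nat m)"

lemma om_add: "om m (i + j) = om m i * om m j"
  by (simp add: om_def cis_mult ring_distribs add_divide_distrib)

lemma om_0 [simp]: "om m 0 = 1"
  by (simp add: om_def)

lemma om_mult_period: "m > 0 \<Longrightarrow> om m (int m * j) = 1"
  by (simp add: om_def mult.commute) (metis cis_multiple_2pi Ints_of_int mult.assoc mult.commute)

lemma om_cong:
  assumes "m > 0" "i mod int m = j mod int m"
  shows "om m i = om m j"
proof -
  obtain k where "i = j + int m * k"
    using assms(2) by (metis mod_eqE)
  thus ?thesis using assms by (simp add: om_add om_mult_period)
qed

lemma cnj_om: "cnj (om m j) = om m (- j)"
  by (simp add: om_def cis_cnj)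

lemma norm_om [simp]: "cmod (om m j) = 1"
  by (simp add: om_def)

definition periodic :: "nat \<Rightarrow> (int \<Rightarrow> 'a) \<Rightarrow> bool" where
  "periodic m h \<longleftrightarrow> (\<forall>i j. i mod int m = j mod int m \<longrightarrow> h i = h j)"

lemma periodic_sum:
  assumes "m > 0" "periodic m h"
  shows "(\<Sum>j\<in>{c..<c + int m}. h j) = (\<Sum>j\<in>{0..<int m}. h j)"
proof (rule sum.reindex_bij_witness[of _ "\<lambda>i. c + (i - c) mod int m" "\<lambda>j. j mod int m"])
  fix a assume a: "a \<in> {c..<c + int m}"
  have "(a mod int m - c) mod int m = (a - c) mod int m" by (simp add: mod_diff_left_eq)
  also have "\<dots> = a - c" using a by simp
  finally show "c + (a mod int m - c) mod int m = a" by simp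
  show "a mod int m \<in> {0..<int m}" using assms by simp
  show "h (a mod int m) = h a" using assms(2) unfolding periodic_def by (metis mod_mod_trivial)
next
  fix b assume b: "b \<in> {0..<int m}"
  show "c + (b - c) mod int m \<in> {c..<c + int m}" using assms by simp
  have "(c + (b - c) mod int m) mod int m = (c + (b - c)) mod int m" by (simp add: mod_add_right_eq)
  thus "(c + (b - c) mod int m) mod int m = b" using b by simp
qed

text \<open>Representatives of the residues modulo \<open>m\<close> closest to zero.\<close>

definition res :: "nat \<Rightarrow> int set" where
  "res m = {- ((int m - 1) div 2)..< - ((int m - 1) div 2) + int m}"

lemma finite_res [simp]: "finite (res m)" by (simp add: res_def)

lemma res_iff: "j \<in> res m \<longleftrightarrow> - int m < 2 * j \<and> 2 * j \<le> int m"
  unfolding res_def by auto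

lemma res_sum_shift:
  assumes "m > 0" "periodic m h"
  shows "(\<Sum>j\<in>res m. h (j + c)) = (\<Sum>j\<in>res m. h j)"
proof -
  have "(\<Sum>j\<in>{l..<l + int m}. h (j + c)) = (\<Sum>j\<in>{l + c..<(l + c) + int m}. h j)" for l
    by (rule sum.reindex_bij_witness[of _ "\<lambda>j. j - c" "\<lambda>j. j + c"]) auto
  thus ?thesis unfolding res_def by (simp only: periodic_sum[OF assms])
qed

text \<open>Orthogonality of characters: shifting \<open>j\<close> by one multiplies the sum by
  \<open>om m d\<close>, which differs from 1 unless \<open>m\<close> divides
  \<open>d\<close>.\<close>

lemma sum_om:
  assumes m: "m > 0"
  shows "(\<Sum>j\<in>res m. om m (d * j)) = (if int m dvd d then of_nat m else 0)"
proof (cases "int m dvd d")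
  case True
  then obtain e where "d = int m * e" by auto
  hence "om m (d * j) = 1" for j using om_mult_period[OF m, of "e * j"] by (simp add: mult.assoc)
  moreover have "card (res m) = m" by (simp add: res_def)
  ultimately show ?thesis using True by simp
next
  case False
  let ?X = "\<Sum>j\<in>res m. om m (d * j)"
  have per: "periodic m (\<lambda>j. om m (d * j))"
    unfolding periodic_def using om_cong[OF m] by (metis mod_mult_right_eq)
  have "?X = (\<Sum>j\<in>res m. om m (d * (j + 1)))"
    using res_sum_shift[OF m per, of 1] by simp
  also have "\<dots> = om m d * ?X"
    by (simp add: ring_distribs om_add sum_distrib_left mult.commute)
  finally have "(1 - om m d) * ?X = 0" by (simp add: algebra_simps)
  moreover have "om m d \<noteq> 1"
  proof
    assume "om m d = 1"
    hence "cos (2 * pi * of_int d / of_nat m) = 1"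
      unfolding om_def by (metis Re_complex_of_real cis.simps(1) of_real_1)
    then obtain n :: int where "2 * pi * of_int d / of_nat m = of_int n * 2 * pi"
      by (auto simp: cos_one_2pi_int)
    hence "of_int d = (of_int (n * int m) :: real)" using m by (simp add: field_simps)
    hence "d = n * int m" by (metis of_int_eq_iff)
    thus False using False by simp
  qed
  ultimately show ?thesis using False by simp
qed

definition dot :: "nat \<times> nat \<Rightarrow> int \<times> int \<Rightarrow> int" where
  "dot v z = int (fst v) * fst z + int (snd v) * snd z"

definition dft :: "nat \<Rightarrow> (nat \<times> nat \<Rightarrow> real) \<Rightarrow> int \<times> int \<Rightarrow> complex" where
  "dft m f z = (\<Sum>v\<in>torus m. of_real (f v) * om m (dot v z))"

lemma dft_diff: "dft m (\<lambda>v. f v - g v) z = dft m f z - dft m g z"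
  by (simp add: dft_def sum_subtractf ring_distribs)

text \<open>Expanding the square leaves only the diagonal, because the character sum over
  frequencies factors into two one-dimensional ones.\<close>

lemma parseval:
  assumes m: "m > 0"
  shows "(\<Sum>z\<in>res m \<times> res m. (cmod (dft m f z))\<^sup>2) = of_nat (m * m) * (\<Sum>v\<in>torus m. (f v)\<^sup>2)"
proof -
  have orth: "(\<Sum>z\<in>res m \<times> res m. om m (dot v z) * cnj (om m (dot w z)))
      = (if v = w then of_nat (m * m) else 0)" if v: "v \<in> torus m" and w: "w \<in> torus m" for v w
  proof -
    have "(\<Sum>z\<in>res m \<times> res m. om m (dot v z) * cnj (om m (dot w z)))
      = (\<Sum>z\<in>res m \<times> res m. om m ((int (fst v) - int (fst w)) * fst z) * om m ((int (snd v) - int (snd w)) * snd z))"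
      by (intro sum.cong refl) (simp add: cnj_om om_add[symmetric] dot_def algebra_simps)
    also have "\<dots> = (\<Sum>a\<in>res m. om m ((int (fst v) - int (fst w)) * a)) * (\<Sum>b\<in>res m. om m ((int (snd v) - int (snd w)) * b))"
      by (simp add: sum_product sum.cartesian_product case_prod_beta)
    also have "\<dots> = (if int m dvd int (fst v) - int (fst w) then of_nat m else 0) *
                    (if int m dvd int (snd v) - int (snd w) then of_nat m else 0)"
      by (simp only: sum_om[OF m])
    also have "int m dvd int (fst v) - int (fst w) \<longleftrightarrow> fst v = fst w"
      using v w by (auto simp: torus_def dvd_def mem_Times_iff)
        (metis mod_eq_dvd_iff mod_less of_nat_eq_iff of_nat_mod dvd_triv_left)
    also have "int m dvd int (snd v) - int (snd w) \<longleftrightarrow> snd v = snd w"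
      using v w by (auto simp: torus_def dvd_def mem_Times_iff)
        (metis mod_eq_dvd_iff mod_less of_nat_eq_iff of_nat_mod dvd_triv_left)
    finally show ?thesis by (auto simp: prod_eq_iff)
  qed
  have "complex_of_real (\<Sum>z\<in>res m \<times> res m. (cmod (dft m f z))\<^sup>2) =
      (\<Sum>z\<in>res m \<times> res m. dft m f z * cnj (dft m f z))"
    by (simp add: complex_norm_square[symmetric])
  also have "\<dots> = (\<Sum>z\<in>res m \<times> res m. \<Sum>v\<in>torus m. \<Sum>w\<in>torus m.
      of_real (f v * f w) * (om m (dot v z) * cnj (om m (dot w z))))"
    by (simp add: dft_def sum_product algebra_simps)
  also have "\<dots> = (\<Sum>v\<in>torus m. \<Sum>w\<in>torus m. \<Sum>z\<in>res m \<times> res m. 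
      of_real (f v * f w) * (om m (dot v z) * cnj (om m (dot w z))))"
    by (subst sum.swap) (intro sum.cong refl, subst sum.swap, rule refl)
  also have "\<dots> = (\<Sum>v\<in>torus m. \<Sum>w\<in>torus m. 
      of_real (f v * f w) * (if v = w then of_nat (m * m) else 0))"
    by (intro sum.cong refl) (simp only: sum_distrib_left[symmetric] orth)
  also have "\<dots> = (\<Sum>v\<in>torus m. of_real (f v * f v) * of_nat (m * m))"
    by (intro sum.cong refl) (simp add: if_distrib sum.delta' cong: if_cong)
  also have "\<dots> = complex_of_real (of_nat (m * m) * (\<Sum>v\<in>torus m. (f v)\<^sup>2))"
    by (simp add: sum_distrib_left power2_eq_square mult_ac)
  finally show ?thesis by (simp only: of_real_eq_iff)
qed

text \<open>Substituting \<open>gen m a v\<close> for \<open>v\<close> moves the generator to the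
  frequency side: a translation becomes a phase, a shear becomes the transposed shear of the
  frequencies.\<close>

lemma dft_gen:
  assumes m: "m > 0"
    and dot: "\<And>v. v \<in> torus m \<Longrightarrow> dot (gen m a v) z mod int m = (dot v z' + c) mod int m"
  shows "dft m f z = om m c * dft m (\<lambda>v. f (gen m a v)) z'"
proof -
  have "dft m f z = (\<Sum>v\<in>torus m. of_real (f (gen m a v)) * om m (dot (gen m a v) z))"
    unfolding dft_def by (rule sum_gen[symmetric])
  also have "\<dots> = (\<Sum>v\<in>torus m. of_real (f (gen m a v)) * om m (dot v z' + c))"
    by (intro sum.cong refl) (simp add: om_cong[OF m dot])
  finally show ?thesis
    by (simp add: dft_def om_add sum_distrib_left mult_ac)
qed

lemma dft_periodic:
  assumes m: "m > 0" and "a mod int m = a' mod int m" "b mod int m = b' mod int m"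
  shows "dft m f (a, b) = dft m f (a', b')"
proof -
  have "om m (dot v (a, b)) = om m (dot v (a', b'))" for v
    unfolding dot_def using assms(2,3)
    by (intro om_cong[OF m]) (auto intro!: mod_add_cong mod_mult_cong)
  thus ?thesis by (simp add: dft_def)
qed

text \<open>The angle \<open>th\<close> lies between pi/3 and pi in absolute value, where the
  squared distance \<open>2 - 2 * cos th\<close> is at least 1.\<close>

lemma norm_om_minus_one_ge:
  assumes m: "m > 0" and j: "j \<in> res m" "6 * \<bar>j\<bar> \<ge> int m"
  shows "(cmod (1 - om m j))\<^sup>2 \<ge> 1"
proof -
  define th where "th = 2 * pi * of_int j / of_nat m"
  have "of_int (6 * \<bar>j\<bar>) \<ge> (of_int (int m) :: real)" using j(2) by (simp only: of_int_le_iff)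
  hence j6: "6 * \<bar>real_of_int j\<bar> \<ge> real m" by simp
  have "of_int (2 * \<bar>j\<bar>) \<le> (of_int (int m) :: real)" using j(1) by (simp only: of_int_le_iff res_iff) linarith
  hence j2: "2 * \<bar>real_of_int j\<bar> \<le> real m" by simp
  have abs: "\<bar>th\<bar> = 2 * pi * \<bar>real_of_int j\<bar> / real m" unfolding th_def by (simp add: abs_mult)
  have "pi / 3 \<le> \<bar>th\<bar>" using j6 m unfolding abs by (simp add: field_simps)
  moreover have "\<bar>th\<bar> \<le> pi" using j2 m unfolding abs by (simp add: field_simps)
  ultimately have "cos \<bar>th\<bar> \<le> cos (pi / 3)" by (intro cos_monotone_0_pi_le) auto
  hence c: "cos th \<le> 1 / 2" by (simp add: cos_60)
  have "(cmod (1 - om m j))\<^sup>2 = (1 - cos th)\<^sup>2 + (sin th)\<^sup>2"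
    unfolding om_def th_def[symmetric] by (simp add: cmod_power2)
  also have "\<dots> = 2 - 2 * cos th" using sin_cos_squared_add[of th] by (simp add: power2_eq_square algebra_simps)
  finally show ?thesis using c by simp
qed

text \<open>The shears \<open>(a, b) \<mapsto> (a, b \<plusminus> 2 a)\<close> map the cone \<open>\<bar>b\<bar> < \<bar>a\<bar>\<close> into two disjoint parts of
  the cone \<open>\<bar>a\<bar> < \<bar>b\<bar>\<close>.\<close>

lemma ping_pong:
  fixes \<mu> :: "int \<times> int \<Rightarrow> real" and m :: nat
  assumes nonneg: "\<And>z. \<mu> z \<ge> 0"
  defines "Bx \<equiv> {z. 6 * \<bar>fst z\<bar> < int m \<and> 6 * \<bar>snd z\<bar> < int m}"
  shows "2 * (\<Sum>z\<in>{z\<in>Bx. \<bar>snd z\<bar> < \<bar>fst z\<bar>}. \<mu> z) +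
     (\<Sum>z\<in>{z\<in>Bx. fst z = snd z \<and> fst z \<noteq> 0}. \<mu> z) + (\<Sum>z\<in>{z\<in>Bx. fst z = - snd z \<and> fst z \<noteq> 0}. \<mu> z)
   \<le> (\<Sum>z\<in>{z\<in>res m \<times> res m. \<bar>fst z\<bar> < \<bar>snd z\<bar>}. \<mu> z) +
     2 * (\<Sum>z\<in>res m \<times> res m. \<bar>\<mu> z - \<mu> (fst z, snd z + 2 * fst z)\<bar>)"
proof -
  define S where "S = (\<lambda>z::int \<times> int. (fst z, snd z + 2 * fst z))"
  define S' where "S' = (\<lambda>z::int \<times> int. (fst z, snd z - 2 * fst z))"
  let ?R = "res m \<times> res m"
  let ?D = "\<Sum>z\<in>?R. \<bar>\<mu> z - \<mu> (S z)\<bar>"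
  define A where "A = {z\<in>Bx. \<bar>snd z\<bar> < \<bar>fst z\<bar>}"
  define P where "P = {z\<in>Bx. fst z = snd z \<and> fst z \<noteq> 0}"
  define M where "M = {z\<in>Bx. fst z = - snd z \<and> fst z \<noteq> 0}"
  have fR: "finite ?R" by simp
  have BxR: "Bx \<subseteq> ?R" unfolding Bx_def by (auto simp: res_iff)
  hence fin: "finite A" "finite P" "finite M" unfolding A_def P_def M_def
    using finite_subset[OF BxR fR] by auto
  have disj: "A \<inter> P = {}" "A \<inter> M = {}" by (auto simp: A_def P_def M_def)
  have injS: "inj S" "inj S'" by (auto simp: inj_def S_def S'_def prod_eq_iff)
  have SS': "S (S' z) = z" for z by (simp add: S_def S'_def)
  \<comment> \<open>The diagonal \<open>P\<close> goes with \<open>S\<close> and the antidiagonal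
    \<open>M\<close> with \<open>S'\<close>, since these take \<open>(a, a)\<close> to
    \<open>(a, 3 a)\<close> and \<open>(a, - a)\<close> to \<open>(a, - 3 a)\<close>, away from the
    diagonals.\<close>
  have 1: "sum \<mu> A + sum \<mu> P \<le> sum \<mu> (S ` (A \<union> P)) + ?D"
  proof -
    have "sum \<mu> A + sum \<mu> P = sum \<mu> (A \<union> P)" using fin disj by (simp add: sum.union_disjoint)
    also have "\<dots> \<le> (\<Sum>z\<in>A \<union> P. \<mu> (S z) + \<bar>\<mu> z - \<mu> (S z)\<bar>)"
      by (intro sum_mono) linarith
    also have "\<dots> = sum \<mu> (S ` (A \<union> P)) + (\<Sum>z\<in>A \<union> P. \<bar>\<mu> z - \<mu> (S z)\<bar>)"
      using injS(1) by (simp add: sum.distrib sum.reindex inj_on_subset[OF injS(1)])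
    also have "(\<Sum>z\<in>A \<union> P. \<bar>\<mu> z - \<mu> (S z)\<bar>) \<le> ?D"
      using BxR by (intro sum_mono2 fR) (auto simp: A_def P_def)
    finally show ?thesis by simp
  qed
  \<comment> \<open>The factor 6 in \<open>Bx\<close> enters here:
    \<open>\<bar>b\<bar> + 2 * \<bar>a\<bar>\<close> stays below \<open>m / 2\<close>, so a sheared
    frequency is again a representative in \<open>res m\<close> and no reduction modulo
    \<open>m\<close> occurs.\<close>
  have SR: "S' ` (A \<union> M) \<subseteq> {z\<in>?R. \<bar>fst z\<bar> < \<bar>snd z\<bar>}"
    unfolding A_def M_def S'_def Bx_def by (auto simp: res_iff)
  have SR2: "S ` (A \<union> P) \<subseteq> {z\<in>?R. \<bar>fst z\<bar> < \<bar>snd z\<bar>}"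
    unfolding A_def P_def S_def Bx_def by (auto simp: res_iff)
  \<comment> \<open>The error of \<open>S'\<close> at \<open>z\<close> is the error of
    \<open>S\<close> at \<open>S' z\<close>, so the same sum \<open>?D\<close> serves for both
    shears.\<close>
  have 2: "sum \<mu> A + sum \<mu> M \<le> sum \<mu> (S' ` (A \<union> M)) + ?D"
  proof -
    have "sum \<mu> A + sum \<mu> M = sum \<mu> (A \<union> M)" using fin disj by (simp add: sum.union_disjoint)
    also have "\<dots> \<le> (\<Sum>z\<in>A \<union> M. \<mu> (S' z) + \<bar>\<mu> (S' z) - \<mu> (S (S' z))\<bar>)"
      unfolding SS' by (intro sum_mono) linarith
    also have "\<dots> = sum \<mu> (S' ` (A \<union> M)) + (\<Sum>z\<in>S' ` (A \<union> M). \<bar>\<mu> z - \<mu> (S z)\<bar>)"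
      using injS(2) by (simp add: sum.distrib sum.reindex inj_on_subset[OF injS(2)])
    also have "(\<Sum>z\<in>S' ` (A \<union> M). \<bar>\<mu> z - \<mu> (S z)\<bar>) \<le> ?D"
      using SR by (intro sum_mono2 fR) auto
    finally show ?thesis by simp
  qed
  \<comment> \<open>The sign of the product of the coordinates separates the two images.\<close>
  have pos: "fst z * snd z > 0" if "z \<in> S ` (A \<union> P)" for z
    using that unfolding A_def P_def S_def by (auto simp: zero_less_mult_iff)
  have neg: "fst z * snd z < 0" if "z \<in> S' ` (A \<union> M)" for z
    using that unfolding A_def M_def S'_def by (auto simp: mult_less_0_iff)
  have "S ` (A \<union> P) \<inter> S' ` (A \<union> M) = {}"
    using pos neg by (meson disjoint_iff not_less_iff_gr_or_eq)
  hence "sum \<mu> (S ` (A \<union> P)) + sum \<mu> (S' ` (A \<union> M)) = sum \<mu> (S ` (A \<union> P) \<union> S' ` (A \<union> M))"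
    using fin by (simp add: sum.union_disjoint)
  also have "\<dots> \<le> sum \<mu> {z\<in>?R. \<bar>fst z\<bar> < \<bar>snd z\<bar>}"
    using SR SR2 nonneg by (intro sum_mono2) auto
  finally show ?thesis using 1 2 unfolding A_def P_def M_def S_def by simp
qed

text \<open>The difference of squares is at most \<open>d * s\<close>, which weighted AM-GM splits.
  The weights 8 and 1/16 leave an energy term small enough to be absorbed in
  \<open>torus_gap\<close>.\<close>

lemma sum_square_diff_le:
  fixes u v :: "'b \<Rightarrow> complex"
  shows "(\<Sum>z\<in>R. \<bar>(cmod (u z))\<^sup>2 - (cmod (v z))\<^sup>2\<bar>)
    \<le> 8 * (\<Sum>z\<in>R. (cmod (u z - v z))\<^sup>2) + ((\<Sum>z\<in>R. (cmod (u z))\<^sup>2) + (\<Sum>z\<in>R. (cmod (v z))\<^sup>2)) / 16"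
proof -
  have "\<bar>(cmod a)\<^sup>2 - (cmod b)\<^sup>2\<bar> \<le> 8 * (cmod (a - b))\<^sup>2 + ((cmod a)\<^sup>2 + (cmod b)\<^sup>2) / 16" for a b
  proof -
    define d where "d = cmod (a - b)"
    define s where "s = cmod a + cmod b"
    have "\<bar>cmod a - cmod b\<bar> \<le> d" unfolding d_def by (rule norm_triangle_ineq3)
    hence "\<bar>(cmod a)\<^sup>2 - (cmod b)\<^sup>2\<bar> \<le> d * s"
      unfolding s_def by (simp add: power2_eq_square square_diff_square_factored abs_mult mult_left_mono mult.commute[of d])
    also have "d * s \<le> 8 * d\<^sup>2 + s\<^sup>2 / 32"
      using zero_le_power2[of "16 * d - s"] by (simp add: power2_eq_square algebra_simps)
    also have "s\<^sup>2 \<le> 2 * ((cmod a)\<^sup>2 + (cmod b)\<^sup>2)"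
      using zero_le_power2[of "cmod a - cmod b"] unfolding s_def by (simp add: power2_eq_square algebra_simps)
    finally show ?thesis by (simp add: d_def field_simps)
  qed
  hence "(\<Sum>z\<in>R. \<bar>(cmod (u z))\<^sup>2 - (cmod (v z))\<^sup>2\<bar>)
    \<le> (\<Sum>z\<in>R. 8 * (cmod (u z - v z))\<^sup>2 + ((cmod (u z))\<^sup>2 + (cmod (v z))\<^sup>2) / 16)"
    by (intro sum_mono)
  thus ?thesis by (simp add: sum.distrib sum_distrib_left sum_divide_distrib add_divide_distrib)
qed

lemma res_sum_shear:
  fixes h :: "int \<times> int \<Rightarrow> real"
  assumes m: "m > 0" and per: "\<And>a. periodic m (\<lambda>b. h (a, b))"
  shows "(\<Sum>z\<in>res m \<times> res m. h (fst z, snd z + 2 * fst z)) = (\<Sum>z\<in>res m \<times> res m. h z)"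
proof -
  have "(\<Sum>a\<in>res m. \<Sum>b\<in>res m. h (a, b + 2 * a)) = (\<Sum>a\<in>res m. \<Sum>b\<in>res m. h (a, b))"
    by (rule sum.cong[OF refl]) (rule res_sum_shift[OF m per])
  thus ?thesis by (simp add: sum.cartesian_product case_prod_beta)
qed

lemma sum_res_swap: "(\<Sum>z\<in>res m \<times> res m. h (prod.swap z)) = (\<Sum>z\<in>res m \<times> res m. h z)"
  by (rule sum.reindex_bij_witness[of _ prod.swap prod.swap]) auto

text \<open>A translation acts on the transform by a phase, so the difference acts, up to a phase,
  as multiplication by \<open>1 - om m (c z)\<close>.\<close>

lemma energy_translation:
  assumes "\<And>z. dft m f z = om m (c z) * dft m (\<lambda>v. f (gen m a v)) z"
  shows "(\<Sum>z\<in>R. (cmod (dft m (\<lambda>v. f v - f (gen m a v)) z))\<^sup>2) =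
    (\<Sum>z\<in>R. (cmod (dft m f z))\<^sup>2 * (cmod (1 - om m (c z)))\<^sup>2)"
proof (rule sum.cong[OF refl])
  fix z
  let ?g = "dft m (\<lambda>v. f (gen m a v)) z"
  have "dft m (\<lambda>v. f v - f (gen m a v)) z = - (1 - om m (c z)) * ?g"
    unfolding dft_diff using assms[of z] by (simp add: algebra_simps)
  hence "cmod (dft m (\<lambda>v. f v - f (gen m a v)) z) = cmod (1 - om m (c z)) * cmod ?g"
    by (simp add: norm_mult norm_minus_commute)
  moreover have "cmod (dft m f z) = cmod ?g" unfolding assms[of z] by (simp add: norm_mult)
  ultimately show "(cmod (dft m (\<lambda>v. f v - f (gen m a v)) z))\<^sup>2 =
    (cmod (dft m f z))\<^sup>2 * (cmod (1 - om m (c z)))\<^sup>2" by (simp add: power_mult_distrib)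
qed

text \<open>With \<open>\<sigma> = prod.swap\<close> this covers the shear in the other coordinate.\<close>

lemma energy_shear:
  fixes \<sigma> :: "int \<times> int \<Rightarrow> int \<times> int"
  assumes m: "m > 0" and \<sigma>: "\<sigma> = (\<lambda>z. z) \<or> \<sigma> = prod.swap"
    and dual: "\<And>z. dft m f (\<sigma> z) = dft m (\<lambda>v. f (gen m a v)) (\<sigma> (fst z, snd z + 2 * fst z))"
  defines "\<mu> \<equiv> \<lambda>z. (cmod (dft m f z))\<^sup>2" and "R \<equiv> res m \<times> res m"
  shows "(\<Sum>z\<in>R. \<bar>\<mu> (\<sigma> z) - \<mu> (\<sigma> (fst z, snd z + 2 * fst z))\<bar>)
    \<le> 8 * (\<Sum>z\<in>R. (cmod (dft m (\<lambda>v. f v - f (gen m a v)) z))\<^sup>2) + sum \<mu> R / 8"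
proof -
  have \<sigma>_sum: "(\<Sum>z\<in>R. h (\<sigma> z)) = sum h R" for h :: "int \<times> int \<Rightarrow> real"
    using \<sigma> sum_res_swap[of h m] by (auto simp: R_def)
  have shear_sum: "(\<Sum>z\<in>R. (cmod (dft m g (\<sigma> (fst z, snd z + 2 * fst z))))\<^sup>2) = (\<Sum>z\<in>R. (cmod (dft m g z))\<^sup>2)" for g
  proof -
    have "(\<Sum>z\<in>R. (cmod (dft m g (\<sigma> (fst z, snd z + 2 * fst z))))\<^sup>2) = (\<Sum>z\<in>R. (cmod (dft m g (\<sigma> z)))\<^sup>2)"
      unfolding R_def using \<sigma>
      by (intro res_sum_shear[OF m]) (auto simp: periodic_def intro!: arg_cong[of _ _ cmod] dft_periodic[OF m])
    thus ?thesis using \<sigma>_sum[of "\<lambda>z. (cmod (dft m g z))\<^sup>2"] by simp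
  qed
  have "(\<Sum>z\<in>R. \<bar>\<mu> (\<sigma> z) - \<mu> (\<sigma> (fst z, snd z + 2 * fst z))\<bar>) \<le>
    8 * (\<Sum>z\<in>R. (cmod (dft m f (\<sigma> z) - dft m f (\<sigma> (fst z, snd z + 2 * fst z))))\<^sup>2) +
    ((\<Sum>z\<in>R. \<mu> (\<sigma> z)) + (\<Sum>z\<in>R. \<mu> (\<sigma> (fst z, snd z + 2 * fst z)))) / 16"
    unfolding \<mu>_def by (rule sum_square_diff_le)
  also have "(\<Sum>z\<in>R. (cmod (dft m f (\<sigma> z) - dft m f (\<sigma> (fst z, snd z + 2 * fst z))))\<^sup>2) =
     (\<Sum>z\<in>R. (cmod (dft m (\<lambda>v. f v - f (gen m a v)) (\<sigma> (fst z, snd z + 2 * fst z))))\<^sup>2)"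
    by (intro sum.cong refl) (simp add: dft_diff dual norm_minus_commute)
  finally show ?thesis using \<sigma>_sum[of \<mu>] shear_sum[of f] shear_sum[of "\<lambda>v. f v - f (gen m a v)"]
    by (simp add: \<mu>_def)
qed

lemma mod_mult_add_cong:
  fixes u M a w :: int
  shows "(u mod M * a + w) mod M = (u * a + w) mod M" "(w + u mod M * a) mod M = (w + u * a) mod M"
  by (intro mod_add_cong mod_mult_cong refl mod_mod_trivial)+

text \<open>A Poincare inequality with a constant independent of \<open>m\<close>. The Fourier
  energy splits into two open cones inside the box \<open>Bx\<close>, the diagonals, and the part
  outside \<open>Bx\<close>. The last is paid for by the translations; ping-pong in both coordinates
  makes the energy of each cone, up to errors, at most half that of the other.\<close>

lemma torus_gap:
  fixes f :: "nat \<times> nat \<Rightarrow> real"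
  assumes m: "m > 0" and mean: "sum f (torus m) = 0"
  shows "(\<Sum>v\<in>torus m. (f v)\<^sup>2) \<le> 32 * (\<Sum>a\<in>{1,2,3,4}. \<Sum>v\<in>torus m. (f v - f (gen m a v))\<^sup>2)"
proof -
  let ?R = "res m \<times> res m"
  define F where "F = dft m f"
  define \<mu> where "\<mu> = (\<lambda>z. (cmod (F z))\<^sup>2)"
  define T where "T = sum \<mu> ?R"
  define e where "e = (\<lambda>a. \<Sum>z\<in>?R. (cmod (dft m (\<lambda>v. f v - f (gen m a v)) z))\<^sup>2)"
  have F0: "F (0, 0) = 0"
    using mean by (simp add: F_def dft_def dot_def flip: of_real_sum)
  have \<mu>0: "\<mu> z \<ge> 0" for z by (simp add: \<mu>_def)
  have t1: "dft m f z = om m (fst z) * dft m (\<lambda>v. f (gen m 1 v)) z" for z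
    by (rule dft_gen[OF m]) (auto simp: gen_def dot_def zmod_int mod_mult_add_cong, simp add: algebra_simps)
  have t2: "dft m f z = om m (snd z) * dft m (\<lambda>v. f (gen m 2 v)) z" for z
    by (rule dft_gen[OF m]) (auto simp: gen_def dot_def zmod_int mod_mult_add_cong, simp add: algebra_simps)
  have t3: "dft m f z = om m 0 * dft m (\<lambda>v. f (gen m 3 v)) (fst z, snd z + 2 * fst z)" for z
    by (rule dft_gen[OF m]) (auto simp: gen_def dot_def zmod_int mod_mult_add_cong, simp add: algebra_simps)
  have t4: "dft m f z = om m 0 * dft m (\<lambda>v. f (gen m 4 v)) (fst z + 2 * snd z, snd z)" for z
    by (rule dft_gen[OF m]) (auto simp: gen_def dot_def zmod_int mod_mult_add_cong, simp add: algebra_simps)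
  have e1: "e 1 = (\<Sum>z\<in>?R. \<mu> z * (cmod (1 - om m (fst z)))\<^sup>2)"
    unfolding e_def \<mu>_def F_def by (rule energy_translation[OF t1])
  have e2: "e 2 = (\<Sum>z\<in>?R. \<mu> z * (cmod (1 - om m (snd z)))\<^sup>2)"
    unfolding e_def \<mu>_def F_def by (rule energy_translation[OF t2])
  have shear: "(\<Sum>z\<in>?R. \<bar>\<mu> z - \<mu> (fst z, snd z + 2 * fst z)\<bar>) \<le> 8 * e 3 + T / 8"
    using energy_shear[OF m, of "\<lambda>z. z" f 3] t3 by (simp add: \<mu>_def T_def e_def F_def)
  have shear': "(\<Sum>z\<in>?R. \<bar>\<mu> (prod.swap z) - \<mu> (prod.swap (fst z, snd z + 2 * fst z))\<bar>) \<le> 8 * e 4 + T / 8"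
    using energy_shear[OF m, of prod.swap f 4] t4 by (simp add: \<mu>_def T_def e_def F_def)
  define Bx where "Bx = {z :: int \<times> int. 6 * \<bar>fst z\<bar> < int m \<and> 6 * \<bar>snd z\<bar> < int m}"
  define a where "a = sum \<mu> {z\<in>Bx. \<bar>snd z\<bar> < \<bar>fst z\<bar>}"
  define b where "b = sum \<mu> {z\<in>Bx. \<bar>fst z\<bar> < \<bar>snd z\<bar>}"
  define d where "d = sum \<mu> {z\<in>Bx. fst z = snd z \<and> fst z \<noteq> 0} + sum \<mu> {z\<in>Bx. fst z = - snd z \<and> fst z \<noteq> 0}"
  define out where "out = sum \<mu> (?R - Bx)"
  have BxR: "Bx \<subseteq> ?R" unfolding Bx_def by (auto simp: res_iff)
  hence finB: "finite Bx" by (rule finite_subset) simp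
  have out: "out \<le> e 1 + e 2"
  proof -
    have "out \<le> (\<Sum>z\<in>?R - Bx. \<mu> z * (cmod (1 - om m (fst z)))\<^sup>2 + \<mu> z * (cmod (1 - om m (snd z)))\<^sup>2)"
      unfolding out_def
    proof (rule sum_mono)
      fix z assume z: "z \<in> ?R - Bx"
      hence "(cmod (1 - om m (fst z)))\<^sup>2 \<ge> 1 \<or> (cmod (1 - om m (snd z)))\<^sup>2 \<ge> 1"
        using norm_om_minus_one_ge[OF m] unfolding Bx_def by (auto simp: not_less)
      hence "1 \<le> (cmod (1 - om m (fst z)))\<^sup>2 + (cmod (1 - om m (snd z)))\<^sup>2"
        by (smt (verit) zero_le_power2)
      from mult_left_mono[OF this \<mu>0[of z]]
      show "\<mu> z \<le> \<mu> z * (cmod (1 - om m (fst z)))\<^sup>2 + \<mu> z * (cmod (1 - om m (snd z)))\<^sup>2"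
        by (simp add: ring_distribs)
    qed
    also have "\<dots> \<le> (\<Sum>z\<in>?R. \<mu> z * (cmod (1 - om m (fst z)))\<^sup>2 + \<mu> z * (cmod (1 - om m (snd z)))\<^sup>2)"
      using \<mu>0 by (intro sum_mono2) auto
    finally show ?thesis unfolding e1 e2 by (simp only: sum.distrib)
  qed
  have halfA: "sum \<mu> {z\<in>?R. \<bar>fst z\<bar> < \<bar>snd z\<bar>} \<le> b + out"
  proof -
    have "sum \<mu> {z\<in>?R. \<bar>fst z\<bar> < \<bar>snd z\<bar>} \<le> sum \<mu> ({z\<in>Bx. \<bar>fst z\<bar> < \<bar>snd z\<bar>} \<union> (?R - Bx))"
      using \<mu>0 finB by (intro sum_mono2) auto
    also have "\<dots> = b + out" unfolding b_def out_def using finB by (intro sum.union_disjoint) auto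
    finally show ?thesis .
  qed
  have halfB: "sum (\<lambda>z. \<mu> (prod.swap z)) {z\<in>?R. \<bar>fst z\<bar> < \<bar>snd z\<bar>} \<le> a + out"
  proof -
    have "sum (\<lambda>z. \<mu> (prod.swap z)) {z\<in>?R. \<bar>fst z\<bar> < \<bar>snd z\<bar>} = sum \<mu> {z\<in>?R. \<bar>snd z\<bar> < \<bar>fst z\<bar>}"
      by (rule sum.reindex_bij_witness[of _ prod.swap prod.swap]) auto
    also have "\<dots> \<le> sum \<mu> ({z\<in>Bx. \<bar>snd z\<bar> < \<bar>fst z\<bar>} \<union> (?R - Bx))"
      using \<mu>0 finB by (intro sum_mono2) auto
    also have "\<dots> = a + out" unfolding a_def out_def using finB by (intro sum.union_disjoint) auto
    finally show ?thesis .
  qed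
  have I: "2 * a + d \<le> b + out + 2 * (8 * e 3 + T / 8)"
    using ping_pong[of \<mu> m, OF \<mu>0] halfA shear unfolding a_def d_def Bx_def by simp
  have II: "2 * b + d \<le> a + out + 2 * (8 * e 4 + T / 8)"
  proof -
    have sb: "sum (\<lambda>z. \<mu> (prod.swap z)) {z\<in>Bx. \<bar>snd z\<bar> < \<bar>fst z\<bar>} = b" unfolding b_def
      by (rule sum.reindex_bij_witness[of _ prod.swap prod.swap]) (auto simp: Bx_def)
    have sp: "sum (\<lambda>z. \<mu> (prod.swap z)) {z\<in>Bx. fst z = snd z \<and> fst z \<noteq> 0} = sum \<mu> {z\<in>Bx. fst z = snd z \<and> fst z \<noteq> 0}"
      by (rule sum.reindex_bij_witness[of _ prod.swap prod.swap]) (auto simp: Bx_def)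
    have sm: "sum (\<lambda>z. \<mu> (prod.swap z)) {z\<in>Bx. fst z = - snd z \<and> fst z \<noteq> 0} = sum \<mu> {z\<in>Bx. fst z = - snd z \<and> fst z \<noteq> 0}"
      by (rule sum.reindex_bij_witness[of _ prod.swap prod.swap]) (auto simp: Bx_def)
    have "2 * b + d \<le> sum (\<lambda>z. \<mu> (prod.swap z)) {z\<in>?R. \<bar>fst z\<bar> < \<bar>snd z\<bar>} +
        2 * (\<Sum>z\<in>?R. \<bar>\<mu> (prod.swap z) - \<mu> (prod.swap (fst z, snd z + 2 * fst z))\<bar>)"
      using ping_pong[of "\<lambda>z. \<mu> (prod.swap z)" m, OF \<mu>0]
      unfolding Bx_def[symmetric] sb sp sm d_def by (simp only: add.assoc)
    also have "\<dots> \<le> (a + out) + 2 * (8 * e 4 + T / 8)"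
      by (intro add_mono mult_left_mono halfB shear') simp
    finally show ?thesis .
  qed
  have Tsum: "T \<le> a + b + d + out"
  proof -
    let ?A = "{z\<in>Bx. \<bar>snd z\<bar> < \<bar>fst z\<bar>}" and ?B = "{z\<in>Bx. \<bar>fst z\<bar> < \<bar>snd z\<bar>}"
    let ?P = "{z\<in>Bx. fst z = snd z \<and> fst z \<noteq> 0}" and ?M = "{z\<in>Bx. fst z = - snd z \<and> fst z \<noteq> 0}"
    have "T = sum \<mu> (?R - {(0, 0)})"
      unfolding T_def by (rule sum.mono_neutral_right) (auto simp: \<mu>_def F0)
    also have "\<dots> \<le> sum \<mu> (((?A \<union> ?B) \<union> (?P \<union> ?M)) \<union> (?R - Bx))"
      using \<mu>0 finB by (intro sum_mono2) auto
    also have "sum \<mu> (((?A \<union> ?B) \<union> (?P \<union> ?M)) \<union> (?R - Bx)) = sum \<mu> ((?A \<union> ?B) \<union> (?P \<union> ?M)) + out"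
      unfolding out_def using finB by (intro sum.union_disjoint) auto
    also have "sum \<mu> ((?A \<union> ?B) \<union> (?P \<union> ?M)) = sum \<mu> (?A \<union> ?B) + sum \<mu> (?P \<union> ?M)"
      using finB by (intro sum.union_disjoint) auto
    also have "sum \<mu> (?A \<union> ?B) = a + b" unfolding a_def b_def using finB by (intro sum.union_disjoint) auto
    also have "sum \<mu> (?P \<union> ?M) = d" unfolding d_def using finB by (intro sum.union_disjoint) auto
    finally show ?thesis by simp
  qed
  have d0: "d \<ge> 0" unfolding d_def using \<mu>0 by (simp add: sum_nonneg)
  have e0: "e i \<ge> 0" for i unfolding e_def by (simp add: sum_nonneg)
  have "T \<le> 32 * (e 1 + e 2 + e 3 + e 4)"
  proof -
    \<comment> \<open>The two ping-pong inequalities add up to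
      \<open>a + b + 2 * d \<le> 2 * out + 16 * (e3 + e4) + T / 2\<close>. Inserted into
      \<open>Tsum\<close> this absorbs \<open>T / 2\<close> and gives
      \<open>T \<le> 6 * out + 32 * (e3 + e4)\<close>.\<close>
    have lin: "T \<le> 32 * (e1 + e2 + e3 + e4)"
      if "2 * a + d \<le> b + out + 2 * (8 * e3 + T / 8)" "2 * b + d \<le> a + out + 2 * (8 * e4 + T / 8)"
        "out \<le> e1 + e2" "0 \<le> e1" "0 \<le> e2" for e1 e2 e3 e4
      using that Tsum d0 by (simp add: field_simps)
    show ?thesis by (rule lin[OF I II out e0 e0])
  qed
  moreover have "T = of_nat (m * m) * (\<Sum>v\<in>torus m. (f v)\<^sup>2)"
    unfolding T_def \<mu>_def F_def by (rule parseval[OF m])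
  moreover have "e i = of_nat (m * m) * (\<Sum>v\<in>torus m. (f v - f (gen m i v))\<^sup>2)" for i
    unfolding e_def by (rule parseval[OF m])
  ultimately have "real (m * m) * (\<Sum>v\<in>torus m. (f v)\<^sup>2) \<le>
     real (m * m) * (32 * (\<Sum>a\<in>{1,2,3,4}. \<Sum>v\<in>torus m. (f v - f (gen m a v))\<^sup>2))"
    by (simp add: algebra_simps)
  moreover have "real (m * m) > 0" using m by simp
  ultimately show ?thesis by (simp only: mult_le_cancel_left_pos)
qed

subsection \<open>Random walks\<close>

definition lists_of :: "'a set \<Rightarrow> nat \<Rightarrow> 'a list set" where
  "lists_of A n = {xs. set xs \<subseteq> A \<and> length xs = n}"

lemma finite_lists_of: "finite A \<Longrightarrow> finite (lists_of A n)"
  by (simp add: lists_of_def finite_lists_length_eq)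

lemma card_lists_of: "finite A \<Longrightarrow> card (lists_of A n) = card A ^ n"
  by (simp add: lists_of_def card_lists_length_eq)

lemma lists_of_0: "lists_of A 0 = {[]}"
  by (auto simp: lists_of_def)

lemma sum_lists_of_Suc:
  assumes "finite A"
  shows "(\<Sum>xs\<in>lists_of A (Suc n). h xs) = (\<Sum>x\<in>A. \<Sum>xs\<in>lists_of A n. h (x # xs))"
proof -
  have "lists_of A (Suc n) = (\<lambda>(x, xs). x # xs) ` (A \<times> lists_of A n)"
    by (auto simp: lists_of_def image_iff length_Suc_conv)
  moreover have "inj_on (\<lambda>(x, xs). x # xs) (A \<times> lists_of A n)"
    by (auto simp: inj_on_def)
  ultimately show ?thesis
    by (simp add: sum.reindex sum.cartesian_product comp_def split_def)
qed

definition avg_op :: "nat \<Rightarrow> (nat \<times> nat \<Rightarrow> real) \<Rightarrow> nat \<times> nat \<Rightarrow> real" where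
  "avg_op m f v = (\<Sum>a<5. f (gen m a v)) / 5"

lemma sum_avg_op: "sum (avg_op m f) (torus m) = sum f (torus m)"
proof -
  have "sum (avg_op m f) (torus m) = (\<Sum>a<5. \<Sum>v\<in>torus m. f (gen m a v)) / 5"
    unfolding avg_op_def by (simp add: sum_divide_distrib[symmetric] sum.swap[of _ "torus m"])
  thus ?thesis by (simp add: sum_gen)
qed

text \<open>The mean of five squares exceeds the square of the mean by 1/25 of the sum of all
  squared differences. Keeping the four differences that involve \<open>f v\<close> and inserting
  \<open>torus_gap\<close> gives the factor \<open>1 - 1 / (25 * 32)\<close>.\<close>

lemma avg_op_contraction:
  assumes m: "m > 0" and mean: "sum f (torus m) = 0"
  shows "(\<Sum>v\<in>torus m. (avg_op m f v)\<^sup>2) \<le> 799 / 800 * (\<Sum>v\<in>torus m. (f v)\<^sup>2)"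
proof -
  have five: "{..<5::nat} = {0,1,2,3,4}" by auto
  have alg: "((x0 + x1 + x2 + x3 + x4) / 5)\<^sup>2 \<le>
      (x0\<^sup>2 + x1\<^sup>2 + x2\<^sup>2 + x3\<^sup>2 + x4\<^sup>2) / 5
      - ((x0 - x1)\<^sup>2 + (x0 - x2)\<^sup>2 + (x0 - x3)\<^sup>2 + (x0 - x4)\<^sup>2) / 25" for x0 x1 x2 x3 x4 :: real
  proof -
    have "0 \<le> (x1 - x2)\<^sup>2 + (x1 - x3)\<^sup>2 + (x1 - x4)\<^sup>2 + (x2 - x3)\<^sup>2 + (x2 - x4)\<^sup>2 + (x3 - x4)\<^sup>2"
      by simp
    thus ?thesis by (simp add: power2_eq_square field_simps)
  qed
  have "(\<Sum>v\<in>torus m. (avg_op m f v)\<^sup>2) \<le> (\<Sum>v\<in>torus m. (\<Sum>a<5. (f (gen m a v))\<^sup>2) / 5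
      - (\<Sum>a\<in>{1,2,3,4}. (f v - f (gen m a v))\<^sup>2) / 25)"
  proof (rule sum_mono)
    fix v
    have g0: "gen m 0 v = v" by (simp add: gen_def case_prod_beta)
    show "(avg_op m f v)\<^sup>2 \<le> (\<Sum>a<5. (f (gen m a v))\<^sup>2) / 5
      - (\<Sum>a\<in>{1,2,3,4}. (f v - f (gen m a v))\<^sup>2) / 25"
      using alg[of "f v" "f (gen m 1 v)" "f (gen m 2 v)" "f (gen m 3 v)" "f (gen m 4 v)"]
      unfolding avg_op_def five by (simp add: g0 add_ac)
  qed
  also have "\<dots> = (\<Sum>a<5. \<Sum>v\<in>torus m. (f (gen m a v))\<^sup>2) / 5
      - (\<Sum>a\<in>{1,2,3,4}. \<Sum>v\<in>torus m. (f v - f (gen m a v))\<^sup>2) / 25"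
    by (simp only: sum_subtractf sum_divide_distrib[symmetric] sum.swap[of _ "torus m"])
  also have "(\<Sum>a<5. \<Sum>v\<in>torus m. (f (gen m a v))\<^sup>2) = 5 * (\<Sum>v\<in>torus m. (f v)\<^sup>2)"
    using sum_gen[of "\<lambda>v. (f v)\<^sup>2" m] by simp
  finally show ?thesis using torus_gap[OF m mean] by linarith
qed

fun act :: "nat \<Rightarrow> nat list \<Rightarrow> nat \<times> nat \<Rightarrow> nat \<times> nat" where
  "act m [] v = v"
| "act m (a # w) v = act m w (gen m a v)"

lemma bij_betw_act: "bij_betw (act m w) (torus m) (torus m)"
proof (induction w)
  case Nil
  have "act m [] = id" by auto
  thus ?case by (simp only: bij_betw_id)
next
  case (Cons a w)
  have "act m (a # w) = act m w \<circ> gen m a" by auto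
  thus ?case by (simp only: bij_betw_trans[OF bij_betw_gen Cons.IH])
qed

definition wavg :: "nat \<Rightarrow> nat \<Rightarrow> (nat \<times> nat \<Rightarrow> real) \<Rightarrow> nat \<times> nat \<Rightarrow> real" where
  "wavg m t f v = (\<Sum>w\<in>lists_of {..<5} t. f (act m w v)) / 5 ^ t"

lemma wavg_0: "wavg m 0 f = f"
  by (auto simp: wavg_def lists_of_0)

lemma wavg_Suc: "wavg m (Suc t) f = avg_op m (wavg m t f)"
  by (auto simp: wavg_def avg_op_def sum_lists_of_Suc sum_divide_distrib[symmetric] mult.commute)

lemma sum_wavg: "sum (wavg m t f) (torus m) = sum f (torus m)"
  by (induction t) (simp_all add: wavg_0 wavg_Suc sum_avg_op)

lemma wavg_contraction:
  assumes m: "m > 0" and mean: "sum f (torus m) = 0"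
  shows "(\<Sum>v\<in>torus m. (wavg m t f v)\<^sup>2) \<le> (799 / 800) ^ t * (\<Sum>v\<in>torus m. (f v)\<^sup>2)"
proof (induction t)
  case (Suc t)
  have "(\<Sum>v\<in>torus m. (wavg m (Suc t) f v)\<^sup>2) \<le> 799 / 800 * (\<Sum>v\<in>torus m. (wavg m t f v)\<^sup>2)"
    unfolding wavg_Suc by (rule avg_op_contraction[OF m]) (simp add: sum_wavg mean)
  thus ?case using Suc by simp
qed (simp add: wavg_0)

lemma wavg_bounds:
  assumes "\<And>v. 0 \<le> f v \<and> f v \<le> 1"
  shows "0 \<le> wavg m t f v \<and> wavg m t f v \<le> 1"
proof -
  have "(\<Sum>w\<in>lists_of {..<5} t. f (act m w v)) \<le> (\<Sum>w\<in>lists_of {..<5::nat} t. 1)"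
    using assms by (intro sum_mono) auto
  also have "\<dots> = 5 ^ t" by (simp add: card_lists_of)
  finally show ?thesis using assms by (auto simp: wavg_def sum_nonneg)
qed

text \<open>The expander mixing lemma: Cauchy-Schwarz for \<open>F\<close> and the average of the
  centred function \<open>H\<close>. The bound is on \<open>\<kappa>\<^sup>2\<close> because the
  contraction is stated for squared norms.\<close>

lemma wavg_mixing:
  fixes \<kappa> :: real
  assumes m: "m > 0" and F: "\<And>v. 0 \<le> F v \<and> F v \<le> 1" and G: "\<And>v. 0 \<le> G v \<and> G v \<le> 1"
    and \<kappa>: "\<kappa> \<ge> 0" "(799 / 800) ^ t \<le> \<kappa>\<^sup>2"
  shows "\<bar>(\<Sum>v\<in>torus m. F v * wavg m t G v) / (m * m) -
     sum F (torus m) / (m * m) * (sum G (torus m) / (m * m))\<bar> \<le> \<kappa>"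
proof -
  define N where "N = real (m * m)"
  have N: "N > 0" "card (torus m) = N" using m by (auto simp: N_def card_torus)
  define g where "g = sum G (torus m) / N"
  have sG: "sum G (torus m) = g * N" using N by (simp add: g_def)
  define H where "H = (\<lambda>v. G v - g)"
  have H0: "sum H (torus m) = 0" unfolding H_def using N by (simp add: sum_subtractf g_def)
  have wH: "wavg m t H v = wavg m t G v - g" for v
    unfolding wavg_def H_def by (simp add: sum_subtractf card_lists_of diff_divide_distrib)
  have HN: "(\<Sum>v\<in>torus m. (H v)\<^sup>2) \<le> N"
  proof -
    have "(\<Sum>v\<in>torus m. (H v)\<^sup>2) = (\<Sum>v\<in>torus m. (G v)\<^sup>2 - 2 * g * G v + g\<^sup>2)"
      unfolding H_def by (simp add: power2_eq_square algebra_simps)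
    also have "\<dots> = (\<Sum>v\<in>torus m. (G v)\<^sup>2) - 2 * g * (g * N) + N * g\<^sup>2"
      using N sG by (simp add: sum.distrib sum_subtractf sum_distrib_left[symmetric])
    also have "\<dots> \<le> (\<Sum>v\<in>torus m. (G v)\<^sup>2)" using N by (simp add: power2_eq_square algebra_simps)
    also have "\<dots> \<le> (\<Sum>v\<in>torus m. 1)" using G by (intro sum_mono) (simp add: power_le_one)
    finally show ?thesis using N by simp
  qed
  have FN: "(\<Sum>v\<in>torus m. (F v)\<^sup>2) \<le> N"
  proof -
    have "(\<Sum>v\<in>torus m. (F v)\<^sup>2) \<le> (\<Sum>v\<in>torus m. 1)" using F by (intro sum_mono) (simp add: power_le_one)
    thus ?thesis using N by simp
  qed
  have "(\<Sum>v\<in>torus m. F v * wavg m t H v)\<^sup>2 \<le> (\<Sum>v\<in>torus m. (F v)\<^sup>2) * (\<Sum>v\<in>torus m. (wavg m t H v)\<^sup>2)"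
    by (rule Cauchy_Schwarz_ineq_sum)
  also have "\<dots> \<le> N * (\<kappa>\<^sup>2 * N)"
  proof (intro mult_mono FN)
    have "(\<Sum>v\<in>torus m. (wavg m t H v)\<^sup>2) \<le> (799 / 800) ^ t * (\<Sum>v\<in>torus m. (H v)\<^sup>2)"
      by (rule wavg_contraction[OF m H0])
    also have "\<dots> \<le> \<kappa>\<^sup>2 * N" using \<kappa> HN by (intro mult_mono) (auto simp: sum_nonneg)
    finally show "(\<Sum>v\<in>torus m. (wavg m t H v)\<^sup>2) \<le> \<kappa>\<^sup>2 * N" .
  qed (use N in \<open>auto simp: sum_nonneg\<close>)
  also have "\<dots> = (\<kappa> * N)\<^sup>2" by (simp add: power2_eq_square)
  finally have "\<bar>\<Sum>v\<in>torus m. F v * wavg m t H v\<bar> \<le> \<kappa> * N"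
    using \<kappa> N by (simp add: abs_le_square_iff[symmetric])
  moreover have "(\<Sum>v\<in>torus m. F v * wavg m t H v) = (\<Sum>v\<in>torus m. F v * wavg m t G v) - sum F (torus m) * g"
    by (simp add: wH right_diff_distrib sum_subtractf sum_distrib_right)
  ultimately have "\<bar>((\<Sum>v\<in>torus m. F v * wavg m t G v) - sum F (torus m) * g) / N\<bar> \<le> \<kappa>"
    using N by (simp add: abs_divide pos_divide_le_eq)
  thus ?thesis by (simp add: g_def N_def diff_divide_distrib)
qed

text \<open>The last word of the list has no effect; it is only there so that \<open>r\<close> words give an
  \<open>r\<close>-tuple.\<close>

fun walk :: "nat \<Rightarrow> nat list list \<Rightarrow> nat \<times> nat \<Rightarrow> (nat \<times> nat) list" where
  "walk m [] v = []"
| "walk m (w # ws) v = v # walk m ws (act m w v)"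

lemma length_walk [simp]: "length (walk m ws v) = length ws"
  by (induction ws arbitrary: v) auto

lemma bij_betw_walk:
  "p < length ws \<Longrightarrow> bij_betw (\<lambda>v. walk m ws v ! p) (torus m) (torus m)"
proof (induction ws arbitrary: p)
  case (Cons w ws)
  show ?case
  proof (cases p)
    case 0
    thus ?thesis using bij_betw_id[of "torus m"] by (simp add: id_def)
  next
    case (Suc p')
    have "bij_betw ((\<lambda>v. walk m ws v ! p') \<circ> act m w) (torus m) (torus m)"
      using Cons Suc by (intro bij_betw_trans[OF bij_betw_act]) auto
    thus ?thesis using Suc by (simp add: comp_def)
  qed
qed simp

definition walk_colours :: "nat \<Rightarrow> nat \<Rightarrow> nat list list set" where
  "walk_colours t r = lists_of (lists_of {..<5} t) r"

lemma finite_walk_colours [simp]: "finite (walk_colours t r)"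
  by (simp add: walk_colours_def finite_lists_of)

lemma card_walk_colours: "card (walk_colours t r) = (5 ^ t) ^ r"
  by (simp add: walk_colours_def card_lists_of finite_lists_of)

text \<open>Transfer operator form of the walk: weight, average over a word, repeat.
  \<open>walk_avg_eq\<close> identifies it with the mean over all colours, and the recursion makes
  \<open>walk_mixing\<close> an induction.\<close>

fun walk_avg :: "nat \<Rightarrow> nat \<Rightarrow> (nat \<times> nat \<Rightarrow> real) list \<Rightarrow> nat \<times> nat \<Rightarrow> real" where
  "walk_avg m t [] v = 1"
| "walk_avg m t (F # Fs) v = F v * wavg m t (walk_avg m t Fs) v"

lemma walk_avg_eq:
  "walk_avg m t Fs v = (\<Sum>ws\<in>walk_colours t (length Fs). \<Prod>p<length Fs. (Fs ! p) (walk m ws v ! p)) / (5 ^ t) ^ length Fs"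
proof (induction Fs arbitrary: v)
  case Nil
  show ?case by (simp add: walk_colours_def lists_of_0)
next
  case (Cons F Fs)
  let ?W = "lists_of {..<5::nat} t" and ?r = "length Fs"
  have "(\<Sum>ws\<in>walk_colours t (Suc ?r). \<Prod>p<Suc ?r. ((F # Fs) ! p) (walk m ws v ! p)) =
    (\<Sum>w\<in>?W. \<Sum>ws\<in>walk_colours t ?r. F v * (\<Prod>p<?r. (Fs ! p) (walk m ws (act m w v) ! p)))"
    unfolding walk_colours_def
    by (subst sum_lists_of_Suc) (simp_all add: finite_lists_of prod.lessThan_Suc_shift del: prod.lessThan_Suc)
  also have "\<dots> = (\<Sum>w\<in>?W. F v * (walk_avg m t Fs (act m w v) * (5 ^ t) ^ ?r))"
    by (simp add: Cons.IH sum_distrib_left)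
  also have "\<dots> = F v * wavg m t (walk_avg m t Fs) v * 5 ^ t * (5 ^ t) ^ ?r"
    unfolding wavg_def by (simp add: sum_distrib_left sum_distrib_right sum_divide_distrib mult_ac)
  finally show ?case by simp
qed

lemma walk_avg_bounds:
  assumes "\<And>F v. F \<in> set Fs \<Longrightarrow> 0 \<le> F v \<and> F v \<le> 1"
  shows "0 \<le> walk_avg m t Fs v \<and> walk_avg m t Fs v \<le> 1"
  using assms
proof (induction Fs arbitrary: v)
  case (Cons F Fs)
  have "0 \<le> wavg m t (walk_avg m t Fs) v \<and> wavg m t (walk_avg m t Fs) v \<le> 1"
    by (rule wavg_bounds) (use Cons in auto)
  thus ?case using Cons.prems[of F v] by (auto intro: mult_le_one)
qed simp

text \<open>The factor \<open>walk_avg m t Fs\<close> of the remaining coordinates again has values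
  in \<open>[0, 1]\<close>, so \<open>wavg_mixing\<close> splits off the first coordinate at cost
  \<kappa>; the error inherited from the rest is multiplied by a mean that is at most 1.\<close>

lemma walk_mixing:
  fixes \<kappa> :: real
  assumes m: "m > 0" and Fs: "\<And>F v. F \<in> set Fs \<Longrightarrow> 0 \<le> F v \<and> F v \<le> 1"
    and \<kappa>: "\<kappa> \<ge> 0" "(799 / 800) ^ t \<le> \<kappa>\<^sup>2"
  shows "\<bar>(sum (walk_avg m t Fs) (torus m)) / (m * m) -
     (\<Prod>F\<leftarrow>Fs. sum F (torus m) / (m * m))\<bar> \<le> length Fs * \<kappa>"
  using Fs
proof (induction Fs)
  case Nil
  thus ?case using m by (simp add: card_torus)
next
  case (Cons F Fs)
  define x where "x = sum F (torus m) / (m * m)"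
  define y where "y = (sum (walk_avg m t Fs) (torus m)) / (m * m)"
  define z where "z = (\<Prod>F\<leftarrow>Fs. sum F (torus m) / (m * m))"
  define u where "u = (\<Sum>v\<in>torus m. walk_avg m t (F # Fs) v) / (m * m)"
  have F: "0 \<le> F v \<and> F v \<le> 1" for v using Cons.prems by simp
  have "sum F (torus m) \<le> (\<Sum>v\<in>torus m. 1)" using F by (intro sum_mono) auto
  hence x: "0 \<le> x" "x \<le> 1" using m F by (auto simp: x_def card_torus sum_nonneg divide_le_eq)
  have 1: "\<bar>u - x * y\<bar> \<le> \<kappa>" unfolding u_def x_def y_def walk_avg.simps
    by (rule wavg_mixing[OF m F walk_avg_bounds \<kappa>]) (use Cons.prems in auto)
  have 2: "\<bar>y - z\<bar> \<le> length Fs * \<kappa>" unfolding y_def z_def using Cons by auto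
  have "\<bar>x * y - x * z\<bar> = x * \<bar>y - z\<bar>" using x by (simp add: right_diff_distrib[symmetric] abs_mult)
  also have "\<dots> \<le> 1 * (length Fs * \<kappa>)" using x 2 by (intro mult_mono) auto
  finally have "\<bar>u - x * z\<bar> \<le> length (F # Fs) * \<kappa>" using 1 by (simp add: algebra_simps)
  thus ?case by (simp add: u_def x_def z_def)
qed

subsection \<open>Sparse random tuple systems\<close>

text \<open>An entry \<open>(i, a, b)\<close> stands for the tuple with index \<open>i\<close>, entered at position \<open>a\<close> and left at
  position \<open>b\<close>. A cycle of length 1 is a tuple with a repeated coordinate.\<close>

definition pos_cycle :: "('i \<Rightarrow> 'a list) \<Rightarrow> ('i \<times> nat \<times> nat) list \<Rightarrow> bool" where
  "pos_cycle f cs \<longleftrightarrow> cs \<noteq> [] \<and> distinct (map fst cs) \<and>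
     (\<forall>l<length cs. fst (snd (cs ! l)) \<noteq> snd (snd (cs ! l)) \<and>
        f (fst (cs ! l)) ! snd (snd (cs ! l)) =
        f (fst (cs ! (Suc l mod length cs))) ! fst (snd (cs ! (Suc l mod length cs))))"

definition cycle_free :: "nat \<Rightarrow> 'i set \<Rightarrow> nat \<Rightarrow> ('i \<Rightarrow> 'a list) \<Rightarrow> bool" where
  "cycle_free k I r f \<longleftrightarrow>
     (\<forall>cs. set cs \<subseteq> I \<times> {..<r} \<times> {..<r} \<and> pos_cycle f cs \<longrightarrow> k \<le> length cs)"

text \<open>The expansion property of an indexed family: indices are counted, so coinciding tuples
  keep their multiplicity. With the weak inequality the errors of successive steps simply add
  up.\<close>

definition mixing :: "real \<Rightarrow> 'a set \<Rightarrow> nat \<Rightarrow> 'i set \<Rightarrow> ('i \<Rightarrow> 'a list) \<Rightarrow> bool" where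
  "mixing \<epsilon> X r J f \<longleftrightarrow> (\<forall>As. length As = r \<and> (\<forall>B\<in>set As. B \<subseteq> X) \<longrightarrow>
     \<bar>real (card {i\<in>J. list_all2 (\<in>) (f i) As}) -
        real (card J) * (\<Prod>B\<leftarrow>As. real (card B) / real (card X))\<bar> \<le> \<epsilon> * real (card J))"

text \<open>Independence in counting form: \<open>f\<close> is recovered from its restriction to the
  complement of \<open>W\<close>, so the proportion of functions in \<open>X\<close> is at most
  \<open>1 / n ^ card W\<close>.\<close>

lemma card_determined:
  fixes I :: "'i set"
  assumes I: "finite I" and W: "W \<subseteq> I \<times> {..<r}" and X: "X \<subseteq> PiE I (\<lambda>_. lists_of {..<n} r)"
    and det: "\<And>f g i p. f \<in> X \<Longrightarrow> g \<in> X \<Longrightarrow>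
      (\<And>j p'. (j, p') \<in> I \<times> {..<r} - W \<Longrightarrow> f j ! p' = g j ! p') \<Longrightarrow> (i, p) \<in> W \<Longrightarrow> f i ! p = g i ! p"
  shows "card X * n ^ card W \<le> n ^ (card I * r)"
proof -
  let ?U = "I \<times> {..<r}"
  define \<Phi> where "\<Phi> = (\<lambda>f :: 'i \<Rightarrow> nat list. restrict (\<lambda>(i, p). f i ! p) (?U - W))"
  have mem: "length (f i) = r" "p < r \<Longrightarrow> f i ! p < n" if "f \<in> X" "i \<in> I" for f i p
  proof -
    have "f i \<in> lists_of {..<n} r" using X that by (auto dest: PiE_mem)
    thus "length (f i) = r" "p < r \<Longrightarrow> f i ! p < n" by (auto simp: lists_of_def dest!: subsetD[OF _ nth_mem])
  qed
  have "inj_on \<Phi> X"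
  proof (rule inj_onI)
    fix f g assume f: "f \<in> X" and g: "g \<in> X" and eq: "\<Phi> f = \<Phi> g"
    have out: "f i ! p = g i ! p" if "(i, p) \<in> ?U - W" for i p
      using fun_cong[OF eq, of "(i, p)"] that by (simp add: \<Phi>_def)
    have "f i = g i" if i: "i \<in> I" for i
    proof (rule nth_equalityI)
      show "length (f i) = length (g i)" using mem(1)[OF f i] mem(1)[OF g i] by simp
      fix p assume "p < length (f i)"
      thus "f i ! p = g i ! p" using out det[OF f g out] i mem(1)[OF f i] by (cases "(i, p) \<in> W") auto
    qed
    thus "f = g" using f g X by (intro PiE_ext[of f I _ g]) auto
  qed
  moreover have "\<Phi> ` X \<subseteq> PiE (?U - W) (\<lambda>_. {..<n})" using mem(2) by (auto simp: \<Phi>_def split: if_splits)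
  ultimately have "card X \<le> card (PiE (?U - W) (\<lambda>_. {..<n}))"
    using I by (intro card_inj_on_le) (auto intro!: finite_PiE)
  also have "\<dots> = n ^ (card I * r - card W)"
    using I W by (subst card_PiE) (auto simp: card_Diff_subset finite_subset[of W] card_cartesian_product)
  finally have "card X * n ^ card W \<le> n ^ (card I * r - card W) * n ^ card W" by simp
  moreover have "card W \<le> card I * r" using card_mono[OF _ W] I by (simp add: card_cartesian_product)
  ultimately show ?thesis by (simp flip: power_add)
qed

text \<open>\<open>W\<close> consists of the entry positions of the cycle. Each carries the value at
  the exit position of the preceding tuple, and no exit position lies in \<open>W\<close>, since the
  indices are distinct and entry and exit differ. So every tuple of the cycle gains a factor
  \<open>n\<close>.\<close>

lemma card_pos_cycle:
  assumes I: "finite I" and cs: "set cs \<subseteq> I \<times> {..<r} \<times> {..<r}"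
  shows "card {f \<in> PiE I (\<lambda>_. lists_of {..<n} r). pos_cycle f cs} * n ^ length cs \<le> n ^ (card I * r)"
proof (cases "cs \<noteq> [] \<and> distinct (map fst cs) \<and> (\<forall>l<length cs. fst (snd (cs ! l)) \<noteq> snd (snd (cs ! l)))")
  case False
  hence "{f \<in> PiE I (\<lambda>_. lists_of {..<n} r). pos_cycle f cs} = {}"
    unfolding pos_cycle_def by blast
  thus ?thesis by (simp only: card.empty mult_0 le0)
next
  case True
  define s where "s = length cs"
  define ix where "ix = (\<lambda>l. fst (cs ! l))"
  define a where "a = (\<lambda>l. fst (snd (cs ! l)))"
  define b where "b = (\<lambda>l. snd (snd (cs ! l)))"
  define W where "W = (\<lambda>l. (ix l, a l)) ` {..<s}"
  let ?X = "{f \<in> PiE I (\<lambda>_. lists_of {..<n} r). pos_cycle f cs}"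
  have s: "s > 0" using True by (simp add: s_def)
  have inj: "ix l = ix l' \<Longrightarrow> l < s \<Longrightarrow> l' < s \<Longrightarrow> l = l'" for l l'
    using True unfolding ix_def s_def by (metis length_map nth_eq_iff_index_eq nth_map)
  have ab: "a l \<noteq> b l" if "l < s" for l using True that unfolding a_def b_def s_def by blast
  have mem: "ix l \<in> I" "a l < r" "b l < r" if "l < s" for l
  proof -
    have "cs ! l \<in> I \<times> {..<r} \<times> {..<r}" using cs that unfolding s_def by (meson nth_mem subsetD)
    thus "ix l \<in> I" "a l < r" "b l < r" unfolding ix_def a_def b_def by auto
  qed
  have cW: "card W = s" unfolding W_def using inj by (subst card_image) (auto simp: inj_on_def)
  have bW: "(ix l, b l) \<notin> W" if l: "l < s" for l
  proof
    assume "(ix l, b l) \<in> W"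
    then obtain j where "j < s" "ix l = ix j" "b l = a j" unfolding W_def by auto
    thus False using inj[of l j] ab[of l] l by auto
  qed
  have link: "h (ix l) ! b l = h (ix (Suc l mod s)) ! a (Suc l mod s)" if "h \<in> ?X" "l < s" for h l
    using that unfolding pos_cycle_def ix_def a_def b_def s_def by auto
  have "card ?X * n ^ card W \<le> n ^ (card I * r)"
  proof (rule card_determined[OF I])
    show "W \<subseteq> I \<times> {..<r}" unfolding W_def using mem by auto
    fix f g i p
    assume f: "f \<in> ?X" and g: "g \<in> ?X" and "(i, p) \<in> W"
      and out: "\<And>j p'. (j, p') \<in> I \<times> {..<r} - W \<Longrightarrow> f j ! p' = g j ! p'"
    then obtain l where l: "l < s" "i = ix l" "p = a l" unfolding W_def by auto
    obtain l' where l': "l' < s" "Suc l' mod s = l"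
    proof (cases l)
      case 0
      show ?thesis by (rule that[of "s - 1"]) (use s 0 in auto)
    next
      case (Suc l0)
      show ?thesis by (rule that[of l0]) (use l Suc in auto)
    qed
    have "f (ix l') ! b l' = g (ix l') ! b l'" using bW[OF l'(1)] mem[OF l'(1)] by (intro out) simp
    thus "f i ! p = g i ! p" using link[OF f l'(1)] link[OF g l'(1)] l' l by simp
  qed auto
  thus ?thesis by (simp add: cW s_def)
qed

section \<open>Concentration of sums of independent bounded variables\<close>

lemma exp_le_quadratic:
  fixes x :: real
  assumes "\<bar>x\<bar> \<le> 1"
  shows "exp x \<le> 1 + x + x\<^sup>2"
proof (cases "x \<ge> 0")
  case True
  thus ?thesis using assms by (intro exp_bound) auto
next
  case False
  define y where "y = - x"
  have y: "y \<ge> 0" "y \<le> 1" using False assms by (auto simp: y_def)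
  have "1 + y \<le> exp y" by (rule exp_ge_add_one_self)
  hence "exp x * (1 + y) \<le> exp x * exp y" by (intro mult_left_mono) auto
  also have "\<dots> = 1" by (simp add: y_def flip: exp_add)
  \<comment> \<open>The identity behind this is
    \<open>(1 + x + x\<^sup>2) * (1 - x) = 1 - x ^ 3\<close>.\<close>
  also have "1 \<le> 1 + y * (y * y)" using y by simp
  also have "\<dots> = (1 + x + x\<^sup>2) * (1 + y)" by (simp add: y_def power2_eq_square algebra_simps)
  finally show ?thesis using y by (simp add: mult_le_cancel_right)
qed

lemma markov_count:
  fixes X :: "'w \<Rightarrow> real"
  assumes "finite \<Omega>" "\<And>w. w \<in> \<Omega> \<Longrightarrow> X w \<ge> 0"
  shows "a * card {w\<in>\<Omega>. X w \<ge> a} \<le> sum X \<Omega>"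
proof -
  have "a * card {w\<in>\<Omega>. X w \<ge> a} = (\<Sum>w\<in>{w\<in>\<Omega>. X w \<ge> a}. a)" by (simp add: mult.commute)
  also have "\<dots> \<le> (\<Sum>w\<in>{w\<in>\<Omega>. X w \<ge> a}. X w)" by (intro sum_mono) auto
  also have "\<dots> \<le> sum X \<Omega>" using assms by (intro sum_mono2) auto
  finally show ?thesis .
qed

text \<open>The sum over all \<open>f\<close> factors over the indices. For one index the linear
  term of \<open>exp_le_quadratic\<close> vanishes because \<open>h\<close> has mean zero, and
  \<open>1 + s\<^sup>2 \<le> exp (s\<^sup>2)\<close> remains.\<close>

lemma exponential_moment:
  fixes h :: "'b \<Rightarrow> real" and s :: real
  assumes I: "finite I" "J \<subseteq> I" and T: "finite T" "(\<Sum>x\<in>T. h x) = 0" "\<And>x. x \<in> T \<Longrightarrow> \<bar>h x\<bar> \<le> 1"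
    and s: "0 \<le> s" "s \<le> 1"
  shows "(\<Sum>f\<in>PiE I (\<lambda>_. T). exp (s * (\<Sum>i\<in>J. h (f i)))) \<le> card (PiE I (\<lambda>_. T)) * exp (s\<^sup>2 * card J)"
proof -
  have J: "finite J" using I finite_subset by blast
  have 1: "(\<Sum>x\<in>T. exp (s * h x)) \<le> card T * exp (s\<^sup>2)"
  proof -
    have "(\<Sum>x\<in>T. exp (s * h x)) \<le> (\<Sum>x\<in>T. 1 + s * h x + s\<^sup>2)"
    proof (rule sum_mono)
      fix x assume x: "x \<in> T"
      have "\<bar>s * h x\<bar> \<le> 1" using T(3)[OF x] s by (simp add: abs_mult mult_le_one)
      hence "exp (s * h x) \<le> 1 + s * h x + (s * h x)\<^sup>2" by (rule exp_le_quadratic)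
      also have "(s * h x)\<^sup>2 \<le> s\<^sup>2 * 1"
        unfolding power_mult_distrib using T(3)[OF x] by (intro mult_left_mono) (auto simp: abs_square_le_1)
      finally show "exp (s * h x) \<le> 1 + s * h x + s\<^sup>2" by simp
    qed
    also have "\<dots> = card T * (1 + s\<^sup>2)" using T(2) by (simp add: sum.distrib flip: sum_distrib_left) (simp add: algebra_simps)
    also have "\<dots> \<le> card T * exp (s\<^sup>2)" by (intro mult_left_mono exp_ge_add_one_self) auto
    finally show ?thesis .
  qed
  define g where "g = (\<lambda>i x. if i \<in> J then exp (s * h x) else 1)"
  have "(\<Sum>f\<in>PiE I (\<lambda>_. T). exp (s * (\<Sum>i\<in>J. h (f i)))) = (\<Sum>f\<in>PiE I (\<lambda>_. T). \<Prod>i\<in>I. g i (f i))"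
  proof (rule sum.cong[OF refl])
    fix f
    have "(\<Prod>i\<in>I. g i (f i)) = (\<Prod>i\<in>I \<inter> J. exp (s * h (f i)))"
      unfolding g_def using I by (simp add: prod.inter_restrict)
    also have "I \<inter> J = J" using I by auto
    finally show "exp (s * (\<Sum>i\<in>J. h (f i))) = (\<Prod>i\<in>I. g i (f i))"
      using J by (simp add: exp_sum sum_distrib_left)
  qed
  also have "\<dots> = (\<Prod>i\<in>I. \<Sum>x\<in>T. g i x)" using I T by (intro prod_sum_PiE[symmetric]) auto
  also have "\<dots> \<le> (\<Prod>i\<in>I. card T * (if i \<in> J then exp (s\<^sup>2) else 1))"
    using 1 by (intro prod_mono) (auto simp: g_def intro: sum_nonneg)
  also have "\<dots> = real (card T) ^ card I * (\<Prod>i\<in>I \<inter> J. exp (s\<^sup>2))"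
    using I by (simp add: prod.distrib) (simp only: prod.inter_restrict simp_thms flip: prod_constant)
  also have "I \<inter> J = J" using I by auto
  finally show ?thesis using I
    by (simp add: card_PiE exp_of_nat_mult[symmetric] mult.commute)
qed

lemma hoeffding_count:
  fixes h :: "'b \<Rightarrow> real" and \<eta> :: real
  assumes I: "finite I" "J \<subseteq> I" and T: "finite T" "(\<Sum>x\<in>T. h x) = 0" "\<And>x. x \<in> T \<Longrightarrow> \<bar>h x\<bar> \<le> 1"
    and \<eta>: "0 < \<eta>" "\<eta> \<le> 1"
  shows "card {f\<in>PiE I (\<lambda>_. T). (\<Sum>i\<in>J. h (f i)) \<ge> \<eta> * card J}
    \<le> card (PiE I (\<lambda>_. T)) * exp (- (\<eta>\<^sup>2 * card J / 4))"
proof -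
  let ?\<Omega> = "PiE I (\<lambda>_. T)"
  \<comment> \<open>This minimises the exponent \<open>s\<^sup>2 - s * \<eta>\<close>, with value
    \<open>- \<eta>\<^sup>2 / 4\<close>.\<close>
  define s where "s = \<eta> / 2"
  have s: "0 < s" "s \<le> 1" using \<eta> by (auto simp: s_def)
  have fin: "finite ?\<Omega>" using I T by (intro finite_PiE) auto
  let ?c = "card {f\<in>?\<Omega>. (\<Sum>i\<in>J. h (f i)) \<ge> \<eta> * card J}"
  have "{f\<in>?\<Omega>. (\<Sum>i\<in>J. h (f i)) \<ge> \<eta> * card J} = {f\<in>?\<Omega>. exp (s * (\<Sum>i\<in>J. h (f i))) \<ge> exp (s * (\<eta> * card J))}"
    using s by auto
  hence "exp (s * (\<eta> * card J)) * ?c \<le> (\<Sum>f\<in>?\<Omega>. exp (s * (\<Sum>i\<in>J. h (f i))))"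
    using markov_count[OF fin, of "\<lambda>f. exp (s * (\<Sum>i\<in>J. h (f i)))" "exp (s * (\<eta> * card J))"] by simp
  also have "\<dots> \<le> card ?\<Omega> * exp (s\<^sup>2 * card J)"
    using s by (intro exponential_moment[OF I T]) auto
  finally have le: "exp (s * (\<eta> * card J)) * ?c \<le> card ?\<Omega> * exp (s\<^sup>2 * card J)" .
  have "?c = exp (- (s * (\<eta> * card J))) * (exp (s * (\<eta> * card J)) * ?c)"
    by (simp add: mult.assoc[symmetric] flip: exp_add)
  also have "\<dots> \<le> exp (- (s * (\<eta> * card J))) * (card ?\<Omega> * exp (s\<^sup>2 * card J))"
    by (intro mult_left_mono le) simp
  also have "\<dots> = card ?\<Omega> * exp (- (s * (\<eta> * card J)) + s\<^sup>2 * card J)"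
    by (simp only: exp_add mult_ac)
  also have "- (s * (\<eta> * card J)) + s\<^sup>2 * card J = - (\<eta>\<^sup>2 * card J / 4)"
    by (simp add: s_def power2_eq_square algebra_simps)
  finally show ?thesis .
qed

lemma card_list_all2_mem: "card {xs. list_all2 (\<in>) xs As} = (\<Prod>A\<leftarrow>As. card A)"
proof (induction As)
  case (Cons A As)
  have eq: "{xs. list_all2 (\<in>) xs (A # As)} = (\<lambda>(x, xs). x # xs) ` (A \<times> {xs. list_all2 (\<in>) xs As})"
    by (auto simp: list_all2_Cons2 image_iff)
  have inj: "inj_on (\<lambda>(x, xs). x # xs) (A \<times> {xs. list_all2 (\<in>) xs As})"
    by (auto simp: inj_on_def)
  show ?case unfolding eq card_image[OF inj] using Cons.IH by (simp add: card_cartesian_product)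
qed simp

text \<open>A union bound over the \<open>(2 ^ n) ^ r\<close> lists of subsets and the two signs of
  the deviation. It is effective once \<open>card J\<close> is a large multiple of
  \<open>n\<close>.\<close>

lemma hoeffding_mixing:
  fixes n r :: nat and \<eta> :: real
  assumes I: "finite I" "J \<subseteq> I" "J \<noteq> {}" and n: "n > 0" and \<eta>: "0 < \<eta>" "\<eta> \<le> 1"
  defines "\<Omega> \<equiv> PiE I (\<lambda>_. lists_of {..<n} r)"
  shows "card {f\<in>\<Omega>. \<not> mixing \<eta> {..<n} r J f} \<le> card \<Omega> * (2 * (2 ^ n) ^ r * exp (- (\<eta>\<^sup>2 * card J / 4)))"
proof -
  let ?T = "lists_of {..<n} r"
  have finT: "finite ?T" by (simp add: finite_lists_of)
  have fin: "finite \<Omega>" unfolding \<Omega>_def using I finT by (intro finite_PiE) auto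
  have finJ: "finite J" using I finite_subset by blast
  define p where "p = (\<lambda>As :: nat set list. \<Prod>B\<leftarrow>As. real (card B) / real (card {..<n}))"
  define h where "h = (\<lambda>As xs. of_bool (list_all2 (\<in>) xs As) - p As :: real)"
  define P where "P = (\<lambda>As. {f\<in>\<Omega>. (\<Sum>i\<in>J. h As (f i)) \<ge> \<eta> * card J})"
  define M where "M = (\<lambda>As. {f\<in>\<Omega>. (\<Sum>i\<in>J. - h As (f i)) \<ge> \<eta> * card J})"
  let ?L = "lists_of (Pow {..<n}) r"
  have finL: "finite ?L" by (simp add: finite_lists_of)
  have "{f\<in>\<Omega>. \<not> mixing \<eta> {..<n} r J f} \<subseteq> (\<Union>As\<in>?L. P As \<union> M As)"
  proof
    fix f assume f: "f \<in> {f\<in>\<Omega>. \<not> mixing \<eta> {..<n} r J f}"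
    then obtain As where As: "length As = r" "\<forall>B\<in>set As. B \<subseteq> {..<n}"
      and gt: "\<bar>real (card {i\<in>J. list_all2 (\<in>) (f i) As}) - real (card J) * p As\<bar> > \<eta> * real (card J)"
      unfolding mixing_def p_def by (auto simp: not_le)
    have "As \<in> ?L" using As by (auto simp: lists_of_def)
    moreover have "(\<Sum>i\<in>J. h As (f i)) = real (card {i\<in>J. list_all2 (\<in>) (f i) As}) - real (card J) * p As"
      unfolding h_def using finJ by (simp add: sum_subtractf Int_def)
    hence "f \<in> P As \<union> M As" using f gt unfolding P_def M_def by (auto simp: sum_negf abs_if split: if_splits)
    ultimately show "f \<in> (\<Union>As\<in>?L. P As \<union> M As)" by blast
  qed
  hence "card {f\<in>\<Omega>. \<not> mixing \<eta> {..<n} r J f} \<le> card (\<Union>As\<in>?L. P As \<union> M As)"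
    using finL fin by (intro card_mono) (auto simp: P_def M_def)
  also have "\<dots> \<le> (\<Sum>As\<in>?L. card (P As \<union> M As))" by (rule card_UN_le[OF finL])
  also have "real \<dots> \<le> (\<Sum>As\<in>?L. 2 * (card \<Omega> * exp (- (\<eta>\<^sup>2 * card J / 4))))"
    unfolding of_nat_sum
  proof (rule sum_mono)
    fix As assume As: "As \<in> ?L"
    have lenAs: "length As = r" and subAs: "\<forall>B\<in>set As. B \<subseteq> {..<n}" using As by (auto simp: lists_of_def)
    have hT: "{xs\<in>?T. list_all2 (\<in>) xs As} = {xs. list_all2 (\<in>) xs As}"
      using subAs lenAs unfolding lists_of_def
      by (auto simp: list_all2_conv_all_nth in_set_conv_nth) (metis lessThan_iff nth_mem subsetD)+
    have pnn: "p As = real (\<Prod>B\<leftarrow>As. card B) / real n ^ r"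
      unfolding p_def lenAs[symmetric] by (induction As) auto
    have cle: "(\<Prod>B\<leftarrow>As. card B) \<le> n ^ r"
    proof -
      have "card {xs\<in>?T. list_all2 (\<in>) xs As} \<le> card ?T" using finT by (intro card_mono) auto
      thus ?thesis unfolding hT card_list_all2_mem by (simp add: card_lists_of)
    qed
    have p01: "0 \<le> p As" "p As \<le> 1" unfolding pnn using cle n by (auto simp: divide_le_eq simp flip: of_nat_power)
    have h1: "\<bar>h As x\<bar> \<le> 1" for x using p01 unfolding h_def by (auto simp: abs_le_iff)
    have "(\<Sum>x\<in>?T. h As x) = real (card {xs\<in>?T. list_all2 (\<in>) xs As}) - n ^ r * p As"
      unfolding h_def using finT by (simp add: sum_subtractf Int_def card_lists_of)
    also have "\<dots> = 0" unfolding hT card_list_all2_mem pnn using n by simp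
    finally have h0: "(\<Sum>x\<in>?T. h As x) = 0" .
    have "card (P As) \<le> card \<Omega> * exp (- (\<eta>\<^sup>2 * card J / 4))"
      unfolding P_def \<Omega>_def by (rule hoeffding_count[OF I(1,2) finT h0 h1 \<eta>])
    moreover have "card (M As) \<le> card \<Omega> * exp (- (\<eta>\<^sup>2 * card J / 4))"
      unfolding M_def \<Omega>_def using h0 h1
      by (intro hoeffding_count[OF I(1,2) finT _ _ \<eta>]) (auto simp: sum_negf)
    moreover have "real (card (P As \<union> M As)) \<le> real (card (P As)) + real (card (M As))"
      using card_Un_le[of "P As" "M As"] by linarith
    ultimately show "real (card (P As \<union> M As)) \<le> 2 * (card \<Omega> * exp (- (\<eta>\<^sup>2 * card J / 4)))" by linarith
  qed
  also have "\<dots> = card \<Omega> * (2 * (2 ^ n) ^ r * exp (- (\<eta>\<^sup>2 * card J / 4)))"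
    by (simp add: card_lists_of card_Pow)
  finally show ?thesis by simp
qed

section \<open>Short cycles, collisions, and the deletion of bad tuples\<close>

lemma cycle_free_reindex:
  assumes cf: "cycle_free k I r f" and inj: "inj_on \<sigma> I'" and im: "\<sigma> ` I' \<subseteq> I"
  shows "cycle_free k I' r (\<lambda>i. f (\<sigma> i))"
  unfolding cycle_free_def
proof (intro allI impI, elim conjE)
  fix cs assume cs: "set cs \<subseteq> I' \<times> {..<r} \<times> {..<r}" and pc: "pos_cycle (\<lambda>i. f (\<sigma> i)) cs"
  let ?cs = "map (\<lambda>(i, ab). (\<sigma> i, ab)) cs"
  have m: "map fst ?cs = map \<sigma> (map fst cs)" by (induction cs) auto
  have "inj_on \<sigma> (set (map fst cs))" using cs by (intro inj_on_subset[OF inj]) auto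
  hence "distinct (map fst ?cs)"
    using pc unfolding m distinct_map[of \<sigma>] pos_cycle_def by blast
  moreover have "Suc l mod length cs < length cs" if "l < length cs" for l using that by (intro mod_less_divisor) auto
  ultimately have "pos_cycle f ?cs" using pc unfolding pos_cycle_def by (auto simp: case_prod_beta)
  moreover have "set ?cs \<subseteq> I \<times> {..<r} \<times> {..<r}" using cs im by auto
  ultimately have "k \<le> length ?cs" using cf unfolding cycle_free_def by blast
  thus "k \<le> length cs" by simp
qed

text \<open>There are \<open>(card I * (r * r)) ^ s\<close> candidates of length \<open>s\<close>,
  each realised with probability at most \<open>1 / n ^ s\<close>. If \<open>card I\<close> is
  proportional to \<open>n\<close>, the expected number is bounded independently of
  \<open>n\<close>.\<close>

lemma card_short_cycles:
  fixes I :: "'i set" and n r k :: nat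
  assumes I: "finite I" and n: "n > 0"
  defines "\<Omega> \<equiv> PiE I (\<lambda>_. lists_of {..<n} r)"
    and "\<C> \<equiv> \<Union>s\<in>{1..<k}. lists_of (I \<times> {..<r} \<times> {..<r}) s"
  shows "(\<Sum>f\<in>\<Omega>. real (card {cs\<in>\<C>. pos_cycle f cs}))
    \<le> card \<Omega> * (\<Sum>s\<in>{1..<k}. (card I * (r * r) / n) ^ s)"
proof -
  have finC': "finite (lists_of (I \<times> {..<r} \<times> {..<r}) s)" for s using I by (simp add: finite_lists_of)
  hence finC: "finite \<C>" by (simp add: \<C>_def)
  have fin: "finite \<Omega>" unfolding \<Omega>_def using I by (intro finite_PiE) (auto simp: finite_lists_of)
  have c\<Omega>: "card \<Omega> = n ^ (card I * r)"
    unfolding \<Omega>_def using I by (simp add: card_PiE card_lists_of power_mult[symmetric] mult.commute)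
  have "(\<Sum>f\<in>\<Omega>. real (card {cs\<in>\<C>. pos_cycle f cs})) = (\<Sum>f\<in>\<Omega>. \<Sum>cs\<in>\<C>. of_bool (pos_cycle f cs))"
    using finC by (simp add: Int_def)
  also have "\<dots> = (\<Sum>cs\<in>\<C>. \<Sum>f\<in>\<Omega>. of_bool (pos_cycle f cs))" by (rule sum.swap)
  also have "\<dots> = (\<Sum>cs\<in>\<C>. real (card {f\<in>\<Omega>. pos_cycle f cs}))" using fin by (simp add: Int_def)
  also have "\<dots> = (\<Sum>s\<in>{1..<k}. \<Sum>cs\<in>lists_of (I \<times> {..<r} \<times> {..<r}) s. real (card {f\<in>\<Omega>. pos_cycle f cs}))"
    unfolding \<C>_def using finC' by (intro sum.UNION_disjoint) (auto simp: lists_of_def)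
  also have "\<dots> \<le> (\<Sum>s\<in>{1..<k}. \<Sum>cs\<in>lists_of (I \<times> {..<r} \<times> {..<r}) s. card \<Omega> / real n ^ s)"
  proof (intro sum_mono)
    fix s cs assume "cs \<in> lists_of (I \<times> {..<r} \<times> {..<r}) s"
    hence cs: "set cs \<subseteq> I \<times> {..<r} \<times> {..<r}" "length cs = s" by (auto simp: lists_of_def)
    have "real (card {f\<in>\<Omega>. pos_cycle f cs} * n ^ s) \<le> real (card \<Omega>)"
      unfolding c\<Omega> using card_pos_cycle[OF I cs(1), of n] cs(2) unfolding \<Omega>_def of_nat_le_iff by simp
    thus "real (card {f\<in>\<Omega>. pos_cycle f cs}) \<le> card \<Omega> / real n ^ s"
      using n by (simp add: le_divide_eq)
  qed
  also have "\<dots> = (\<Sum>s\<in>{1..<k}. card \<Omega> * (card I * (r * r) / n) ^ s)"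
    using I by (intro sum.cong refl) (simp add: card_lists_of card_cartesian_product power_divide)
  finally show ?thesis by (simp add: sum_distrib_left)
qed

text \<open>Two different positions carry the same element with probability at most
  \<open>1 / n\<close>, since the entry at one is then determined by that at the other.\<close>

lemma card_collisions:
  fixes I :: "'i set" and n r :: nat
  assumes I: "finite I" and n: "n > 0"
  defines "\<Omega> \<equiv> PiE I (\<lambda>_. lists_of {..<n} r)" and "U \<equiv> I \<times> {..<r}"
  shows "(\<Sum>f\<in>\<Omega>. real (card {(u, w)\<in>U \<times> U. u \<noteq> w \<and> f (fst u) ! snd u = f (fst w) ! snd w}))
    \<le> card \<Omega> * ((card I * r)\<^sup>2 / n)"
proof -
  have finU: "finite U" using I by (simp add: U_def)
  have fin: "finite \<Omega>" unfolding \<Omega>_def using I by (intro finite_PiE) (auto simp: finite_lists_of)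
  have c\<Omega>: "card \<Omega> = n ^ (card I * r)"
    unfolding \<Omega>_def using I by (simp add: card_PiE card_lists_of power_mult[symmetric] mult.commute)
  define E where "E = (\<lambda>(f :: 'i \<Rightarrow> nat list) (u, w). u \<noteq> w \<and> f (fst u) ! snd u = f (fst w) ! snd w)"
  have pair: "real (card {f\<in>\<Omega>. E f uw}) \<le> card \<Omega> / real n" if uw: "uw \<in> U \<times> U" for uw
  proof -
    obtain i p j q where uw': "uw = ((i, p), (j, q))" by (metis surj_pair)
    have m: "i \<in> I" "j \<in> I" "p < r" "q < r" using uw by (auto simp: uw' U_def)
    have "card {f\<in>\<Omega>. E f uw} * n \<le> card \<Omega>"
    proof (cases "(i, p) = (j, q)")
      case True
      hence "{f\<in>\<Omega>. E f uw} = {}" by (auto simp: E_def uw')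
      thus ?thesis by (simp only: card.empty mult_0 le0)
    next
      case False
      have "card {f\<in>\<Omega>. E f uw} * n ^ card {(i, p)} \<le> n ^ (card I * r)"
      proof (rule card_determined[OF I])
        fix f g i' p'
        assume f: "f \<in> {f\<in>\<Omega>. E f uw}" and g: "g \<in> {f\<in>\<Omega>. E f uw}" and ip: "(i', p') \<in> {(i, p)}"
          and out: "\<And>j p'. (j, p') \<in> I \<times> {..<r} - {(i, p)} \<Longrightarrow> f j ! p' = g j ! p'"
        have "f j ! q = g j ! q" using False m by (intro out) auto
        thus "f i' ! p' = g i' ! p'" using f g ip by (auto simp: E_def uw')
      qed (use m in \<open>auto simp: \<Omega>_def\<close>)
      thus ?thesis by (simp add: c\<Omega>)
    qed
    hence "real (card {f\<in>\<Omega>. E f uw} * n) \<le> real (card \<Omega>)" by (simp only: of_nat_le_iff)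
    thus ?thesis using n by (simp add: le_divide_eq)
  qed
  have "(\<Sum>f\<in>\<Omega>. real (card {uw\<in>U \<times> U. E f uw})) = (\<Sum>f\<in>\<Omega>. \<Sum>uw\<in>U \<times> U. of_bool (E f uw))"
    using finU by (simp add: Int_def)
  also have "\<dots> = (\<Sum>uw\<in>U \<times> U. \<Sum>f\<in>\<Omega>. of_bool (E f uw))" by (rule sum.swap)
  also have "\<dots> = (\<Sum>uw\<in>U \<times> U. real (card {f\<in>\<Omega>. E f uw}))" using fin by (simp add: Int_def)
  also have "\<dots> \<le> (\<Sum>uw\<in>U \<times> U. card \<Omega> / real n)" by (intro sum_mono pair)
  also have "\<dots> = card \<Omega> * ((card I * r)\<^sup>2 / n)" 
    by (simp add: card_cartesian_product U_def power2_eq_square)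
  also have "(\<lambda>f. {uw\<in>U \<times> U. E f uw}) = (\<lambda>f. {(u, w)\<in>U \<times> U. u \<noteq> w \<and> f (fst u) ! snd u = f (fst w) ! snd w})"
    by (auto simp: E_def)
  finally show ?thesis by meson
qed

text \<open>If \<open>x\<close> has degree \<open>d > M\<close>, then it accounts for \<open>d (d - 1) \<ge> M d\<close> collisions.\<close>

lemma card_heavy_le:
  fixes F :: "'u \<Rightarrow> 'a"
  assumes U: "finite U"
  shows "M * card {u\<in>U. card {w\<in>U. F w = F u} > M} \<le> card {(u, w)\<in>U \<times> U. u \<noteq> w \<and> F u = F w}"
proof -
  let ?H = "{u\<in>U. card {w\<in>U. F w = F u} > M}"
  have "M * card ?H = (\<Sum>u\<in>?H. M)" by simp
  also have "\<dots> \<le> (\<Sum>u\<in>?H. card {w\<in>U. u \<noteq> w \<and> F u = F w})"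
  proof (rule sum_mono)
    fix u assume u: "u \<in> ?H"
    have "{w\<in>U. F w = F u} = insert u {w\<in>U. u \<noteq> w \<and> F u = F w}" using u by auto
    thus "M \<le> card {w\<in>U. u \<noteq> w \<and> F u = F w}" using u U by simp
  qed
  also have "\<dots> = card (SIGMA u:?H. {w\<in>U. u \<noteq> w \<and> F u = F w})" using U by (simp add: card_SigmaI)
  also have "\<dots> \<le> card {(u, w)\<in>U \<times> U. u \<noteq> w \<and> F u = F w}"
    using U by (intro card_mono) (auto intro: finite_subset[of _ "U \<times> U"])
  finally show ?thesis .
qed

text \<open>Deleting at most \<open>\<delta> * m\<close> indices raises the deviation from
  \<open>\<delta> * m\<close> to at most \<open>2 * \<delta> * m\<close>, as the losses in the count
  and in its expected value act in opposite directions. Since \<open>m \<le> 8 / 7 * m'\<close>,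
  this is at most \<open>8 * \<delta> * m'\<close>.\<close>

lemma mixing_thin:
  fixes f :: "'c \<times> nat \<Rightarrow> nat list"
  assumes mix: "mixing \<delta> X r ({c} \<times> {..<m}) f" and X: "finite X"
    and G: "G \<subseteq> {..<m}" "card G = m'" "bij_betw g {..<m'} G"
    and m': "real m - real m' \<le> \<delta> * m" and \<delta>: "0 < \<delta>" "\<delta> \<le> 1/8" "8 * \<delta> \<le> \<epsilon>"
  shows "mixing \<epsilon> X r ({c} \<times> {..<m'}) (\<lambda>(c, i). f (c, g i))"
  unfolding mixing_def
proof (intro allI impI, elim conjE)
  fix As :: "nat set list"
  assume As: "length As = r" "\<forall>B\<in>set As. B \<subseteq> X"
  define p where "p = (\<Prod>B\<leftarrow>As. real (card B) / real (card X))"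
  have p: "0 \<le> p" "p \<le> 1"
  proof -
    have "0 \<le> (\<Prod>B\<leftarrow>As. real (card B) / real (card X)) \<and> (\<Prod>B\<leftarrow>As. real (card B) / real (card X)) \<le> 1"
      using As(2)
    proof (induction As)
      case (Cons B As)
      have "card B \<le> card X" using Cons.prems X by (intro card_mono) auto
      hence "real (card B) / real (card X) \<le> 1" by (cases "card X = 0") (auto simp: divide_le_eq_1)
      moreover have "0 \<le> (\<Prod>B\<leftarrow>As. real (card B) / real (card X))" "(\<Prod>B\<leftarrow>As. real (card B) / real (card X)) \<le> 1"
        using Cons by auto
      ultimately show ?case by (simp only: list.map prod_list.Cons) (simp add: mult_le_one del: times_divide_eq_left)
    qed simp
    thus "0 \<le> p" "p \<le> 1" by (auto simp: p_def)
  qed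
  define A where "A = {i\<in>{..<m}. list_all2 (\<in>) (f (c, i)) As}"
  have finA: "finite A" by (simp add: A_def)
  have finG: "finite G" using G finite_subset by blast
  have m'm: "m' \<le> m" using card_mono[OF _ G(1)] G(2) by simp
  have full: "{i\<in>{c} \<times> {..<m}. list_all2 (\<in>) (f i) As} = Pair c ` A" by (auto simp: A_def)
  have sub: "{i\<in>{c} \<times> {..<m'}. list_all2 (\<in>) (case i of (c, i) \<Rightarrow> f (c, g i)) As} = Pair c ` {i\<in>{..<m'}. g i \<in> A}"
    using G by (auto simp: A_def bij_betw_def)
  have "g ` {i\<in>{..<m'}. g i \<in> A} = A \<inter> G" using G(3) by (auto simp: bij_betw_def)
  moreover have "inj_on g {i\<in>{..<m'}. g i \<in> A}" using G(3) by (auto simp: bij_betw_def inj_on_def)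
  ultimately have cAG: "card {i\<in>{..<m'}. g i \<in> A} = card (A \<inter> G)" by (metis card_image)
  have "card A \<le> card (A \<inter> G) + card ({..<m} - G)"
    using finA finG by (intro order_trans[OF card_mono card_Un_le]) (auto simp: A_def)
  also have "card ({..<m} - G) = m - m'" using G finG by (simp add: card_Diff_subset)
  finally have 1: "real (card A) - real (card (A \<inter> G)) \<le> real m - real m'" using m'm by linarith
  have 2: "card (A \<inter> G) \<le> card A" using finA by (intro card_mono) auto
  have 3: "\<bar>real (card A) - real m * p\<bar> \<le> \<delta> * real m"
    using mix As unfolding mixing_def p_def by (auto simp: full card_image inj_on_def dest!: spec[of _ As])
  have 4: "0 \<le> (real m - real m') * p" "(real m - real m') * p \<le> real m - real m'"
    using p m'm by (auto simp: mult_left_le)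
  have "\<bar>real (card (A \<inter> G)) - real m' * p\<bar> \<le> 2 * \<delta> * m"
  proof -
    have e: "real (card (A \<inter> G)) - real m' * p =
      (real (card A) - real m * p) - (real (card A) - real (card (A \<inter> G))) + (real m - real m') * p"
      by (simp add: algebra_simps)
    show ?thesis unfolding e using 1 2 3 4 m' by linarith
  qed
  also have "\<dots> \<le> \<epsilon> * real m'"
  proof -
    have "\<delta> * real m \<le> 1 / 8 * real m" using \<delta> by (intro mult_right_mono) auto
    hence "7 * real m \<le> 8 * real m'" using m' by linarith
    hence "\<delta> * (7 * real m) \<le> \<delta> * (8 * real m')" using \<delta> by (intro mult_left_mono) auto
    moreover have "8 * \<delta> * real m' \<le> \<epsilon> * real m'" using \<delta> by (intro mult_right_mono) auto
    moreover have "0 \<le> \<delta> * real m'" "0 \<le> \<delta> * real m" using \<delta> by auto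
    ultimately show ?thesis by (simp add: algebra_simps)
  qed
  finally show "\<bar>real (card {i\<in>{c} \<times> {..<m'}. list_all2 (\<in>) (case i of (c, i) \<Rightarrow> f (c, g i)) As}) -
        real (card ({c} \<times> {..<m'})) * (\<Prod>B\<leftarrow>As. real (card B) / real (card X))\<bar> \<le> \<epsilon> * real (card ({c} \<times> {..<m'}))"
    unfolding sub using cAG by (simp add: card_image inj_on_def p_def)
qed

text \<open>The indices in \<open>B\<close> are to be deleted.\<close>

definition almost_sparse :: "'c set \<Rightarrow> nat \<Rightarrow> real \<Rightarrow> nat \<Rightarrow> nat \<Rightarrow> nat \<Rightarrow> nat \<Rightarrow>
    ('c \<times> nat \<Rightarrow> nat list) \<Rightarrow> ('c \<times> nat) set \<Rightarrow> bool" where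
  "almost_sparse Col r \<delta> M k n m f B \<longleftrightarrow>
     (\<forall>i\<in>Col \<times> {..<m}. length (f i) = r \<and> set (f i) \<subseteq> {..<n}) \<and>
     B \<subseteq> Col \<times> {..<m} \<and> real (card B) \<le> \<delta> * real m \<and>
     cycle_free k (Col \<times> {..<m} - B) r f \<and>
     (\<forall>x. card {u\<in>(Col \<times> {..<m} - B) \<times> {..<r}. f (fst u) ! snd u = x} \<le> M) \<and>
     (\<forall>c\<in>Col. mixing \<delta> {..<n} r ({c} \<times> {..<m}) f)"

definition sparse_system :: "'c set \<Rightarrow> nat \<Rightarrow> real \<Rightarrow> nat \<Rightarrow> nat \<Rightarrow> nat \<Rightarrow> nat \<Rightarrow>
    ('c \<times> nat \<Rightarrow> nat list) \<Rightarrow> bool" where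
  "sparse_system Col r \<epsilon> M k n m f \<longleftrightarrow>
     (\<forall>i\<in>Col \<times> {..<m}. length (f i) = r \<and> set (f i) \<subseteq> {..<n}) \<and>
     cycle_free k (Col \<times> {..<m}) r f \<and>
     (\<forall>x. card {u\<in>(Col \<times> {..<m}) \<times> {..<r}. f (fst u) ! snd u = x} \<le> M) \<and>
     (\<forall>c\<in>Col. mixing \<epsilon> {..<n} r ({c} \<times> {..<m}) f)"

text \<open>Three bad events do not exhaust all systems: too many short cycles and too many
  collisions have probability at most 1/4 each by Markov's inequality, failure of mixing less than
  1/2 by concentration. The quantifiers matter: \<open>d\<close> and \<open>M\<close> precede
  \<open>k\<close>, and only \<open>n\<close> may depend on it.\<close>

lemma random_system:
  fixes Col :: "'c set" and \<delta> :: real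
  assumes Col: "finite Col" and \<delta>: "0 < \<delta>" "\<delta> \<le> 1/8"
  obtains d M :: nat where "d > 0" and
    "\<And>k. \<exists>n>0. \<exists>(f :: 'c \<times> nat \<Rightarrow> nat list) B. almost_sparse Col r \<delta> M k n (d * n) f B"
proof -
  define K where "K = card Col"
  \<comment> \<open>So large that \<open>exp (- (\<delta>\<^sup>2 * d * n / 4))\<close> beats the
    \<open>2 ^ (n * r)\<close> lists of subsets with a factor \<open>exp (- n)\<close> to
    spare.\<close>
  obtain d :: nat where d0: "real d > 4 * (real r + 1) / \<delta>\<^sup>2" using reals_Archimedean2 by blast
  have "4 * (real r + 1) / \<delta>\<^sup>2 > 0" using \<delta> by simp
  hence d: "d > 0" using d0 by (cases d) auto
  have d\<delta>: "\<delta>\<^sup>2 * real d / 4 \<ge> real r + 1" using d0 \<delta> by (simp add: divide_less_eq mult.commute)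
  \<comment> \<open>The expected number of collisions is at most
    \<open>(K * r)\<^sup>2 * d * m\<close>; this \<open>M\<close> makes four times that at most
    \<open>M * (\<delta> * m / 2)\<close>.\<close>
  obtain M :: nat where M0: "real M > 8 * (K * r)\<^sup>2 * d / \<delta>" using reals_Archimedean2 by blast
  have M: "8 * (real K * r)\<^sup>2 * d \<le> \<delta> * M" using M0 \<delta> by (simp add: divide_less_eq mult.commute less_imp_le)
  have "8 * (K * r)\<^sup>2 * d / \<delta> \<ge> 0" using \<delta> by simp
  hence Mpos: "M > 0" using M0 by (cases M) auto
  show thesis
  proof (rule that[OF d, of M])
    fix k :: nat
    define S where "S = (\<Sum>s\<in>{1..<k}. (real K * d * (r * r)) ^ s)"
    have S0: "S \<ge> 0" unfolding S_def by (intro sum_nonneg) auto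
    \<comment> \<open>Here \<open>k\<close> enters: \<open>S\<close> bounds the expected number of
      short cycles uniformly in \<open>n\<close>, and \<open>n\<close> makes it a small part of
      \<open>\<delta> * m\<close>. The term \<open>4 * K\<close> is for the union bound over the
      colours.\<close>
    obtain n :: nat where n0: "real n > max (8 * S / \<delta>) (4 * K)" using reals_Archimedean2 by blast
    have n: "n > 0" using n0 by (cases n) auto
    have nS: "8 * S \<le> \<delta> * n" using n0 \<delta> by (simp add: divide_less_eq mult.commute less_imp_le)
    have nK: "real n > 4 * K" using n0 by simp
    define m where "m = d * n"
    define I where "I = Col \<times> {..<m}"
    have I: "finite I" using Col by (simp add: I_def)
    have cI: "card I = K * m" by (simp add: I_def K_def card_cartesian_product)
    have m: "m > 0" using d n by (simp add: m_def)
    define \<Omega> where "\<Omega> = PiE I (\<lambda>_. lists_of {..<n} r)"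
    define U where "U = I \<times> {..<r}"
    have finU: "finite U" using I by (simp add: U_def)
    define \<C> where "\<C> = (\<Union>s\<in>{1..<k}. lists_of (I \<times> {..<r} \<times> {..<r}) s)"
    have fin: "finite \<Omega>" unfolding \<Omega>_def using I by (intro finite_PiE) (auto simp: finite_lists_of)
    have finC: "finite \<C>" using I by (simp add: \<C>_def finite_lists_of)
    have cpos: "card \<Omega> > 0" unfolding \<Omega>_def using I n by (simp add: card_PiE card_lists_of)
    define cyc where "cyc = (\<lambda>f :: 'c \<times> nat \<Rightarrow> nat list. real (card {cs\<in>\<C>. pos_cycle f cs}))"
    define coll where "coll = (\<lambda>f. real (card {(u, w)\<in>U \<times> U. u \<noteq> w \<and> f (fst u) ! snd u = (f :: 'c \<times> nat \<Rightarrow> nat list) (fst w) ! snd w}))"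
    define B1 where "B1 = {f\<in>\<Omega>. cyc f \<ge> \<delta> * m / 2}"
    define B2 where "B2 = {f\<in>\<Omega>. coll f \<ge> M * (\<delta> * m / 2)}"
    define B3 where "B3 = (\<lambda>c. {f\<in>\<Omega>. \<not> mixing \<delta> {..<n} r ({c} \<times> {..<m}) f})"
    have b1: "real (card B1) \<le> card \<Omega> / 4"
    proof -
      have "\<delta> * m / 2 * card B1 \<le> sum cyc \<Omega>" unfolding B1_def
        by (rule markov_count[OF fin]) (simp add: cyc_def)
      also have "\<dots> \<le> card \<Omega> * (\<Sum>s\<in>{1..<k}. (card I * (r * r) / n) ^ s)"
        unfolding cyc_def \<Omega>_def \<C>_def by (rule card_short_cycles[OF I n])
      also have "(\<Sum>s\<in>{1..<k}. (card I * (r * r) / n) ^ s) = S"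
        unfolding S_def using n by (intro sum.cong refl) (simp add: cI m_def mult_ac)
      also have "card \<Omega> * S \<le> card \<Omega> * (\<delta> * m / 8)"
      proof (rule mult_left_mono)
        have "\<delta> * n * 1 \<le> \<delta> * n * d" using \<delta> d by (intro mult_left_mono) auto
        thus "S \<le> \<delta> * m / 8" using nS by (simp add: m_def mult_ac)
      qed simp
      finally have "(\<delta> * m / 2) * real (card B1) \<le> (\<delta> * m / 2) * (card \<Omega> / 4)" by (simp add: mult_ac)
      thus ?thesis using \<delta> m by (simp add: mult_le_cancel_left_pos)
    qed
    have b2: "real (card B2) \<le> card \<Omega> / 4"
    proof -
      have "M * (\<delta> * m / 2) * card B2 \<le> sum coll \<Omega>" unfolding B2_def
        by (rule markov_count[OF fin]) (simp add: coll_def)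
      also have "\<dots> \<le> card \<Omega> * ((card I * r)\<^sup>2 / n)"
        unfolding coll_def \<Omega>_def U_def by (rule card_collisions[OF I n])
      also have "\<dots> \<le> card \<Omega> * (M * (\<delta> * m / 8))"
      proof (rule mult_left_mono)
        have "real ((card I * r)\<^sup>2) / n = (real K * r)\<^sup>2 * d * m" using n
          by (simp add: cI m_def power2_eq_square field_simps)
        also have "\<dots> = (8 * (real K * r)\<^sup>2 * d) * m / 8" by simp
        also have "\<dots> \<le> (\<delta> * M) * m / 8" using M by (intro divide_right_mono mult_right_mono) auto
        finally show "real ((card I * r)\<^sup>2) / n \<le> M * (\<delta> * m / 8)" by (simp add: mult_ac)
      qed simp
      finally have "(M * (\<delta> * m / 2)) * real (card B2) \<le> (M * (\<delta> * m / 2)) * (card \<Omega> / 4)" by (simp add: mult_ac)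
      thus ?thesis using \<delta> m Mpos by (simp add: mult_le_cancel_left_pos)
    qed
    have b3: "real (card (\<Union>c\<in>Col. B3 c)) < card \<Omega> / 2"
    proof -
      have "real (card (\<Union>c\<in>Col. B3 c)) \<le> real (\<Sum>c\<in>Col. card (B3 c))"
        unfolding of_nat_le_iff by (rule card_UN_le[OF Col])
      also have "\<dots> \<le> (\<Sum>c\<in>Col. card \<Omega> * (2 * exp (- real n)))" unfolding of_nat_sum
      proof (rule sum_mono)
        fix c assume c: "c \<in> Col"
        have "real (card (B3 c)) \<le> card \<Omega> * (2 * (2 ^ n) ^ r * exp (- (\<delta>\<^sup>2 * card ({c} \<times> {..<m}) / 4)))"
          unfolding B3_def \<Omega>_def using c m \<delta>
          by (intro hoeffding_mixing[OF I]) (auto simp: I_def n)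
        also have "\<dots> \<le> card \<Omega> * (2 * exp (- real n))"
        proof (rule mult_left_mono)
          have "(2::real) \<le> exp 1" using exp_ge_add_one_self[of 1] by simp
          hence "(2::real) ^ (n * r) \<le> exp 1 ^ (n * r)" by (intro power_mono) auto
          also have "\<dots> = exp (real n * r)" by (simp flip: exp_of_nat_mult)
          finally have two: "((2::real) ^ n) ^ r \<le> exp (real n * r)" by (simp add: power_mult)
          have "real n * (real r + 1) \<le> real n * (\<delta>\<^sup>2 * real d / 4)" using d\<delta> by (intro mult_left_mono) auto
          hence "exp (- (\<delta>\<^sup>2 * card ({c} \<times> {..<m}) / 4)) \<le> exp (- (real n * (real r + 1)))"
            by (simp add: m_def card_cartesian_product mult_ac)
          hence "((2::real) ^ n) ^ r * exp (- (\<delta>\<^sup>2 * card ({c} \<times> {..<m}) / 4)) \<le> exp (real n * r) * exp (- (real n * (real r + 1)))"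
            using two by (intro mult_mono) auto
          also have "\<dots> = exp (- real n)" by (simp add: algebra_simps flip: exp_add)
          finally show "2 * (2 ^ n) ^ r * exp (- (\<delta>\<^sup>2 * card ({c} \<times> {..<m}) / 4)) \<le> 2 * exp (- real n)" by simp
        qed simp
        finally show "real (card (B3 c)) \<le> card \<Omega> * (2 * exp (- real n))" .
      qed
      also have "\<dots> = card \<Omega> * (2 * K * exp (- real n))" by (simp add: K_def)
      also have "\<dots> < card \<Omega> * (1 / 2)"
      proof (rule mult_strict_left_mono)
        have "4 * K < exp (real n)" using nK exp_ge_add_one_self[of "real n"] by linarith
        thus "2 * K * exp (- real n) < 1 / 2" by (simp add: exp_minus field_simps)
      qed (use cpos in simp)
      finally show ?thesis by simp
    qed
    have "\<exists>f\<in>\<Omega>. f \<notin> B1 \<and> f \<notin> B2 \<and> (\<forall>c\<in>Col. f \<notin> B3 c)"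
    proof (rule ccontr)
      assume "\<not> ?thesis"
      hence "\<Omega> \<subseteq> (B1 \<union> B2) \<union> (\<Union>c\<in>Col. B3 c)" by auto
      hence "card \<Omega> \<le> card ((B1 \<union> B2) \<union> (\<Union>c\<in>Col. B3 c))"
        using fin Col by (intro card_mono) (auto simp: B1_def B2_def B3_def)
      also have "\<dots> \<le> card (B1 \<union> B2) + card (\<Union>c\<in>Col. B3 c)" by (rule card_Un_le)
      also have "card (B1 \<union> B2) \<le> card B1 + card B2" by (rule card_Un_le)
      finally show False using b1 b2 b3 by linarith
    qed
    then obtain f where f: "f \<in> \<Omega>" "f \<notin> B1" "f \<notin> B2" "\<forall>c\<in>Col. f \<notin> B3 c" by blast
    define F where "F = (\<lambda>u. f (fst u) ! snd u)"
    define heavy where "heavy = {u\<in>U. card {w\<in>U. F w = F u} > M}"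
    \<comment> \<open>\<open>Bc\<close> takes one tuple from every short cycle; \<open>heavy\<close>
      contributes every tuple through an element of degree above \<open>M\<close>.\<close>
    define Bc where "Bc = (\<lambda>cs. fst (hd cs)) ` {cs\<in>\<C>. pos_cycle f cs}"
    define B where "B = Bc \<union> fst ` heavy"
    have "B \<subseteq> I"
    proof -
      have "fst (hd cs) \<in> I" if "cs \<in> \<C>" for cs
      proof -
        have "cs \<noteq> []" "set cs \<subseteq> I \<times> {..<r} \<times> {..<r}" using that by (auto simp: \<C>_def lists_of_def)
        thus ?thesis using hd_in_set by fastforce
      qed
      thus ?thesis by (auto simp: B_def Bc_def heavy_def U_def)
    qed
    moreover have "real (card B) \<le> \<delta> * real m"
    proof -
      have "card B \<le> card Bc + card (fst ` heavy)" unfolding B_def by (rule card_Un_le)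
      also have "card Bc \<le> card {cs\<in>\<C>. pos_cycle f cs}" unfolding Bc_def using finC by (intro card_image_le) auto
      also have "card (fst ` heavy) \<le> card heavy" using finU by (intro card_image_le) (auto simp: heavy_def)
      finally have 1: "real (card B) \<le> cyc f + card heavy" unfolding cyc_def by linarith
      have 2: "cyc f \<le> \<delta> * m / 2" using f unfolding B1_def by auto
      have "real (M * card heavy) \<le> coll f" unfolding heavy_def coll_def of_nat_le_iff
        using card_heavy_le[OF finU, of M F] unfolding F_def .
      also have "\<dots> \<le> M * (\<delta> * m / 2)" using f unfolding B2_def by auto
      finally have "real (card heavy) \<le> \<delta> * m / 2" using Mpos by simp
      thus ?thesis using 1 2 by simp
    qed
    moreover have "cycle_free k (I - B) r f" unfolding cycle_free_def
    proof (intro allI impI, elim conjE)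
      fix cs assume cs: "set cs \<subseteq> (I - B) \<times> {..<r} \<times> {..<r}" and pc: "pos_cycle f cs"
      show "k \<le> length cs"
      proof (rule ccontr)
        assume "\<not> k \<le> length cs"
        moreover have ne: "cs \<noteq> []" using pc by (simp add: pos_cycle_def)
        ultimately have "cs \<in> \<C>" using cs by (auto simp: \<C>_def lists_of_def Suc_le_eq)
        hence "fst (hd cs) \<in> B" using pc by (auto simp: B_def Bc_def)
        moreover have "hd cs \<in> set cs" using ne by simp
        ultimately show False using cs by auto
      qed
    qed
    \<comment> \<open>An element met by a surviving tuple was not of large degree, for otherwise
      this tuple would have been deleted.\<close>
    moreover have "card {u\<in>(I - B) \<times> {..<r}. f (fst u) ! snd u = x} \<le> M" for x
    proof (cases "{u\<in>(I - B) \<times> {..<r}. f (fst u) ! snd u = x} = {}")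
      case True
      thus ?thesis by (simp only: card.empty le0)
    next
      case False
      then obtain u where u: "u \<in> (I - B) \<times> {..<r}" "F u = x" by (auto simp: F_def)
      have "u \<notin> heavy" using u unfolding B_def by (metis DiffD2 UnI2 imageI mem_Times_iff)
      hence "card {w\<in>U. F w = F u} \<le> M" using u by (auto simp: heavy_def U_def)
      moreover have "card {u\<in>(I - B) \<times> {..<r}. f (fst u) ! snd u = x} \<le> card {w\<in>U. F w = F u}"
        using finU u by (intro card_mono) (auto simp: F_def U_def)
      ultimately show ?thesis by simp
    qed
    moreover have "\<forall>i\<in>I. length (f i) = r \<and> set (f i) \<subseteq> {..<n}"
      using f(1) by (auto simp: \<Omega>_def lists_of_def dest!: PiE_mem)
    moreover have "\<forall>c\<in>Col. mixing \<delta> {..<n} r ({c} \<times> {..<m}) f" using f unfolding B3_def by auto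
    ultimately show "\<exists>n>0. \<exists>(f :: 'c \<times> nat \<Rightarrow> nat list) B. almost_sparse Col r \<delta> M k n (d * n) f B"
      using n unfolding almost_sparse_def I_def m_def by blast
  qed
qed

text \<open>The deleted set may be spread unevenly, but every colour keeps at least
  \<open>m - card B\<close> indices. All are trimmed to exactly this number, so that the colours get
  equal weight in the lift.\<close>

lemma base_system:
  fixes Col :: "'c set" and \<epsilon> :: real
  assumes Col: "finite Col" and \<epsilon>: "0 < \<epsilon>"
  obtains M :: nat where
    "\<And>k. \<exists>n>0. \<exists>m>0. \<exists>f :: 'c \<times> nat \<Rightarrow> nat list. sparse_system Col r \<epsilon> M k n m f"
proof -
  define \<delta> where "\<delta> = min \<epsilon> 1 / 8"
  have \<delta>: "0 < \<delta>" "\<delta> \<le> 1/8" "8 * \<delta> \<le> \<epsilon>" using \<epsilon> by (auto simp: \<delta>_def)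
  obtain d M :: nat where d: "d > 0" and
    ex: "\<And>k. \<exists>n>0. \<exists>(f :: 'c \<times> nat \<Rightarrow> nat list) B. almost_sparse Col r \<delta> M k n (d * n) f B"
    using random_system[OF Col \<delta>(1,2), of r] by blast
  show thesis
  proof (rule that[of M])
    fix k
    obtain n f B where n: "n > 0" and sys: "almost_sparse Col r \<delta> M k n (d * n) f B" using ex[of k] by blast
    note sys = sys[unfolded almost_sparse_def]
    have len: "\<forall>i\<in>Col \<times> {..<d * n}. length (f i) = r \<and> set (f i) \<subseteq> {..<n}"
      and B: "B \<subseteq> Col \<times> {..<d * n}" "real (card B) \<le> \<delta> * real (d * n)"
      and cf: "cycle_free k (Col \<times> {..<d * n} - B) r f"
      and deg: "\<forall>x. card {u\<in>(Col \<times> {..<d * n} - B) \<times> {..<r}. f (fst u) ! snd u = x} \<le> M"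
      and mix: "\<forall>c\<in>Col. mixing \<delta> {..<n} r ({c} \<times> {..<d * n}) f"
      using sys by blast+
    define m where "m = d * n"
    have finB: "finite B" using B(1) Col finite_subset by blast
    define m' where "m' = m - card B"
    have m: "m > 0" using d n by (simp add: m_def)
    have "\<delta> * m \<le> 1/8 * m" using \<delta> by (intro mult_right_mono) auto
    hence cB: "card B < m" using B(2) m unfolding m_def by linarith
    hence m': "m' > 0" "real m - real m' \<le> \<delta> * m" using B(2) by (auto simp: m'_def m_def)
    have "\<exists>G g. G \<subseteq> {i\<in>{..<m}. (c, i) \<notin> B} \<and> card G = m' \<and> bij_betw g {..<m'} G" for c
    proof -
      have "{..<m} - {i\<in>{..<m}. (c, i) \<notin> B} \<subseteq> snd ` B" by force
      hence "card ({..<m} - {i\<in>{..<m}. (c, i) \<notin> B}) \<le> card B"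
        by (rule order_trans[OF card_mono[OF finite_imageI[OF finB]] card_image_le[OF finB]])
      moreover have "card ({..<m} - {i\<in>{..<m}. (c, i) \<notin> B}) = m - card {i\<in>{..<m}. (c, i) \<notin> B}"
        by (subst card_Diff_subset) auto
      ultimately have "m' \<le> card {i\<in>{..<m}. (c, i) \<notin> B}" unfolding m'_def by linarith
      then obtain G where G: "G \<subseteq> {i\<in>{..<m}. (c, i) \<notin> B}" "card G = m'" "finite G"
        by (meson obtain_subset_with_card_n)
      obtain g where "bij_betw g {0..<card G} G" using ex_bij_betw_nat_finite[OF G(3)] by blast
      thus ?thesis using G by (auto simp: atLeast0LessThan)
    qed
    then obtain G g where G: "\<And>c. G c \<subseteq> {i\<in>{..<m}. (c, i) \<notin> B}" "\<And>c. card (G c) = m'"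
      "\<And>c. bij_betw (g c) {..<m'} (G c)" by metis
    define \<sigma> where "\<sigma> = (\<lambda>(c, i). (c, g c i))"
    have inj: "inj_on \<sigma> (Col \<times> {..<m'})"
      using G(3) by (auto simp: \<sigma>_def inj_on_def bij_betw_def)
    have gG: "g c i \<in> G c" if "i < m'" for c i using G(3)[of c] that by (auto simp: bij_betw_def)
    have im: "\<sigma> ` (Col \<times> {..<m'}) \<subseteq> Col \<times> {..<m} - B"
      using G(1) gG by (fastforce simp: \<sigma>_def)
    have r1: "\<forall>i\<in>Col \<times> {..<m'}. length (f (\<sigma> i)) = r \<and> set (f (\<sigma> i)) \<subseteq> {..<n}"
      using len im unfolding m_def by blast
    have r2: "cycle_free k (Col \<times> {..<m'}) r (\<lambda>i. f (\<sigma> i))"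
      by (rule cycle_free_reindex[OF cf[folded m_def] inj im])
    have "card {u\<in>(Col \<times> {..<m'}) \<times> {..<r}. f (\<sigma> (fst u)) ! snd u = x} \<le> M" for x
    proof -
      have "card {u\<in>(Col \<times> {..<m'}) \<times> {..<r}. f (\<sigma> (fst u)) ! snd u = x} \<le>
        card {u\<in>(Col \<times> {..<m} - B) \<times> {..<r}. f (fst u) ! snd u = x}"
      proof (rule card_inj_on_le[of "\<lambda>u. (\<sigma> (fst u), snd u)"])
        show "inj_on (\<lambda>u. (\<sigma> (fst u), snd u)) {u\<in>(Col \<times> {..<m'}) \<times> {..<r}. f (\<sigma> (fst u)) ! snd u = x}"
        proof (rule inj_onI)
          fix u w
          assume "u \<in> {u\<in>(Col \<times> {..<m'}) \<times> {..<r}. f (\<sigma> (fst u)) ! snd u = x}"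
            "w \<in> {u\<in>(Col \<times> {..<m'}) \<times> {..<r}. f (\<sigma> (fst u)) ! snd u = x}"
            "(\<sigma> (fst u), snd u) = (\<sigma> (fst w), snd w)"
          thus "u = w" using inj_onD[OF inj, of "fst u" "fst w"] by (auto simp: prod_eq_iff)
        qed
        show "(\<lambda>u. (\<sigma> (fst u), snd u)) ` {u\<in>(Col \<times> {..<m'}) \<times> {..<r}. f (\<sigma> (fst u)) ! snd u = x}
          \<subseteq> {u\<in>(Col \<times> {..<m} - B) \<times> {..<r}. f (fst u) ! snd u = x}"
          using im by (auto simp: image_subset_iff)
      qed (use Col in simp)
      thus ?thesis using deg unfolding m_def by (meson order_trans)
    qed
    hence r3: "\<forall>x. card {u\<in>(Col \<times> {..<m'}) \<times> {..<r}. f (\<sigma> (fst u)) ! snd u = x} \<le> M" by blast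
    have "mixing \<epsilon> {..<n} r ({c} \<times> {..<m'}) (\<lambda>i. f (\<sigma> i))" if c: "c \<in> Col" for c
    proof -
      have "mixing \<epsilon> {..<n} r ({c} \<times> {..<m'}) (\<lambda>(c', i). f (c', g c i))"
        using mix c G(1)[of c]
        by (intro mixing_thin[OF _ _ _ G(2) G(3) m'(2) \<delta>]) (auto simp: m_def)
      moreover have "{i\<in>{c} \<times> {..<m'}. list_all2 (\<in>) (case i of (c', i) \<Rightarrow> f (c', g c i)) As} =
        {i\<in>{c} \<times> {..<m'}. list_all2 (\<in>) (f (\<sigma> i)) As}" for As by (auto simp: \<sigma>_def)
      ultimately show ?thesis unfolding mixing_def by simp
    qed
    hence r4: "\<forall>c\<in>Col. mixing \<epsilon> {..<n} r ({c} \<times> {..<m'}) (\<lambda>i. f (\<sigma> i))" by blast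
    show "\<exists>n>0. \<exists>m>0. \<exists>f :: 'c \<times> nat \<Rightarrow> nat list. sparse_system Col r \<epsilon> M k n m f"
      by (rule exI[of _ n], rule conjI, rule n, rule exI[of _ m'], rule conjI, rule m'(1),
          rule exI[of _ "\<lambda>i. f (\<sigma> i)"], unfold sparse_system_def, intro conjI r1 r2 r3 r4)
  qed
qed

subsection \<open>Lifting a tuple system along walks\<close>

text \<open>Closes a stretch of a walk at an element met again; the first tuple may then have to be
  entered at \<open>a0\<close> and not at its own entry position.\<close>

lemma pos_cycle_segment:
  fixes i :: "nat \<Rightarrow> 'i" and a b :: "nat \<Rightarrow> nat"
  assumes e: "e > 0" and inj: "inj_on i {s..<s + e}" and ab: "\<And>j. a j \<noteq> b j" "a0 \<noteq> b s"
    and link: "\<And>j. f (i j) ! b j = f (i (Suc j)) ! a (Suc j)"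
    and wrap: "f (i (s + e - 1)) ! b (s + e - 1) = f (i s) ! a0"
  shows "pos_cycle f (map (\<lambda>j. (i j, if j = s then a0 else a j, b j)) [s..<s + e])" (is "pos_cycle f ?cs")
proof -
  have len: "length ?cs = e" by simp
  have nth: "?cs ! j = (i (s + j), if j = 0 then a0 else a (s + j), b (s + j))" if "j < e" for j
    using that by simp
  have "map fst ?cs = map i [s..<s + e]" by simp
  hence "distinct (map fst ?cs)" using inj by (simp only: distinct_map set_upt distinct_upt simp_thms)
  moreover have "fst (snd (?cs ! j)) \<noteq> snd (snd (?cs ! j)) \<and>
      f (fst (?cs ! j)) ! snd (snd (?cs ! j)) =
      f (fst (?cs ! (Suc j mod e))) ! fst (snd (?cs ! (Suc j mod e)))" if j: "j < e" for j
  proof -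
    have "fst (snd (?cs ! j)) \<noteq> snd (snd (?cs ! j))" using nth[OF j] ab(1)[of "s + j"] ab(2) by auto
    moreover have "f (fst (?cs ! j)) ! snd (snd (?cs ! j)) =
      f (fst (?cs ! (Suc j mod e))) ! fst (snd (?cs ! (Suc j mod e)))"
    proof (cases "Suc j = e")
      case True
      have "?cs ! (Suc j mod e) = (i s, a0, b s)" using nth[of 0] e True by simp
      moreover have "s + e - 1 = s + j" using True by simp
      ultimately show ?thesis using nth[OF j] wrap by simp
    next
      case False
      hence "Suc j < e" using j by simp
      thus ?thesis using nth[OF j] nth[of "Suc j"] link[of "s + j"] by simp
    qed
    ultimately show ?thesis by simp
  qed
  ultimately show ?thesis unfolding pos_cycle_def len using e by auto
qed

text \<open>A shortest return \<open>i l = i (l + d)\<close> has distinct indices in between. If the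
  tuple is re-entered at a position other than the one where it was left, these \<open>d\<close>
  tuples form a cycle. Otherwise the walk is back at the same element, and dropping this tuple
  leaves a cycle of length \<open>d - 1\<close>; here \<open>d \<noteq> 1\<close> by the last
  hypothesis.\<close>

lemma closed_walk_pos_cycle:
  fixes i :: "nat \<Rightarrow> 'i" and a b :: "nat \<Rightarrow> nat"
  assumes t: "t > 0" and per: "\<And>j. i (j + t) = i j"
    and mem: "\<And>j. i j \<in> I" "\<And>j. a j < r" "\<And>j. b j < r"
    and ab: "\<And>j. a j \<noteq> b j" and link: "\<And>j. f (i j) ! b j = f (i (Suc j)) ! a (Suc j)"
    and nb: "\<And>j. (i j, b j) \<noteq> (i (Suc j), a (Suc j))"
  shows "\<exists>cs. set cs \<subseteq> I \<times> {..<r} \<times> {..<r} \<and> pos_cycle f cs \<and> length cs \<le> t"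
proof -
  define d where "d = (LEAST d. d > 0 \<and> (\<exists>l. i l = i (l + d)))"
  have ex: "t > 0 \<and> (\<exists>l. i l = i (l + t))" using t per by simp
  have "d > 0 \<and> (\<exists>l. i l = i (l + d))" unfolding d_def by (rule LeastI, rule ex)
  then obtain l where d: "d > 0" and l: "i l = i (l + d)" by blast
  have dt: "d \<le> t" unfolding d_def by (rule Least_le, rule ex)
  have distinct: "x = y" if "i x = i y" "x \<in> {l..<l + d}" "y \<in> {l..<l + d}" for x y
  proof -
    have "\<not> (x < y \<and> i x = i y)" if "x \<in> {l..<l + d}" "y \<in> {l..<l + d}" for x y
    proof
      assume *: "x < y \<and> i x = i y"
      have "i x = i (x + (y - x))" using * by simp
      hence "y - x > 0 \<and> (\<exists>l. i l = i (l + (y - x)))" using * by (metis zero_less_diff)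
      hence "d \<le> y - x" unfolding d_def by (rule Least_le)
      thus False using that * by auto
    qed
    from this[of x y] this[of y x] show ?thesis using that by (cases x y rule: linorder_cases) auto
  qed
  have inj: "inj_on i {l..<l + d}" using distinct by (auto simp: inj_on_def)
  define sub where "sub = (\<lambda>s e a0. map (\<lambda>j. (i j, if j = s then a0 else a j, b j)) [s..<s + e])"
  have sub: "set (sub s e a0) \<subseteq> I \<times> {..<r} \<times> {..<r}" if "a0 < r" for s e a0
    using mem that by (auto simp: sub_def)
  show ?thesis
  proof (cases "a (l + d) = b l")
    case False
    have s: "Suc (l + d - 1) = l + d" using d by simp
    have "f (i (l + d - 1)) ! b (l + d - 1) = f (i l) ! a (l + d)" using link[of "l + d - 1"] unfolding s l .
    hence "pos_cycle f (sub l d (a (l + d)))" unfolding sub_def by (rule pos_cycle_segment[OF d inj ab False link])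
    moreover have "length (sub l d (a (l + d))) \<le> t" using dt by (simp add: sub_def)
    ultimately show ?thesis using sub[OF mem(2)] by blast
  next
    case True
    have "d \<noteq> 1" using nb[of l] l True by auto
    hence d': "d - 1 > 0" and s: "Suc (Suc l + (d - 1) - 1) = l + d" using d by auto
    have inj': "inj_on i {Suc l..<Suc l + (d - 1)}" by (rule inj_on_subset[OF inj]) auto
    have "f (i (Suc l + (d - 1) - 1)) ! b (Suc l + (d - 1) - 1) = f (i (l + d)) ! a (l + d)"
      using link[of "Suc l + (d - 1) - 1"] unfolding s .
    also have "\<dots> = f (i (Suc l)) ! a (Suc l)" unfolding True l[symmetric] by (rule link)
    finally have "pos_cycle f (sub (Suc l) (d - 1) (a (Suc l)))"
      unfolding sub_def by (rule pos_cycle_segment[OF d' inj' ab ab link])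
    moreover have "length (sub (Suc l) (d - 1) (a (Suc l))) \<le> t"
      using dt unfolding sub_def length_map length_upt by linarith
    ultimately show ?thesis using sub[OF mem(2)] by blast
  qed
qed

text \<open>Mixed radix notation of a torus point and a fibre coordinate, computable by additions
  and multiplications alone.\<close>

definition code :: "nat \<Rightarrow> nat \<Rightarrow> nat \<times> nat \<Rightarrow> nat \<Rightarrow> nat" where
  "code m q u j = (fst u * m + snd u) * q + j"

lemma pair_code_less:
  fixes x y m n :: nat
  assumes "x < n" "y < m"
  shows "x * m + y < n * m"
proof -
  have "x * m + y < Suc x * m" using assms by simp
  also have "\<dots> \<le> n * m" using assms by (intro mult_le_mono1) simp
  finally show ?thesis .
qed

lemma pair_code_inj:
  fixes x y m :: nat
  assumes "x * m + y = x' * m + y'" "y < m" "y' < m"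
  shows "x = x' \<and> y = y'"
proof -
  have "(x * m + y) div m = (x' * m + y') div m" "(x * m + y) mod m = (x' * m + y') mod m"
    by (simp_all only: assms(1))
  thus ?thesis using assms(2,3) by simp
qed

lemma code_less: "u \<in> torus m \<Longrightarrow> j < q \<Longrightarrow> code m q u j < m * m * q"
  unfolding code_def torus_def by (intro pair_code_less) (auto intro: pair_code_less)

lemma code_inj:
  assumes "code m q u j = code m q u' j'" "u \<in> torus m" "u' \<in> torus m" "j < q" "j' < q"
  shows "u = u' \<and> j = j'"
proof -
  have "fst u * m + snd u = fst u' * m + snd u' \<and> j = j'"
    using assms unfolding code_def by (intro pair_code_inj) auto
  thus ?thesis using pair_code_inj[of "fst u" m "snd u" "fst u'" "snd u'"] assms(2,3)
    by (auto simp: torus_def prod_eq_iff)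
qed

lemma bij_betw_code: "bij_betw (\<lambda>(u, j). code m q u j) (torus m \<times> {..<q}) {..<m * m * q}"
proof -
  have inj: "inj_on (\<lambda>(u, j). code m q u j) (torus m \<times> {..<q})"
    by (auto simp: inj_on_def dest!: code_inj)
  have "(\<lambda>(u, j). code m q u j) ` (torus m \<times> {..<q}) = {..<m * m * q}"
    using card_image[OF inj]
    by (intro card_subset_eq) (auto simp: code_less card_cartesian_product card_torus)
  thus ?thesis using inj by (simp add: bij_betw_def)
qed

definition lift :: "nat \<Rightarrow> nat \<Rightarrow> ('c \<Rightarrow> nat list list) \<Rightarrow> ('c \<times> nat \<Rightarrow> nat list) \<Rightarrow>
    ('c \<times> nat) \<times> (nat \<times> nat) \<Rightarrow> nat list" where
  "lift m q wd f = (\<lambda>(i, v). map2 (code m q) (walk m (wd (fst i)) v) (f i))"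

context
  fixes I :: "('c \<times> nat) set" and f :: "'c \<times> nat \<Rightarrow> nat list" and wd :: "'c \<Rightarrow> nat list list"
    and m q r :: nat
  assumes len: "\<And>i. i \<in> I \<Longrightarrow> length (f i) = r \<and> set (f i) \<subseteq> {..<q} \<and> length (wd (fst i)) = r"
begin

lemma lift_nth:
  assumes "i \<in> I" "p < r"
  shows "lift m q wd f (i, v) ! p = code m q (walk m (wd (fst i)) v ! p) (f i ! p)"
  using len[OF assms(1)] assms(2) by (simp add: lift_def)

lemma f_less: "i \<in> I \<Longrightarrow> p < r \<Longrightarrow> f i ! p < q"
  using len by (metis lessThan_iff nth_mem subsetD)

lemma walk_mem: "i \<in> I \<Longrightarrow> p < r \<Longrightarrow> v \<in> torus m \<Longrightarrow> walk m (wd (fst i)) v ! p \<in> torus m"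
  using bij_betw_walk[of p "wd (fst i)" m] len by (auto simp: bij_betw_def)

lemma walk_inj:
  "walk m (wd (fst i)) v ! p = walk m (wd (fst i)) v' ! p \<Longrightarrow> i \<in> I \<Longrightarrow> p < r \<Longrightarrow>
    v \<in> torus m \<Longrightarrow> v' \<in> torus m \<Longrightarrow> v = v'"
  using bij_betw_walk[of p "wd (fst i)" m] len by (auto simp: bij_betw_def inj_on_def)

lemma lift_nth_eqD:
  assumes "lift m q wd f (i, v) ! p = lift m q wd f (i', v') ! p'"
    "i \<in> I" "i' \<in> I" "p < r" "p' < r" "v \<in> torus m" "v' \<in> torus m"
  shows "walk m (wd (fst i)) v ! p = walk m (wd (fst i')) v' ! p' \<and> f i ! p = f i' ! p'"
  using assms lift_nth by (intro code_inj[of m q]) (auto simp: walk_mem f_less)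

lemma lift_in:
  assumes "i \<in> I" "v \<in> torus m"
  shows "length (lift m q wd f (i, v)) = r \<and> set (lift m q wd f (i, v)) \<subseteq> {..<m * m * q}"
proof -
  have l: "length (lift m q wd f (i, v)) = r" using len[OF assms(1)] by (simp add: lift_def)
  have "lift m q wd f (i, v) ! p < m * m * q" if "p < r" for p
    using lift_nth[OF assms(1) that] code_less walk_mem[OF assms(1) that assms(2)] f_less[OF assms(1) that]
    by simp
  thus ?thesis using l by (auto simp: in_set_conv_nth)
qed

text \<open>Forgetting the base points turns a cycle of the lift into a closed walk of the finite
  system. Distinct lifted tuples may have the same index, but by \<open>walk_inj\<close> they cannot
  then meet at the same position of both, so \<open>closed_walk_pos_cycle\<close> applies.\<close>

lemma lift_cycle_free:
  assumes cf: "cycle_free k I r f"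
  shows "cycle_free k (I \<times> torus m) r (lift m q wd f)"
  unfolding cycle_free_def
proof (intro allI impI, elim conjE)
  fix cs assume cs: "set cs \<subseteq> (I \<times> torus m) \<times> {..<r} \<times> {..<r}" and pc: "pos_cycle (lift m q wd f) cs"
  define t where "t = length cs"
  have t: "t > 0" using pc by (simp add: t_def pos_cycle_def)
  define iv where "iv = (\<lambda>j. fst (cs ! (j mod t)))"
  define a where "a = (\<lambda>j. fst (snd (cs ! (j mod t))))"
  define b where "b = (\<lambda>j. snd (snd (cs ! (j mod t))))"
  define i where "i = (\<lambda>j. fst (iv j))"
  define v where "v = (\<lambda>j. snd (iv j))"
  have iv: "iv j = (i j, v j)" for j by (simp add: i_def v_def)
  have "cs ! (j mod t) \<in> (I \<times> torus m) \<times> {..<r} \<times> {..<r}" for j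
    using cs t by (metis mod_less_divisor nth_mem subsetD t_def)
  hence mem: "i j \<in> I" "v j \<in> torus m" "a j < r" "b j < r" for j
    by (simp_all add: i_def v_def iv_def a_def b_def mem_Times_iff)
  have pcD: "a j \<noteq> b j" "lift m q wd f (iv j) ! b j = lift m q wd f (iv (Suc j)) ! a (Suc j)" for j
  proof -
    have "j mod t < t" using t by simp
    hence "fst (snd (cs ! (j mod t))) \<noteq> snd (snd (cs ! (j mod t))) \<and>
        lift m q wd f (fst (cs ! (j mod t))) ! snd (snd (cs ! (j mod t))) =
        lift m q wd f (fst (cs ! (Suc (j mod t) mod t))) ! fst (snd (cs ! (Suc (j mod t) mod t)))"
      using pc unfolding pos_cycle_def t_def by blast
    thus "a j \<noteq> b j" "lift m q wd f (iv j) ! b j = lift m q wd f (iv (Suc j)) ! a (Suc j)"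
      unfolding a_def b_def iv_def by (simp_all add: mod_Suc_eq)
  qed
  have link: "walk m (wd (fst (i j))) (v j) ! b j = walk m (wd (fst (i (Suc j)))) (v (Suc j)) ! a (Suc j) \<and>
      f (i j) ! b j = f (i (Suc j)) ! a (Suc j)" for j
    using pcD(2)[of j] mem unfolding iv by (intro lift_nth_eqD) auto
  have "\<exists>cs. set cs \<subseteq> I \<times> {..<r} \<times> {..<r} \<and> pos_cycle f cs \<and> length cs \<le> t"
  proof (rule closed_walk_pos_cycle[OF t, of i I a r b f])
    show "(i j, b j) \<noteq> (i (Suc j), a (Suc j))" for j
    proof
      assume eq: "(i j, b j) = (i (Suc j), a (Suc j))"
      hence "v j = v (Suc j)" using link[of j] mem walk_inj by (metis prod.inject)
      hence "iv j = iv (Suc j)" using eq by (simp add: iv)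
      hence "map fst cs ! (j mod t) = map fst cs ! (Suc j mod t)" using t unfolding iv_def t_def by simp
      moreover have "distinct (map fst cs)" using pc by (simp add: pos_cycle_def)
      \<comment> \<open>This leaves \<open>t = 1\<close>, where entry and exit of the only tuple
        would agree.\<close>
      ultimately have "j mod t = Suc j mod t"
        using t nth_eq_iff_index_eq[of "map fst cs" "j mod t" "Suc j mod t"] by (simp add: t_def)
      hence "a j = b j" using eq by (simp add: a_def b_def)
      thus False using pcD(1) by blast
    qed
    show "i (j + t) = i j" for j by (simp add: i_def iv_def)
  qed (use mem pcD link in auto)
  thus "k \<le> length cs" using cf unfolding cycle_free_def t_def by (meson order_trans)
qed

text \<open>Over a fixed element, index and position determine the base point \<open>v\<close> by
  \<open>walk_inj\<close>, so its incidences inject into those of a single element of the finite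
  system.\<close>

lemma lift_degree:
  assumes fin: "finite I" and deg: "\<And>x. card {u\<in>I \<times> {..<r}. f (fst u) ! snd u = x} \<le> M"
  shows "card {u\<in>(I \<times> torus m) \<times> {..<r}. lift m q wd f (fst u) ! snd u = x} \<le> M"
proof (cases "{u\<in>(I \<times> torus m) \<times> {..<r}. lift m q wd f (fst u) ! snd u = x} = {}")
  case True
  thus ?thesis by (simp only: card.empty le0)
next
  case False
  let ?S = "{u\<in>(I \<times> torus m) \<times> {..<r}. lift m q wd f (fst u) ! snd u = x}"
  obtain i0 v0 p0 where u0: "((i0, v0), p0) \<in> ?S" using False by auto
  define y where "y = f i0 ! p0"
  have key: "walk m (wd (fst i)) v ! p = walk m (wd (fst i0)) v0 ! p0 \<and> f i ! p = y"
    if "((i, v), p) \<in> ?S" for i v p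
    unfolding y_def using that u0 by (intro lift_nth_eqD) auto
  have "card ?S \<le> card {u\<in>I \<times> {..<r}. f (fst u) ! snd u = y}"
  proof (rule card_inj_on_le[of "\<lambda>u. (fst (fst u), snd u)"])
    show "inj_on (\<lambda>u. (fst (fst u), snd u)) ?S"
    proof (rule inj_onI)
      fix s s' assume s: "s \<in> ?S" "s' \<in> ?S" and eq: "(fst (fst s), snd s) = (fst (fst s'), snd s')"
      obtain i v p v' where s': "s = ((i, v), p)" "s' = ((i, v'), p)" using eq by (metis prod.collapse prod.inject)
      have "walk m (wd (fst i)) v ! p = walk m (wd (fst i)) v' ! p"
        using key[of i v p] key[of i v' p] s unfolding s' by simp
      hence "v = v'" using s unfolding s' by (intro walk_inj[of i v p v']) auto
      thus "s = s'" by (simp add: s')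
    qed
    show "(\<lambda>u. (fst (fst u), snd u)) ` ?S \<subseteq> {u\<in>I \<times> {..<r}. f (fst u) ! snd u = y}"
      using key by auto
  qed (use fin in simp)
  thus ?thesis using deg[of y] by simp
qed

end

section \<open>Equidistribution of the lift\<close>

lemma prod_list_nth: "(\<Prod>x\<leftarrow>xs. g x) = (\<Prod>p<length xs. g (xs ! p))"
  for g :: "'a \<Rightarrow> 'b :: comm_monoid_mult"
  by (induction xs) (simp_all add: prod.lessThan_Suc_shift del: prod.lessThan_Suc)

definition lift_indices ::
    "nat \<Rightarrow> nat \<Rightarrow> nat \<Rightarrow> nat \<Rightarrow> 'r \<Rightarrow> ((('r \<times> nat list list) \<times> nat) \<times> (nat \<times> nat)) set" where
  "lift_indices t r m0 m R = (({R} \<times> walk_colours t r) \<times> {..<m0}) \<times> torus m"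

text \<open>For a fixed colour and a fixed \<open>v\<close>, mixing of the finite system replaces
  the sets by the densities \<open>Fs\<close> of their slices in the fibres over the walk, with
  relative error \<open>\<epsilon>0\<close>. The mean of the product of densities over colours and
  \<open>v\<close> is what \<open>walk_mixing\<close> estimates, at cost \<kappa> per
  coordinate.\<close>

lemma lift_mixing:
  fixes f :: "('r \<times> nat list list) \<times> nat \<Rightarrow> nat list" and \<kappa> \<epsilon>0 :: real
  assumes len: "\<And>i. i \<in> ({R} \<times> walk_colours t r) \<times> {..<m0} \<Longrightarrow> length (f i) = r \<and> set (f i) \<subseteq> {..<q}"
    and mix: "\<And>ws. ws \<in> walk_colours t r \<Longrightarrow> mixing \<epsilon>0 {..<q} r ({(R, ws)} \<times> {..<m0}) f"
    and m: "m > 0" and q: "q > 0" and \<kappa>: "\<kappa> \<ge> 0" "(799 / 800) ^ t \<le> \<kappa>\<^sup>2"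
  shows "mixing (\<epsilon>0 + r * \<kappa>) {..<m * m * q} r (lift_indices t r m0 m R) (lift m q snd f)"
  unfolding mixing_def
proof (intro allI impI, elim conjE)
  fix As :: "nat set list"
  assume lenAs: "length As = r" and subAs: "\<forall>B\<in>set As. B \<subseteq> {..<m * m * q}"
  let ?WC = "walk_colours t r" and ?J = "lift_indices t r m0 m R"
  define sl where "sl = (\<lambda>A u. {j\<in>{..<q}. code m q u j \<in> A})"
  define Fs where "Fs = map (\<lambda>A u. real (card (sl A u)) / real q) As"
  define H where "H = (\<lambda>ws v. {i\<in>{..<m0}. list_all2 (\<in>) (lift m q snd f (((R, ws), i), v)) As})"
  define C where "C = real ((5 ^ t) ^ r)"
  have lenFs: "length Fs = r" by (simp add: Fs_def lenAs)
  have walkmem: "walk m ws v ! p \<in> torus m" if "ws \<in> ?WC" "v \<in> torus m" "p < r" for ws v p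
    using bij_betw_walk[of p ws m] that by (auto simp: bij_betw_def walk_colours_def lists_of_def)
  have total: "card {x\<in>?J. list_all2 (\<in>) (lift m q snd f x) As} = (\<Sum>ws\<in>?WC. \<Sum>v\<in>torus m. card (H ws v))"
  proof -
    have eq: "{x\<in>?J. list_all2 (\<in>) (lift m q snd f x) As} =
      (\<lambda>y. (((R, fst (fst y)), snd y), snd (fst y))) ` (SIGMA z:?WC \<times> torus m. H (fst z) (snd z))"
      by (auto simp: lift_indices_def H_def image_iff) 
    have "inj_on (\<lambda>y. (((R, fst (fst y)), snd y), snd (fst y))) (SIGMA z:?WC \<times> torus m. H (fst z) (snd z))"
      by (auto simp: inj_on_def)
    from card_image[OF this] show ?thesis unfolding eq
      by (simp add: card_SigmaI H_def sum.cartesian_product case_prod_beta)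
  qed
  have local: "\<bar>real (card (H ws v)) - m0 * (\<Prod>p<r. (Fs ! p) (walk m ws v ! p))\<bar> \<le> \<epsilon>0 * m0"
    if ws: "ws \<in> ?WC" and v: "v \<in> torus m" for ws v
  proof -
    define Bs where "Bs = map2 (\<lambda>u A. sl A u) (walk m ws v) As"
    have lenw: "length ws = r" using ws by (simp add: walk_colours_def lists_of_def)
    have lenB: "length Bs = r" by (simp add: Bs_def lenw lenAs)
    have nthB: "Bs ! p = sl (As ! p) (walk m ws v ! p)" if "p < r" for p
      using that by (simp add: Bs_def lenw lenAs)
    have subB: "\<forall>B\<in>set Bs. B \<subseteq> {..<q}" by (auto simp: Bs_def sl_def set_zip)
    have "{i\<in>{(R, ws)} \<times> {..<m0}. list_all2 (\<in>) (f i) Bs} = Pair (R, ws) ` H ws v"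
    proof -
      have "list_all2 (\<in>) (f ((R, ws), i)) Bs = list_all2 (\<in>) (lift m q snd f (((R, ws), i), v)) As"
        if i: "i < m0" for i
      proof -
        have l: "length (f ((R, ws), i)) = r" "set (f ((R, ws), i)) \<subseteq> {..<q}" using len ws i by auto
        have "f ((R, ws), i) ! p < q" if "p < r" for p using l that by (metis lessThan_iff nth_mem subsetD)
        thus ?thesis
          by (auto simp: list_all2_conv_all_nth l lenB lenAs nthB sl_def lift_def lenw)
      qed
      thus ?thesis by (auto simp: H_def)
    qed
    hence "card {i\<in>{(R, ws)} \<times> {..<m0}. list_all2 (\<in>) (f i) Bs} = card (H ws v)"
      by (simp add: card_image inj_on_def)
    moreover have "(\<Prod>B\<leftarrow>Bs. real (card B) / real (card {..<q})) = (\<Prod>p<r. (Fs ! p) (walk m ws v ! p))"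
      unfolding prod_list_nth lenB by (intro prod.cong refl) (simp add: nthB Fs_def lenAs)
    ultimately show ?thesis using mix[OF ws] lenB subB unfolding mixing_def
      by (auto dest!: spec[of _ Bs] simp: card_cartesian_product)
  qed
  define W where "W = (\<Sum>v\<in>torus m. walk_avg m t Fs v)"
  define P where "P = (\<Prod>A\<leftarrow>As. real (card A) / real (m * m * q))"
  have walksum: "(\<Sum>ws\<in>?WC. \<Sum>v\<in>torus m. \<Prod>p<r. (Fs ! p) (walk m ws v ! p)) = C * W"
    unfolding W_def walk_avg_eq lenFs C_def
    by (subst sum.swap) (simp add: sum_divide_distrib[symmetric])
  have cW: "card ?WC = C" by (simp add: card_walk_colours C_def)
  have 1: "\<bar>real (card {x\<in>?J. list_all2 (\<in>) (lift m q snd f x) As}) - m0 * (C * W)\<bar> \<le> \<epsilon>0 * m0 * (C * (m * m))"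
  proof -
    have "real (card {x\<in>?J. list_all2 (\<in>) (lift m q snd f x) As}) - m0 * (C * W) =
      (\<Sum>ws\<in>?WC. \<Sum>v\<in>torus m. real (card (H ws v)) - m0 * (\<Prod>p<r. (Fs ! p) (walk m ws v ! p)))"
      unfolding total walksum[symmetric] by (simp add: sum_subtractf sum_distrib_left)
    also have "\<bar>\<dots>\<bar> \<le> (\<Sum>ws\<in>?WC. \<Sum>v\<in>torus m. \<epsilon>0 * m0)"
      by (intro order_trans[OF sum_abs] sum_mono local)
    also have "\<dots> = \<epsilon>0 * m0 * (C * (m * m))" by (simp add: card_torus cW)
    finally show ?thesis .
  qed
  have F01: "0 \<le> F v \<and> F v \<le> 1" if "F \<in> set Fs" for F v
  proof -
    have "card (sl A u) \<le> q" for A u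
      using card_mono[of "{..<q}" "sl A u"] by (auto simp: sl_def)
    thus ?thesis using that q by (cases v) (auto simp: Fs_def)
  qed
  have Favg: "(\<Sum>u\<in>torus m. real (card (sl A u)) / real q) / (m * m) = real (card A) / real (m * m * q)"
    if A: "A \<subseteq> {..<m * m * q}" for A
  proof -
    have "bij_betw (\<lambda>(u, j). code m q u j) (SIGMA u:torus m. sl A u) A"
      unfolding bij_betw_def
    proof
      show "inj_on (\<lambda>(u, j). code m q u j) (SIGMA u:torus m. sl A u)"
        using bij_betw_code[of m q] unfolding bij_betw_def
        by (elim conjE) (erule inj_on_subset, auto simp: sl_def)
      have "A \<subseteq> (\<lambda>(u, j). code m q u j) ` (torus m \<times> {..<q})"
        using bij_betw_code[of m q] A by (simp add: bij_betw_def)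
      thus "(\<lambda>(u, j). code m q u j) ` (SIGMA u:torus m. sl A u) = A" by (fastforce simp: sl_def)
    qed
    hence "card (SIGMA u:torus m. sl A u) = card A" by (rule bij_betw_same_card)
    moreover have "card (SIGMA u:torus m. sl A u) = (\<Sum>u\<in>torus m. card (sl A u))"
      by (simp add: card_SigmaI sl_def)
    ultimately have "(\<Sum>u\<in>torus m. real (card (sl A u))) = real (card A)" by (simp flip: of_nat_sum)
    thus ?thesis by (simp add: sum_divide_distrib[symmetric] mult_ac)
  qed
  have "\<bar>W / (m * m) - (\<Prod>F\<leftarrow>Fs. (\<Sum>v\<in>torus m. F v) / (m * m))\<bar> \<le> length Fs * \<kappa>"
    using walk_mixing[of m Fs \<kappa> t] m F01 \<kappa> by (simp add: W_def)
  also have "(\<Prod>F\<leftarrow>Fs. (\<Sum>v\<in>torus m. F v) / (m * m)) = P"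
    unfolding P_def Fs_def map_map comp_def
    by (rule arg_cong[where f = prod_list], rule map_cong[OF refl]) (use Favg subAs in auto)
  finally have 2: "\<bar>W / (m * m) - P\<bar> \<le> r * \<kappa>" by (simp add: lenFs)
  have "\<bar>m0 * (C * W) - m0 * C * (m * m) * P\<bar> = m0 * C * (m * m) * \<bar>W / (m * m) - P\<bar>"
  proof -
    have "m0 * (C * W) - m0 * C * (m * m) * P = m0 * C * (m * m) * (W / (m * m) - P)"
      using m by (simp add: field_simps)
    moreover have "m0 * C * (m * m) \<ge> 0" by (simp add: C_def)
    ultimately show ?thesis by (simp add: abs_mult C_def)
  qed
  also have "\<dots> \<le> m0 * C * (m * m) * (r * \<kappa>)" using 2 by (intro mult_left_mono) (auto simp: C_def)
  finally have 3: "\<bar>m0 * (C * W) - m0 * C * (m * m) * P\<bar> \<le> m0 * C * (m * m) * (r * \<kappa>)" .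
  have cJ: "real (card ?J) = m0 * C * (m * m)"
    by (simp add: lift_indices_def card_cartesian_product cW card_torus)
  have "\<bar>real (card {x\<in>?J. list_all2 (\<in>) (lift m q snd f x) As}) - card ?J * P\<bar> \<le> (\<epsilon>0 + r * \<kappa>) * card ?J"
    unfolding cJ using 1 3 by (simp add: algebra_simps abs_le_iff)
  thus "\<bar>real (card {x\<in>?J. list_all2 (\<in>) (lift m q snd f x) As}) -
      card ?J * (\<Prod>B\<leftarrow>As. real (card B) / real (card {..<m * m * q}))\<bar> \<le> (\<epsilon>0 + r * \<kappa>) * card ?J"
    by (simp add: P_def)
qed

section \<open>From systems of indexed tuples to relational structures\<close>

locale tuple_system =
  fixes \<tau> :: "'r set" and ar :: "'r \<Rightarrow> nat" and r k M N n :: nat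
    and J :: "'r \<Rightarrow> 'i set" and f :: "'i \<Rightarrow> nat list"
  assumes fin_\<tau>: "finite \<tau>" and ar_le: "\<And>R. R \<in> \<tau> \<Longrightarrow> ar R \<le> r"
    and fin_J: "\<And>R. R \<in> \<tau> \<Longrightarrow> finite (J R)" and ne_J: "\<And>R. R \<in> \<tau> \<Longrightarrow> J R \<noteq> {}"
    and disj_J: "\<And>R R'. R \<in> \<tau> \<Longrightarrow> R' \<in> \<tau> \<Longrightarrow> R \<noteq> R' \<Longrightarrow> J R \<inter> J R' = {}"
    and len_f: "\<And>R i. R \<in> \<tau> \<Longrightarrow> i \<in> J R \<Longrightarrow> length (f i) = r"
    and set_f: "\<And>R i. R \<in> \<tau> \<Longrightarrow> i \<in> J R \<Longrightarrow> set (f i) \<subseteq> {..<N}"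
    and N_pos: "N > 0" and N_le: "N \<le> n"
    and cf: "cycle_free k (\<Union>R\<in>\<tau>. J R) r f" and k3: "k \<ge> 3"
    and deg: "\<And>x. card {u\<in>(\<Union>R\<in>\<tau>. J R) \<times> {..<r}. f (fst u) ! snd u = x} \<le> M"
begin

text \<open>All tuples have the common length \<open>r\<close>, and a relation keeps the initial
  segment of its arity. Expansion concerns arities at least 2, so the other relations are left
  empty. The points from \<open>N\<close> on are isolated.\<close>

definition struct :: "('r, nat) rel_structure" where
  "struct = \<lparr>base = {..<n},
     rel = (\<lambda>R. if R \<in> \<tau> \<and> 2 \<le> ar R then (\<lambda>i. take (ar R) (f i)) ` J R else {})\<rparr>"

lemma base_struct [simp]: "base struct = {..<n}" by (simp add: struct_def)

lemma rel_struct: "rel struct R = (if R \<in> \<tau> \<and> 2 \<le> ar R then (\<lambda>i. take (ar R) (f i)) ` J R else {})"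
  by (simp add: struct_def)

lemma is_structure_struct: "is_structure \<tau> ar struct"
  unfolding is_structure_def
proof (intro conjI ballI)
  fix R xs assume R: "R \<in> \<tau>" and "xs \<in> rel struct R"
  then obtain i where i: "i \<in> J R" "xs = take (ar R) (f i)" by (auto simp: rel_struct split: if_splits)
  show "length xs = ar R" using i R len_f ar_le by simp
  show "set xs \<subseteq> base struct" using set_f[OF R i(1)] N_le set_take_subset[of "ar R" "f i"] i(2) by fastforce
qed simp

text \<open>Two tuples that agree in positions 0 and 1 would form a cycle of length 2, against
  \<open>k \<ge> 3\<close>.\<close>

lemma inj_take:
  assumes R: "R \<in> \<tau>" "2 \<le> ar R"
  shows "inj_on (\<lambda>i. take (ar R) (f i)) (J R)"
proof (rule inj_onI)
  fix i i' assume i: "i \<in> J R" "i' \<in> J R" and eq: "take (ar R) (f i) = take (ar R) (f i')"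
  have nth: "f i ! p = f i' ! p" if "p < ar R" for p using arg_cong[OF eq, of "\<lambda>xs. xs ! p"] that by simp
  show "i = i'"
  proof (rule ccontr)
    assume ne: "i \<noteq> i'"
    have "pos_cycle f [(i, 0, 1), (i', 1, 0)]"
      using ne nth[of 0] nth[of 1] R by (auto simp: pos_cycle_def less_Suc_eq)
    moreover have "set [(i, 0, 1), (i', 1, 0)] \<subseteq> (\<Union>R\<in>\<tau>. J R) \<times> {..<r} \<times> {..<r}"
      using i R ar_le[of R] by auto
    ultimately have "k \<le> length [(i, 0::nat, 1::nat), (i', 1, 0)]" using cf unfolding cycle_free_def by blast
    thus False using k3 by simp
  qed
qed

lemma max_degree_struct: "max_degree \<tau> struct \<le> M"
proof -
  have "elem_degree \<tau> struct x \<le> M" for x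
  proof -
    have cl: "count_list xs x = card {p\<in>{..<length xs}. xs ! p = x}" for xs :: "nat list"
    proof -
      have "count_list xs x = length (filter ((=) x) xs)" by (simp add: count_list_eq_length_filter)
      also have "\<dots> = card {p. p < length xs \<and> x = xs ! p}" by (simp add: length_filter_conv_card)
      also have "{p. p < length xs \<and> x = xs ! p} = {p\<in>{..<length xs}. xs ! p = x}" by auto
      finally show ?thesis .
    qed
    have "(\<Sum>xs\<in>rel struct R. count_list xs x) \<le> (\<Sum>i\<in>J R. card {p\<in>{..<r}. f i ! p = x})" if R: "R \<in> \<tau>" for R
    proof (cases "2 \<le> ar R")
      case True
      have "(\<Sum>xs\<in>rel struct R. count_list xs x) = (\<Sum>i\<in>J R. count_list (take (ar R) (f i)) x)"
        using R True inj_take[OF R True] by (simp add: rel_struct sum.reindex)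
      also have "\<dots> \<le> (\<Sum>i\<in>J R. card {p\<in>{..<r}. f i ! p = x})"
      proof (rule sum_mono)
        fix i assume i: "i \<in> J R"
        show "count_list (take (ar R) (f i)) x \<le> card {p\<in>{..<r}. f i ! p = x}"
          unfolding cl using len_f[OF R i] by (intro card_mono) auto
      qed
      finally show ?thesis .
    qed (simp add: rel_struct)
    hence "elem_degree \<tau> struct x \<le> (\<Sum>R\<in>\<tau>. \<Sum>i\<in>J R. card {p\<in>{..<r}. f i ! p = x})"
      unfolding elem_degree_def by (intro sum_mono)
    also have "\<dots> = (\<Sum>i\<in>(\<Union>R\<in>\<tau>. J R). card {p\<in>{..<r}. f i ! p = x})"
      using fin_\<tau> fin_J disj_J by (intro sum.UNION_disjoint[symmetric]) auto
    also have "\<dots> = card (SIGMA i:(\<Union>R\<in>\<tau>. J R). {p\<in>{..<r}. f i ! p = x})"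
      using fin_\<tau> fin_J by (subst card_SigmaI) auto
    also have "(SIGMA i:(\<Union>R\<in>\<tau>. J R). {p\<in>{..<r}. f i ! p = x}) = {u\<in>(\<Union>R\<in>\<tau>. J R) \<times> {..<r}. f (fst u) ! snd u = x}"
      by auto
    also have "card \<dots> \<le> M" by (rule deg)
    finally show ?thesis .
  qed
  moreover have "base struct \<noteq> {}" using N_pos N_le by (simp add: lessThan_empty_iff)
  ultimately show ?thesis unfolding max_degree_def by (subst Max_le_iff) auto
qed

text \<open>Choosing a position for each incidence turns a cycle into a \<open>pos_cycle\<close>:
  distinct relational tuples have distinct indices, since an index determines its symbol, and
  distinct elements force entry and exit positions to differ. A repeated coordinate is a
  \<open>pos_cycle\<close> of length 1.\<close>

lemma girth_struct: "girth \<tau> struct \<ge> enat k"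
  unfolding girth_def
proof (rule Inf_greatest, elim imageE)
  fix x c assume x: "x = enat c" and c: "c \<in> cycle_lengths \<tau> struct"
  let ?I = "\<Union>R\<in>\<tau>. J R"
  consider xs rs where "c = length rs" "proper_cycle \<tau> struct xs rs"
    | R xs where "c = 1" "(R, xs) \<in> rel_tuples \<tau> struct" "\<not> distinct xs"
    using c unfolding cycle_lengths_def by auto
  hence "k \<le> c"
  proof cases
    case 2
    then obtain i where R: "R \<in> \<tau>" and i: "i \<in> J R" "xs = take (ar R) (f i)"
      by (auto simp: rel_tuples_def rel_struct split: if_splits)
    obtain p p' where p: "p < length xs" "p' < length xs" "p \<noteq> p'" "xs ! p = xs ! p'"
      using 2(3) by (auto simp: distinct_conv_nth)
    have l: "length xs \<le> r" "length xs = ar R" using i len_f[OF R i(1)] ar_le[OF R] by auto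
    have "pos_cycle f [(i, p, p')]" using p l i by (auto simp: pos_cycle_def)
    moreover have "set [(i, p, p')] \<subseteq> ?I \<times> {..<r} \<times> {..<r}" using i R p l by auto
    ultimately have "k \<le> length [(i, p, p')]" using cf unfolding cycle_free_def by blast
    thus ?thesis using k3 by simp
  next
    case 1
    hence cl: "closed_sequence \<tau> struct xs rs" by (simp add: proper_cycle_def)
    define t where "t = length rs"
    have t: "t \<ge> 2" "length xs = t" "distinct xs" "distinct rs" "set rs \<subseteq> rel_tuples \<tau> struct"
      and inc: "\<And>l. l < t \<Longrightarrow> xs ! l \<in> set (snd (rs ! l)) \<and> xs ! (Suc l mod t) \<in> set (snd (rs ! l))"
      using cl by (auto simp: closed_sequence_def t_def)
    have "\<exists>i a b. fst (rs ! l) \<in> \<tau> \<and> i \<in> J (fst (rs ! l)) \<and> snd (rs ! l) = take (ar (fst (rs ! l))) (f i) \<and>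
        a < r \<and> b < r \<and> f i ! a = xs ! l \<and> f i ! b = xs ! (Suc l mod t)" if l: "l < t" for l
    proof -
      obtain R ys where rl: "rs ! l = (R, ys)" by (metis surj_pair)
      have "(R, ys) \<in> rel_tuples \<tau> struct" using t(5) l rl by (metis nth_mem subsetD t_def)
      then obtain i where R: "R \<in> \<tau>" and i: "i \<in> J R" "ys = take (ar R) (f i)"
        by (auto simp: rel_tuples_def rel_struct split: if_splits)
      obtain a b where ab: "a < length ys" "ys ! a = xs ! l" "b < length ys" "ys ! b = xs ! (Suc l mod t)"
        using inc[OF l] rl by (auto simp: in_set_conv_nth)
      have "length ys \<le> r" "length ys = ar R" using i len_f[OF R i(1)] ar_le[OF R] by auto
      thus ?thesis using rl R i ab by (intro exI[of _ i] exI[of _ a] exI[of _ b]) auto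
    qed
    then obtain i a b where iab: "\<And>l. l < t \<Longrightarrow> fst (rs ! l) \<in> \<tau> \<and> i l \<in> J (fst (rs ! l)) \<and>
        snd (rs ! l) = take (ar (fst (rs ! l))) (f (i l)) \<and>
        a l < r \<and> b l < r \<and> f (i l) ! a l = xs ! l \<and> f (i l) ! b l = xs ! (Suc l mod t)"
      by metis
    define cs where "cs = map (\<lambda>l. (i l, a l, b l)) [0..<t]"
    have nth: "cs ! l = (i l, a l, b l)" if "l < t" for l using that by (simp add: cs_def)
    have lencs: "length cs = t" by (simp add: cs_def)
    have "inj_on i {0..<t}"
    proof (rule inj_onI)
      fix l l' assume l: "l \<in> {0..<t}" "l' \<in> {0..<t}" and eq: "i l = i l'"
      have "fst (rs ! l) = fst (rs ! l')"
        using iab[of l] iab[of l'] l eq disj_J[of "fst (rs ! l)" "fst (rs ! l')"] by auto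
      hence "rs ! l = rs ! l'" using iab[of l] iab[of l'] l eq by (auto simp: prod_eq_iff)
      thus "l = l'" using t(4) l by (simp add: nth_eq_iff_index_eq t_def)
    qed
    hence "distinct (map i [0..<t])" by (simp add: distinct_map)
    hence "distinct (map fst cs)" by (simp add: cs_def comp_def)
    moreover have "a l \<noteq> b l" if l: "l < t" for l
    proof
      assume "a l = b l"
      hence "xs ! l = xs ! (Suc l mod t)" using iab[OF l] by simp
      moreover have "Suc l mod t < t" using l by (intro mod_less_divisor) auto
      ultimately have "l = Suc l mod t" using t l by (simp add: nth_eq_iff_index_eq)
      thus False using t(1) l by (cases "Suc l = t") auto
    qed
    moreover have "f (i l) ! b l = f (i (Suc l mod t)) ! a (Suc l mod t)" if l: "l < t" for l
    proof -
      have "Suc l mod t < t" using l by (intro mod_less_divisor) auto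
      thus ?thesis using iab[OF l] iab[of "Suc l mod t"] by simp
    qed
    moreover have "Suc l mod t < t" for l using t(1) by (intro mod_less_divisor) auto
    ultimately have "pos_cycle f cs"
      unfolding pos_cycle_def lencs using t(1) lencs nth by auto
    moreover have "set cs \<subseteq> ?I \<times> {..<r} \<times> {..<r}" using iab by (fastforce simp: cs_def)
    ultimately have "k \<le> length cs" using cf unfolding cycle_free_def by blast
    thus ?thesis using 1 by (simp add: lencs t_def)
  qed
  thus "enat k \<le> x" by (simp add: x)
qed

text \<open>Passing from densities among the \<open>N\<close> covered points to densities among all
  \<open>n\<close> costs \<delta> per coordinate. The strict bound is possible because
  \<open>J R\<close> is nonempty.\<close>

lemma expander_struct:
  fixes \<epsilon> \<eta> \<delta> :: real
  assumes mix: "\<And>R. R \<in> \<tau> \<Longrightarrow> mixing \<eta> {..<N} r (J R) f"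
    and \<delta>: "real n - real N \<le> \<delta> * n" and \<epsilon>: "\<eta> + r * \<delta> < \<epsilon>"
  shows "expander \<tau> ar \<epsilon> struct"
  unfolding expander_def
proof (intro ballI impI)
  fix R assume R: "R \<in> \<tau>" "2 \<le> ar R"
  have n: "n > 0" using N_pos N_le by simp
  have \<delta>0: "\<delta> \<ge> 0"
  proof (rule ccontr)
    assume "\<not> \<delta> \<ge> 0"
    hence "\<delta> * n < 0" using n by (simp add: mult_neg_pos)
    thus False using \<delta> N_le by simp
  qed
  show "expander_relation \<epsilon> (base struct) (ar R) (rel struct R)"
    unfolding expander_relation_def base_struct
  proof (intro allI impI, elim conjE)
    fix As :: "nat set list"
    assume lenAs: "length As = ar R" and subAs: "\<forall>B\<in>set As. B \<subseteq> {..<n}"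
    have rel: "rel struct R = (\<lambda>i. take (ar R) (f i)) ` J R" using R by (simp add: rel_struct)
    have crel: "card (rel struct R) = card (J R)" unfolding rel by (rule card_image[OF inj_take[OF R]])
    have cpos: "card (J R) > 0" using ne_J[OF R(1)] fin_J[OF R(1)] by (simp add: card_gt_0_iff)
    \<comment> \<open>Isolated points lie in no tuple, and the coordinates cut off by
      \<open>take\<close> are unconstrained.\<close>
    define Bs where "Bs = map (\<lambda>A. A \<inter> {..<N}) As @ replicate (r - ar R) {..<N}"
    have lenB: "length Bs = r" using lenAs ar_le[OF R(1)] by (simp add: Bs_def)
    have nthB: "Bs ! p = (if p < ar R then As ! p \<inter> {..<N} else {..<N})" if "p < r" for p
      using that lenAs by (auto simp: Bs_def nth_append)
    have "tuple_count (rel struct R) As = card {i\<in>J R. list_all2 (\<in>) (take (ar R) (f i)) As}"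
    proof -
      have "{xs\<in>rel struct R. list_all2 (\<in>) xs As} = (\<lambda>i. take (ar R) (f i)) ` {i\<in>J R. list_all2 (\<in>) (take (ar R) (f i)) As}"
        unfolding rel by auto
      moreover have "inj_on (\<lambda>i. take (ar R) (f i)) {i\<in>J R. list_all2 (\<in>) (take (ar R) (f i)) As}"
        by (rule inj_on_subset[OF inj_take[OF R]]) auto
      ultimately show ?thesis unfolding tuple_count_def by (simp add: card_image)
    qed
    also have "{i\<in>J R. list_all2 (\<in>) (take (ar R) (f i)) As} = {i\<in>J R. list_all2 (\<in>) (f i) Bs}"
    proof -
      have "list_all2 (\<in>) (take (ar R) (f i)) As = list_all2 (\<in>) (f i) Bs" if i: "i \<in> J R" for i
      proof -
        have l: "length (f i) = r" by (rule len_f[OF R(1) i])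
        have "f i ! p < N" if "p < r" for p using set_f[OF R(1) i] l that by (metis lessThan_iff nth_mem subsetD)
        thus ?thesis using ar_le[OF R(1)] lenAs
          by (auto simp: list_all2_conv_all_nth l lenB nthB)
      qed
      thus ?thesis by blast
    qed
    finally have tc: "tuple_count (rel struct R) As = card {i\<in>J R. list_all2 (\<in>) (f i) Bs}" .
    define P where "P = (\<Prod>B\<leftarrow>Bs. real (card B) / real N)"
    define Q where "Q = (\<Prod>B\<leftarrow>As. real (card B)) / real n ^ ar R"
    have "\<bar>real (card {i\<in>J R. list_all2 (\<in>) (f i) Bs}) - card (J R) * P\<bar> \<le> \<eta> * card (J R)"
    proof -
      have "\<forall>B\<in>set Bs. B \<subseteq> {..<N}" by (auto simp: Bs_def)
      thus ?thesis using mix[OF R(1)] lenB unfolding mixing_def P_def by auto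
    qed
    moreover have "\<bar>P - Q\<bar> \<le> r * \<delta>"
    proof -
      define x where "x = (\<lambda>p. real (card (As ! p \<inter> {..<N})) / N)"
      define y where "y = (\<lambda>p. real (card (As ! p)) / n)"
      have P: "P = prod x {..<ar R}"
      proof -
        have "P = (\<Prod>A\<leftarrow>As. real (card (A \<inter> {..<N})) / N)"
          using N_pos by (simp add: P_def Bs_def comp_def)
        thus ?thesis by (simp add: prod_list_nth lenAs x_def)
      qed
      have Q: "Q = prod y {..<ar R}"
        by (simp add: Q_def prod_list_nth lenAs y_def prod_dividef)
      have xy: "\<bar>x p\<bar> \<le> 1 \<and> \<bar>y p\<bar> \<le> 1 \<and> \<bar>x p - y p\<bar> \<le> \<delta>" if p: "p < ar R" for p
      proof -
        have A: "As ! p \<subseteq> {..<n}" using subAs p lenAs by (metis nth_mem)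
        define u where "u = real (card (As ! p \<inter> {..<N}))"
        define w where "w = real (card (As ! p))"
        have finA: "finite (As ! p)" using A finite_subset by blast
        have uN: "u \<le> N" using card_mono[of "{..<N}" "As ! p \<inter> {..<N}"] by (simp add: u_def)
        have uw: "u \<le> w" unfolding u_def w_def using finA by (simp add: card_mono)
        have wn: "w \<le> n" using card_mono[OF _ A] by (simp add: w_def)
        have "As ! p \<subseteq> (As ! p \<inter> {..<N}) \<union> {N..<n}" using A by auto
        hence "card (As ! p) \<le> card ((As ! p \<inter> {..<N}) \<union> {N..<n})" using finA by (intro card_mono) auto
        also have "\<dots> \<le> card (As ! p \<inter> {..<N}) + card {N..<n}" by (rule card_Un_le)
        finally have wu: "w \<le> u + (real n - real N)" using N_le by (simp add: u_def w_def of_nat_diff)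
        have xp: "x p = u / N" and yp: "y p = w / n" by (simp_all add: x_def y_def u_def w_def)
        have "u / N - w / n \<le> u / N - u / n" using uw n by (simp add: divide_right_mono)
        also have "\<dots> = u / N * ((real n - real N) / n)" using N_pos n by (simp add: field_simps)
        also have "\<dots> \<le> 1 * \<delta>" using uN N_pos n \<delta> N_le \<delta>0
          by (intro mult_mono) (auto simp: divide_le_eq u_def)
        finally have a: "u / N - w / n \<le> \<delta>" by simp
        have "w / n - u / N \<le> (u + (real n - real N)) / n - u / n"
          using wu N_le n N_pos by (intro diff_mono divide_right_mono divide_left_mono) (auto simp: u_def)
        also have "\<dots> = (real n - real N) / n" by (simp add: diff_divide_distrib add_divide_distrib)
        also have "\<dots> \<le> \<delta>" using \<delta> n by (simp add: divide_le_eq)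
        finally have b: "w / n - u / N \<le> \<delta>" .
        show ?thesis unfolding xp yp using a b uN wn N_pos n by (auto simp: u_def w_def abs_le_iff)
      qed
      \<comment> \<open>Telescoping for products of factors of modulus at most 1.\<close>
      have "\<bar>P - Q\<bar> \<le> (\<Sum>p<ar R. \<bar>x p - y p\<bar>)"
        unfolding P Q using norm_prod_diff[of "{..<ar R}" x y] xy by simp
      also have "\<dots> \<le> (\<Sum>p<ar R. \<delta>)" using xy by (intro sum_mono) auto
      also have "\<dots> \<le> r * \<delta>" using ar_le[OF R(1)] \<delta>0 by (simp add: mult_right_mono)
      finally show ?thesis .
    qed
    hence "card (J R) * \<bar>P - Q\<bar> \<le> card (J R) * (r * \<delta>)" by (intro mult_left_mono) auto
    hence "\<bar>card (J R) * P - card (J R) * Q\<bar> \<le> card (J R) * (r * \<delta>)"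
      by (simp add: abs_mult flip: right_diff_distrib)
    ultimately have "\<bar>real (card {i\<in>J R. list_all2 (\<in>) (f i) Bs}) - card (J R) * Q\<bar> \<le> (\<eta> + r * \<delta>) * card (J R)"
      by (simp add: algebra_simps abs_le_iff)
    also have "\<dots> < \<epsilon> * card (J R)" using \<epsilon> cpos by (intro mult_strict_right_mono) auto
    finally show "\<bar>real (tuple_count (rel struct R) As) - real (card (rel struct R)) * (\<Prod>B\<leftarrow>As. real (card B)) / real (card {..<n}) ^ ar R\<bar>
        < \<epsilon> * real (card (rel struct R))"
      by (simp add: tc crel Q_def)
  qed
qed

end

subsection \<open>Polynomial-time closure properties\<close>

lemma poly_nat_mono: "x \<le> y \<Longrightarrow> poly p x \<le> poly p y" for p :: "nat poly"
  by (induction p) (auto intro: add_mono mult_mono)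

text \<open>The program \<open>c\<close> may change the variables below \<open>k\<close>, whose initial values do not matter.\<close>

definition runs :: "com \<Rightarrow> nat \<Rightarrow> nat poly \<Rightarrow> (tree \<Rightarrow> tree) \<Rightarrow> bool" where
  "runs c k p f \<longleftrightarrow> k > 0 \<and>
     (\<forall>s. \<exists>t s'. exec c s t s' \<and> s' 0 = f (s 0) \<and> (\<forall>x\<ge>k. s' x = s x) \<and>
        t \<le> poly p (size (s 0)) \<and> size (f (s 0)) \<le> poly p (size (s 0)))"

definition ptime :: "(tree \<Rightarrow> tree) \<Rightarrow> bool" where
  "ptime f \<longleftrightarrow> (\<exists>c k p. runs c k p f)"

lemma ptimeI:
  fixes p :: "nat poly"
  assumes "k > 0"
    and "\<And>s. \<exists>t s'. exec c s t s' \<and> s' 0 = f (s 0) \<and> (\<forall>x\<ge>k. s' x = s x) \<and>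
        t \<le> poly p (size (s 0)) \<and> size (f (s 0)) \<le> poly p (size (s 0))"
  shows "ptime f"
  using assms unfolding ptime_def runs_def by blast

lemma runs_exec:
  assumes "runs c k p f"
  obtains t s' where "exec c s t s'" "s' 0 = f (s 0)" "\<forall>x\<ge>k. s' x = s x" "t \<le> poly p (size (s 0))"
  using assms unfolding runs_def by blast

lemma runs_size: "runs c k p f \<Longrightarrow> size (f v) \<le> poly p (size v)"
  unfolding runs_def by (elim conjE, drule spec[of _ "\<lambda>_. v"]) auto

lemma runs_pos: "runs c k p f \<Longrightarrow> k > 0"
  by (simp add: runs_def)

lemma size_hd_tree: "size (hd_tree v) \<le> size v" and size_tl_tree: "size (tl_tree v) \<le> size v"
  by (cases v; simp)+

lemma size_le_hd_tl: "size v \<le> Suc (size (hd_tree v) + size (tl_tree v))"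
  by (cases v) auto

lemma ptime_id: "ptime (\<lambda>v. v)"
  by (rule ptimeI[where c = "Assign 0 (VarE 0)" and k = 1 and p = "[:2, 1:]"])
     (auto intro!: exI exec.Assign)

lemma ptime_Leaf: "ptime (\<lambda>_. Leaf)"
proof (rule ptimeI[where c = "Assign 0 NilE" and k = 1 and p = "[:2:]"])
  fix s :: state
  show "\<exists>t s'. exec (Assign 0 NilE) s t s' \<and> s' 0 = Leaf \<and> (\<forall>x\<ge>1. s' x = s x) \<and>
      t \<le> poly [:2:] (size (s 0)) \<and> size Leaf \<le> poly [:2:] (size (s 0))"
    by (intro exI conjI, rule exec.Assign) auto
qed simp

lemma ptime_hd: "ptime hd_tree"
proof (rule ptimeI[where c = "Assign 0 (HdE (VarE 0))" and k = 1 and p = "[:3, 2:]"])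
  fix s :: state
  show "\<exists>t s'. exec (Assign 0 (HdE (VarE 0))) s t s' \<and> s' 0 = hd_tree (s 0) \<and> (\<forall>x\<ge>1. s' x = s x) \<and>
      t \<le> poly [:3, 2:] (size (s 0)) \<and> size (hd_tree (s 0)) \<le> poly [:3, 2:] (size (s 0))"
    by (intro exI conjI, rule exec.Assign) (use size_hd_tree[of "s 0"] in auto)
qed simp

lemma ptime_tl: "ptime tl_tree"
proof (rule ptimeI[where c = "Assign 0 (TlE (VarE 0))" and k = 1 and p = "[:3, 2:]"])
  fix s :: state
  show "\<exists>t s'. exec (Assign 0 (TlE (VarE 0))) s t s' \<and> s' 0 = tl_tree (s 0) \<and> (\<forall>x\<ge>1. s' x = s x) \<and>
      t \<le> poly [:3, 2:] (size (s 0)) \<and> size (tl_tree (s 0)) \<le> poly [:3, 2:] (size (s 0))"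
    by (intro exI conjI, rule exec.Assign) (use size_tl_tree[of "s 0"] in auto)
qed simp

lemma ptime_comp:
  assumes f: "ptime f" and g: "ptime g"
  shows "ptime (\<lambda>v. f (g v))"
proof -
  obtain cf kf pf where F: "runs cf kf pf f" using f unfolding ptime_def by blast
  obtain cg kg pg where G: "runs cg kg pg g" using g unfolding ptime_def by blast
  show ?thesis
  proof (rule ptimeI[where c = "Seq cg cf" and k = "max kf kg" and p = "pg + pcompose pf pg"])
    fix s :: state
    obtain t1 s1 where 1: "exec cg s t1 s1" "s1 0 = g (s 0)" "\<forall>x\<ge>kg. s1 x = s x" "t1 \<le> poly pg (size (s 0))"
      using runs_exec[OF G] by metis
    obtain t2 s2 where 2: "exec cf s1 t2 s2" "s2 0 = f (s1 0)" "\<forall>x\<ge>kf. s2 x = s1 x" "t2 \<le> poly pf (size (s1 0))"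
      using runs_exec[OF F] by metis
    have m: "poly pf (size (g (s 0))) \<le> poly pf (poly pg (size (s 0)))" by (rule poly_nat_mono[OF runs_size[OF G]])
    have "exec (Seq cg cf) s (t1 + t2) s2" by (rule exec.Seq[OF 1(1) 2(1)])
    moreover have "t1 + t2 \<le> poly (pg + pcompose pf pg) (size (s 0))"
      using 1 2 m by (simp add: poly_pcompose)
    moreover have "size (f (g (s 0))) \<le> poly (pg + pcompose pf pg) (size (s 0))"
      using runs_size[OF F, of "g (s 0)"] m by (simp add: poly_pcompose)
    ultimately show "\<exists>t s'. exec (Seq cg cf) s t s' \<and> s' 0 = f (g (s 0)) \<and> (\<forall>x\<ge>max kf kg. s' x = s x) \<and>
        t \<le> poly (pg + pcompose pf pg) (size (s 0)) \<and> size (f (g (s 0))) \<le> poly (pg + pcompose pf pg) (size (s 0))"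
      using 1 2 by (intro exI[of _ "t1 + t2"] exI[of _ s2]) auto
  qed (use runs_pos[OF F] in simp)
qed

lemma ptime_Node:
  assumes f: "ptime f" and g: "ptime g"
  shows "ptime (\<lambda>v. Node (f v) (g v))"
proof -
  obtain cf kf pf where F: "runs cf kf pf f" using f unfolding ptime_def by blast
  obtain cg kg pg where G: "runs cg kg pg g" using g unfolding ptime_def by blast
  \<comment> \<open>Both subprograms leave the registers from \<open>k\<close> on alone:
    \<open>k\<close> keeps the input and \<open>Suc k\<close> the first result.\<close>
  define k where "k = max kf kg"
  have k: "k \<ge> kf" "k \<ge> kg" "k > 0" using runs_pos[OF F] by (auto simp: k_def)
  define c where "c = Seq (Assign k (VarE 0)) (Seq cf (Seq (Assign (Suc k) (VarE 0))
     (Seq (Assign 0 (VarE k)) (Seq cg (Assign 0 (ConsE (VarE (Suc k)) (VarE 0)))))))"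
  define p where "p = [:20, 2:] + smult 4 pf + smult 4 pg"
  show ?thesis
  proof (rule ptimeI[where c = c and k = "Suc (Suc k)" and p = p])
    fix s :: state
    let ?v = "s 0"
    define s1 where "s1 = s(k := ?v)"
    have e1: "exec (Assign k (VarE 0)) s (Suc (Suc (size ?v))) s1"
      using exec.Assign[of k "VarE 0" s] by (simp add: s1_def)
    have s10: "s1 0 = ?v" using k by (simp add: s1_def)
    obtain t2 s2 where 2: "exec cf s1 t2 s2" "s2 0 = f ?v" "\<forall>x\<ge>kf. s2 x = s1 x" "t2 \<le> poly pf (size ?v)"
      using runs_exec[OF F, of s1] s10 by metis
    define s3 where "s3 = s2(Suc k := f ?v)"
    have e3: "exec (Assign (Suc k) (VarE 0)) s2 (Suc (Suc (size (f ?v)))) s3"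
      using exec.Assign[of "Suc k" "VarE 0" s2] 2 by (simp add: s3_def)
    define s4 where "s4 = s3(0 := ?v)"
    have s3k: "s3 k = ?v" using 2(3) k by (simp add: s3_def s1_def)
    have e4: "exec (Assign 0 (VarE k)) s3 (Suc (Suc (size ?v))) s4"
      using exec.Assign[of 0 "VarE k" s3] s3k by (simp add: s4_def)
    have s40: "s4 0 = ?v" by (simp add: s4_def)
    obtain t5 s5 where 5: "exec cg s4 t5 s5" "s5 0 = g ?v" "\<forall>x\<ge>kg. s5 x = s4 x" "t5 \<le> poly pg (size ?v)"
      using runs_exec[OF G, of s4] s40 by metis
    have s5k: "s5 (Suc k) = f ?v" using 5(3) k by (simp add: s4_def s3_def)
    define s6 where "s6 = s5(0 := Node (f ?v) (g ?v))"
    have e6: "exec (Assign 0 (ConsE (VarE (Suc k)) (VarE 0))) s5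
       (Suc (Suc (size (f ?v)) + Suc (size (g ?v)) + Suc (size (Node (f ?v) (g ?v))))) s6"
      using exec.Assign[of 0 "ConsE (VarE (Suc k)) (VarE 0)" s5] s5k 5(2) by (simp add: s6_def)
    have ex: "exec c s (Suc (Suc (size ?v)) + (t2 + (Suc (Suc (size (f ?v))) + (Suc (Suc (size ?v)) + (t5 +
       (Suc (Suc (size (f ?v)) + Suc (size (g ?v)) + Suc (size (Node (f ?v) (g ?v)))))))))) s6"
      unfolding c_def by (intro exec.Seq[OF e1] exec.Seq[OF 2(1)] exec.Seq[OF e3] exec.Seq[OF e4] exec.Seq[OF 5(1)] e6)
    have pres: "\<forall>x\<ge>Suc (Suc k). s6 x = s x"
      using 2(3) 5(3) k by (auto simp: s6_def s4_def s3_def s1_def)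
    show "\<exists>t s'. exec c s t s' \<and> s' 0 = Node (f ?v) (g ?v) \<and> (\<forall>x\<ge>Suc (Suc k). s' x = s x) \<and>
        t \<le> poly p (size ?v) \<and> size (Node (f ?v) (g ?v)) \<le> poly p (size ?v)"
      by (intro exI conjI, rule ex)
         (use 2(4) 5(4) runs_size[OF F, of ?v] runs_size[OF G, of ?v] pres in \<open>auto simp: s6_def p_def\<close>)
  qed simp
qed

lemma ptime_if:
  assumes b: "ptime b" and f: "ptime f" and g: "ptime g"
  shows "ptime (\<lambda>v. if b v = Leaf then f v else g v)"
proof -
  obtain cb kb pb where B: "runs cb kb pb b" using b unfolding ptime_def by blast
  obtain cf kf pf where F: "runs cf kf pf f" using f unfolding ptime_def by blast
  obtain cg kg pg where G: "runs cg kg pg g" using g unfolding ptime_def by blast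
  define k where "k = max kb (max kf kg)"
  have k: "k \<ge> kf" "k \<ge> kg" "k \<ge> kb" "k > 0" using runs_pos[OF F] by (auto simp: k_def)
  define d where "d = Cond (VarE 0) (Seq (Assign 0 (VarE k)) cg) (Seq (Assign 0 (VarE k)) cf)"
  define c where "c = Seq (Assign k (VarE 0)) (Seq cb d)"
  define p where "p = [:20, 2:] + smult 2 pb + pf + pg"
  show ?thesis
  proof (rule ptimeI[where c = c and k = "Suc k" and p = p])
    fix s :: state
    let ?v = "s 0"
    define s1 where "s1 = s(k := ?v)"
    have e1: "exec (Assign k (VarE 0)) s (Suc (Suc (size ?v))) s1"
      using exec.Assign[of k "VarE 0" s] by (simp add: s1_def)
    have s10: "s1 0 = ?v" using k by (simp add: s1_def)
    obtain t2 s2 where 2: "exec cb s1 t2 s2" "s2 0 = b ?v" "\<forall>x\<ge>kb. s2 x = s1 x" "t2 \<le> poly pb (size ?v)"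
      using runs_exec[OF B, of s1] s10 by metis
    have s2k: "s2 k = ?v" using 2(3) k by (simp add: s1_def)
    define s3 where "s3 = s2(0 := ?v)"
    have e3: "exec (Assign 0 (VarE k)) s2 (Suc (Suc (size ?v))) s3"
      using exec.Assign[of 0 "VarE k" s2] s2k by (simp add: s3_def)
    have s30: "s3 0 = ?v" by (simp add: s3_def)
    obtain t4 s4 where 4: "exec cf s3 t4 s4" "s4 0 = f ?v" "\<forall>x\<ge>kf. s4 x = s3 x" "t4 \<le> poly pf (size ?v)"
      using runs_exec[OF F, of s3] s30 by metis
    obtain t5 s5 where 5: "exec cg s3 t5 s5" "s5 0 = g ?v" "\<forall>x\<ge>kg. s5 x = s3 x" "t5 \<le> poly pg (size ?v)"
      using runs_exec[OF G, of s3] s30 by metis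
    have ev: "eval_time (VarE 0) s2 = Suc (size (b ?v))" using 2 by simp
    have pres: "\<forall>x\<ge>Suc k. s4 x = s x" "\<forall>x\<ge>Suc k. s5 x = s x"
      using 2(3) 4(3) 5(3) k by (auto simp: s3_def s1_def)
    show "\<exists>t s'. exec c s t s' \<and> s' 0 = (if b ?v = Leaf then f ?v else g ?v) \<and> (\<forall>x\<ge>Suc k. s' x = s x) \<and>
        t \<le> poly p (size ?v) \<and> size (if b ?v = Leaf then f ?v else g ?v) \<le> poly p (size ?v)"
    proof (cases "b ?v = Leaf")
      case True
      have "exec d s2 (Suc (eval_time (VarE 0) s2) + (Suc (Suc (size ?v)) + t4)) s4"
        unfolding d_def using True 2(2) by (intro exec.CondFalse exec.Seq[OF e3 4(1)]) simp
      from exec.Seq[OF e1 exec.Seq[OF 2(1) this]]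
      have ex: "exec c s (Suc (Suc (size ?v)) + (t2 + (Suc (Suc (size (b ?v))) + (Suc (Suc (size ?v)) + t4)))) s4"
        unfolding ev c_def .
      show ?thesis
        by (intro exI conjI, rule ex)
           (use True 2(4) 4(2,4) runs_size[OF B, of ?v] runs_size[OF F, of ?v] pres in \<open>auto simp: p_def\<close>)
    next
      case False
      have "exec d s2 (Suc (eval_time (VarE 0) s2) + (Suc (Suc (size ?v)) + t5)) s5"
        unfolding d_def using False 2(2) by (intro exec.CondTrue exec.Seq[OF e3 5(1)]) simp
      from exec.Seq[OF e1 exec.Seq[OF 2(1) this]]
      have ex: "exec c s (Suc (Suc (size ?v)) + (t2 + (Suc (Suc (size (b ?v))) + (Suc (Suc (size ?v)) + t5)))) s5"
        unfolding ev c_def .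
      show ?thesis
        by (intro exI conjI, rule ex)
           (use False 2(4) 5(2,4) runs_size[OF B, of ?v] runs_size[OF G, of ?v] pres in \<open>auto simp: p_def\<close>)
    qed
  qed simp
qed

text \<open>The source of all loops: a left fold along the spine of a list, whose step receives
  accumulator and element as a pair. Iterating a polynomial-time step may double the accumulator in
  every round, hence the size invariant in \<open>ptime_tfold\<close>.\<close>

fun tfold :: "(tree \<Rightarrow> tree) \<Rightarrow> tree \<Rightarrow> tree \<Rightarrow> tree" where
  "tfold h a Leaf = a"
| "tfold h a (Node x l) = tfold h (h (Node a x)) l"

text \<open>The invariant \<open>Inv S j a\<close> bounds the accumulator \<open>a\<close> after \<open>j\<close> rounds on an input of
  size \<open>S\<close>.\<close>

lemma ptime_tfold:
  fixes pb :: "nat poly"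
  assumes h: "ptime h"
    and init: "\<And>S a. size a \<le> S \<Longrightarrow> Inv S 0 a"
    and step: "\<And>S j a x. Inv S j a \<Longrightarrow> j < S \<Longrightarrow> size x \<le> S \<Longrightarrow> Inv S (Suc j) (h (Node a x))"
    and bnd: "\<And>S j a. Inv S j a \<Longrightarrow> j \<le> S \<Longrightarrow> size a \<le> poly pb S"
  shows "ptime (\<lambda>v. tfold h (hd_tree v) (tl_tree v))"
proof -
  obtain ch k ph where Hr: "runs ch k ph h" using h unfolding ptime_def by blast
  note H = runs_pos[OF Hr]
  define body where "body = Seq (Assign 0 (ConsE (VarE 0) (HdE (VarE k)))) (Seq ch (Assign k (TlE (VarE k))))"
  define W where "W = While (VarE k) body"
  define c where "c = Seq (Assign k (TlE (VarE 0))) (Seq (Assign 0 (HdE (VarE 0))) W)"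
  \<comment> \<open>A bound for one round of the loop when the accumulator has size at most
    \<open>poly pb S\<close>.\<close>
  define pr where "pr = [:40, 10:] + smult 4 pb + pcompose ph (pb + [:2, 1:])"
  have loop: "\<exists>t s'. exec W s t s' \<and> s' 0 = tfold h a l \<and> (\<forall>x>k. s' x = s x) \<and>
      t \<le> Suc (size l) * poly pr S \<and> size (tfold h a l) \<le> poly pb S"
    if "s 0 = a" "s k = l" "Inv S j a" "j + size l \<le> S" for s a l S j
    using that
  proof (induction l arbitrary: s a j rule: tree.induct)
    case Leaf
    have "exec W s (Suc (eval_time (VarE k) s)) s" unfolding W_def using Leaf by (intro exec.WhileFalse) simp
    thus ?case using Leaf bnd[OF Leaf(3)] by (intro exI[of _ "Suc (eval_time (VarE k) s)"] exI[of _ s]) (auto simp: pr_def)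
  next
    case (Node x l)
    have aS: "size a \<le> poly pb S" using bnd[OF Node.prems(3)] Node.prems(4) by simp
    have xS: "size x \<le> S" "size l \<le> S" "j < S" using Node.prems(4) by auto
    define s1 where "s1 = s(0 := Node a x)"
    have e1: "exec (Assign 0 (ConsE (VarE 0) (HdE (VarE k)))) s
       (Suc (Suc (size a) + (Suc (size (Node x l)) + Suc (size x)) + Suc (size (Node a x)))) s1"
      using exec.Assign[of 0 "ConsE (VarE 0) (HdE (VarE k))" s] Node.prems by (simp add: s1_def)
    obtain t2 s2 where 2: "exec ch s1 t2 s2" "s2 0 = h (Node a x)" "\<forall>y\<ge>k. s2 y = s1 y"
      "t2 \<le> poly ph (size (Node a x))" using runs_exec[OF Hr, of s1] by (metis s1_def fun_upd_same)
    have s2k: "s2 k = Node x l" using 2(3) H Node.prems by (simp add: s1_def)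
    define s3 where "s3 = s2(k := l)"
    have e3: "exec (Assign k (TlE (VarE k))) s2 (Suc (Suc (size (Node x l)) + Suc (size l))) s3"
      using exec.Assign[of k "TlE (VarE k)" s2] s2k by (simp add: s3_def)
    define tb where "tb = (Suc (Suc (size a) + (Suc (size (Node x l)) + Suc (size x)) + Suc (size (Node a x)))) +
      (t2 + (Suc (Suc (size (Node x l)) + Suc (size l))))"
    have eb: "exec body s tb s3" unfolding body_def tb_def by (intro exec.Seq[OF e1] exec.Seq[OF 2(1)] e3)
    have inv: "Inv S (Suc j) (h (Node a x))" by (rule step[OF Node.prems(3) xS(3) xS(1)])
    have "s3 0 = h (Node a x)" "s3 k = l" using 2(2) H by (auto simp: s3_def)
    then obtain t4 s4 where 4: "exec W s3 t4 s4" "s4 0 = tfold h (h (Node a x)) l" "\<forall>y>k. s4 y = s3 y"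
      "t4 \<le> Suc (size l) * poly pr S" "size (tfold h (h (Node a x)) l) \<le> poly pb S"
      using Node.IH(2)[of s3 "h (Node a x)" "Suc j"] inv Node.prems(4) by auto
    have ew: "exec W s (Suc (eval_time (VarE k) s) + tb + t4) s4"
      using 4(1) eb Node.prems(2) unfolding W_def by (intro exec.WhileTrue) auto
    have "poly ph (size (Node a x)) \<le> poly ph (poly pb S + S + 2)"
      using aS xS by (intro poly_nat_mono) simp
    hence "Suc (eval_time (VarE k) s) + tb \<le> poly pr S"
      using 2(4) aS xS Node.prems(2,4) by (simp add: tb_def pr_def poly_pcompose algebra_simps)
    hence "Suc (eval_time (VarE k) s) + tb + t4 \<le> Suc (size (Node x l)) * poly pr S"
    proof -
      assume a: "Suc (eval_time (VarE k) s) + tb \<le> poly pr S"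
      have "Suc (eval_time (VarE k) s) + tb + t4 \<le> poly pr S + Suc (size l) * poly pr S"
        using a 4(4) by (rule add_mono)
      also have "\<dots> = Suc (Suc (size l)) * poly pr S" by simp
      also have "\<dots> \<le> Suc (size (Node x l)) * poly pr S" by (intro mult_le_mono1) simp
      finally show ?thesis .
    qed
    moreover have "\<forall>y>k. s4 y = s y" using 4(3) 2(3) H by (auto simp: s3_def s1_def)
    ultimately show ?case using ew 4 by (intro exI[of _ "Suc (eval_time (VarE k) s) + tb + t4"] exI[of _ s4]) auto
  qed
  define p where "p = [:10, 4:] + [:1, 1:] * pr + pb"
  show ?thesis
  proof (rule ptimeI[where c = c and k = "Suc k" and p = p])
    fix s :: state
    let ?v = "s 0"
    let ?S = "size ?v"
    define s1 where "s1 = s(k := tl_tree ?v)"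
    have e1: "exec (Assign k (TlE (VarE 0))) s (Suc (Suc ?S + Suc (size (tl_tree ?v)))) s1"
      using exec.Assign[of k "TlE (VarE 0)" s] by (simp add: s1_def)
    have s10: "s1 0 = ?v" using H by (simp add: s1_def)
    define s2 where "s2 = s1(0 := hd_tree ?v)"
    have e2: "exec (Assign 0 (HdE (VarE 0))) s1 (Suc (Suc ?S + Suc (size (hd_tree ?v)))) s2"
      using exec.Assign[of 0 "HdE (VarE 0)" s1] s10 by (simp add: s2_def)
    have "s2 0 = hd_tree ?v" "s2 k = tl_tree ?v" using H by (auto simp: s2_def s1_def)
    then obtain t3 s3 where 3: "exec W s2 t3 s3" "s3 0 = tfold h (hd_tree ?v) (tl_tree ?v)"
      "\<forall>y>k. s3 y = s2 y" "t3 \<le> Suc (size (tl_tree ?v)) * poly pr ?S"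
      "size (tfold h (hd_tree ?v) (tl_tree ?v)) \<le> poly pb ?S"
      using loop[of s2 "hd_tree ?v" "tl_tree ?v" ?S 0] init size_hd_tree size_tl_tree by auto
    have "Suc (size (tl_tree ?v)) * poly pr ?S \<le> Suc ?S * poly pr ?S"
      using size_tl_tree[of ?v] by (intro mult_le_mono1) simp
    hence t3: "t3 \<le> Suc ?S * poly pr ?S" using 3(4) by linarith
    have ex: "exec c s ((Suc (Suc ?S + Suc (size (tl_tree ?v)))) + ((Suc (Suc ?S + Suc (size (hd_tree ?v)))) + t3)) s3"
      unfolding c_def by (intro exec.Seq[OF e1] exec.Seq[OF e2] 3(1))
    have pres: "\<forall>x\<ge>Suc k. s3 x = s x" using 3(3) H by (auto simp: s2_def s1_def)
    show "\<exists>t s'. exec c s t s' \<and> s' 0 = tfold h (hd_tree ?v) (tl_tree ?v) \<and> (\<forall>x\<ge>Suc k. s' x = s x) \<and>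
        t \<le> poly p (size ?v) \<and> size (tfold h (hd_tree ?v) (tl_tree ?v)) \<le> poly p (size ?v)"
      by (intro exI conjI, rule ex)
         (use t3 pres 3(2,5) size_hd_tree[of ?v] size_tl_tree[of ?v] in \<open>auto simp: p_def algebra_simps\<close>)
  qed simp
qed

subsection \<open>The algorithm\<close>

lemma ptime_hd': "ptime f \<Longrightarrow> ptime (\<lambda>v. hd_tree (f v))"
  and ptime_tl': "ptime f \<Longrightarrow> ptime (\<lambda>v. tl_tree (f v))"
  by (rule ptime_comp[OF ptime_hd], assumption) (rule ptime_comp[OF ptime_tl], assumption)

lemma ptime_const: "ptime (\<lambda>_. a)"
  by (induction a) (auto intro: ptime_Leaf ptime_Node)

lemmas ptime_basic = ptime_id ptime_const ptime_hd' ptime_tl' ptime_Node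

text \<open>Reversing append. On unary numbers, whose list entries are all equal, it is
  addition.\<close>

definition rapp :: "tree \<Rightarrow> tree" where
  "rapp v = tfold (\<lambda>u. Node (tl_tree u) (hd_tree u)) (hd_tree v) (tl_tree v)"

lemma ptime_rapp: "ptime f \<Longrightarrow> ptime (\<lambda>v. rapp (f v))"
proof -
  have "ptime rapp" unfolding rapp_def
  proof (rule ptime_tfold[where Inv = "\<lambda>S j a. size a \<le> S + j * (S + 1)" and pb = "[:0, 2, 1:]"])
    fix S j :: nat and a :: tree assume "size a \<le> S + j * (S + 1)" "j \<le> S"
    moreover from this have "j * (S + 1) \<le> S * (S + 1)" by (intro mult_le_mono1)
    ultimately show "size a \<le> poly [:0, 2, 1:] S" by (simp add: algebra_simps)
  qed (auto intro!: ptime_basic)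
  thus "ptime f \<Longrightarrow> ptime (\<lambda>v. rapp (f v))" by (rule ptime_comp)
qed

lemma size_rapp: "size (rapp v) \<le> size v"
proof -
  have "size (tfold (\<lambda>u. Node (tl_tree u) (hd_tree u)) a l) \<le> size a + size l" for a l
  proof (induction l arbitrary: a rule: tree.induct)
    case (Node x l)
    from Node(2)[of "Node x a"] show ?case by simp
  qed simp
  from order_trans[OF this] show ?thesis unfolding rapp_def by (cases v) auto
qed

lemma rapp_list: "rapp (Node (tree_of_list xs) (tree_of_list ys)) = tree_of_list (rev ys @ xs)"
proof -
  have "tfold (\<lambda>u. Node (tl_tree u) (hd_tree u)) (tree_of_list xs) (tree_of_list ys) = tree_of_list (rev ys @ xs)"
  proof (induction ys arbitrary: xs)
    case (Cons y ys)
    from Cons.IH[of "y # xs"] show ?case by simp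
  qed simp
  thus ?thesis by (simp add: rapp_def)
qed

definition monus :: "tree \<Rightarrow> tree" where
  "monus v = tfold (\<lambda>u. tl_tree (hd_tree u)) (hd_tree v) (tl_tree v)"

lemma ptime_monus: "ptime f \<Longrightarrow> ptime (\<lambda>v. monus (f v))"
proof -
  have "ptime monus" unfolding monus_def
    by (rule ptime_tfold[where Inv = "\<lambda>S j a. size a \<le> S" and pb = "[:0, 1:]"])
       (auto intro!: ptime_basic intro: order_trans[OF size_tl_tree])
  thus "ptime f \<Longrightarrow> ptime (\<lambda>v. monus (f v))" by (rule ptime_comp)
qed

text \<open>A concatenating map with an environment: \<open>tl_tree v\<close> is handed to
  \<open>h\<close> with every element of the list \<open>hd_tree v\<close>. The accumulator pairs
  the environment with the output, which comes out reversed because \<open>rapp\<close> pushes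
  it.\<close>

definition cmap :: "(tree \<Rightarrow> tree) \<Rightarrow> tree \<Rightarrow> tree" where
  "cmap h v = tl_tree (tfold (\<lambda>u. Node (hd_tree (hd_tree u))
     (rapp (Node (tl_tree (hd_tree u)) (h (Node (tl_tree u) (hd_tree (hd_tree u)))))))
     (Node (tl_tree v) Leaf) (hd_tree v))"

lemma ptime_cmap:
  assumes h: "ptime h" and f: "ptime f"
  shows "ptime (\<lambda>v. cmap h (f v))"
proof -
  define g where "g = (\<lambda>u. Node (hd_tree (hd_tree u))
     (rapp (Node (tl_tree (hd_tree u)) (h (Node (tl_tree u) (hd_tree (hd_tree u)))))))"
  obtain ph :: "nat poly" where ph: "\<And>v. size (h v) \<le> poly ph (size v)"
    using h runs_size unfolding ptime_def by blast
  have pg: "ptime g" unfolding g_def by (intro ptime_basic ptime_rapp ptime_comp[OF h])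
  define Inv where "Inv = (\<lambda>S j (a :: tree). size (hd_tree a) \<le> S \<and> size (tl_tree a) \<le> S + j * (poly ph (2 * S + 1) + 1))"
  have "ptime (\<lambda>v. tfold g (hd_tree v) (tl_tree v))"
  proof (rule ptime_tfold[OF pg, where Inv = Inv and pb = "[:1, 2:] + [:0, 1:] * (pcompose ph [:1, 2:] + 1)"])
    fix S :: nat and a :: tree assume "size a \<le> S"
    thus "Inv S 0 a" using size_hd_tree[of a] size_tl_tree[of a] by (simp add: Inv_def)
  next
    fix S j :: nat and a x :: tree assume I: "Inv S j a" and x: "size x \<le> S"
    have "size (h (Node x (hd_tree a))) \<le> poly ph (size (Node x (hd_tree a)))" by (rule ph)
    also have "\<dots> \<le> poly ph (2 * S + 1)" using I x by (intro poly_nat_mono) (simp add: Inv_def)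
    finally have "size (Node (tl_tree a) (h (Node x (hd_tree a)))) \<le> S + Suc j * (poly ph (2 * S + 1) + 1)"
      using I by (simp add: Inv_def)
    hence "size (rapp (Node (tl_tree a) (h (Node x (hd_tree a))))) \<le> S + Suc j * (poly ph (2 * S + 1) + 1)"
      using size_rapp order_trans by blast
    thus "Inv S (Suc j) (g (Node a x))" using I by (simp add: Inv_def g_def)
  next
    fix S j :: nat and a :: tree assume I: "Inv S j a" and j: "j \<le> S"
    have "size a \<le> 1 + S + (S + j * (poly ph (2 * S + 1) + 1))"
      using size_le_hd_tl[of a] I by (simp add: Inv_def)
    also have "\<dots> \<le> 1 + S + (S + S * (poly ph (2 * S + 1) + 1))"
      using j by (intro add_left_mono mult_le_mono1)
    finally show "size a \<le> poly ([:1, 2:] + [:0, 1:] * (pcompose ph [:1, 2:] + 1)) S"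
      by (simp add: poly_pcompose algebra_simps mult_2_right)
  qed
  from ptime_tl'[OF ptime_comp[OF this, of "\<lambda>v. Node (Node (tl_tree (f v)) Leaf) (hd_tree (f v))"]]
  show ?thesis unfolding cmap_def g_def[symmetric] by (simp add: ptime_basic f)
qed

lemma cmap_list:
  assumes "\<And>x. x \<in> set xs \<Longrightarrow> h (Node x c) = tree_of_list (g x)"
  shows "cmap h (Node (tree_of_list xs) c) = tree_of_list (rev (concat (map g xs)))"
proof -
  have "tfold (\<lambda>u. Node (hd_tree (hd_tree u))
     (rapp (Node (tl_tree (hd_tree u)) (h (Node (tl_tree u) (hd_tree (hd_tree u)))))))
     (Node c (tree_of_list out)) (tree_of_list xs) = Node c (tree_of_list (rev (concat (map g xs)) @ out))" for out
    using assms by (induction xs arbitrary: out) (auto simp: rapp_list)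
  from this[of "[]"] show ?thesis by (simp add: cmap_def)
qed

text \<open>The first factor is the environment of \<open>cmap\<close>, and each unit of the second
  factor emits a copy of it.\<close>

definition mult_tree :: "tree \<Rightarrow> tree" where
  "mult_tree v = cmap tl_tree (Node (tl_tree v) (hd_tree v))"

lemma ptime_mult: "ptime f \<Longrightarrow> ptime (\<lambda>v. mult_tree (f v))"
  unfolding mult_tree_def by (intro ptime_cmap ptime_tl ptime_basic)

definition upto_tree :: "tree \<Rightarrow> tree" where
  "upto_tree v = tl_tree (tfold (\<lambda>u. Node (Node Leaf (hd_tree (hd_tree u)))
     (Node (hd_tree (hd_tree u)) (tl_tree (hd_tree u)))) (Node Leaf Leaf) v)"

lemma ptime_upto:
  assumes f: "ptime f"
  shows "ptime (\<lambda>v. upto_tree (f v))"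
proof -
  define g where "g = (\<lambda>u. Node (Node Leaf (hd_tree (hd_tree u)))
     (Node (hd_tree (hd_tree u)) (tl_tree (hd_tree u))))"
  have pg: "ptime g" unfolding g_def by (intro ptime_basic)
  define Inv where "Inv = (\<lambda>S j (a :: tree). size (hd_tree a) \<le> S + j \<and> size (tl_tree a) \<le> S + j * (2 * S + 1))"
  have "ptime (\<lambda>v. tfold g (hd_tree v) (tl_tree v))"
  proof (rule ptime_tfold[OF pg, where Inv = Inv and pb = "[:1, 4, 2:]"])
    fix S :: nat and a :: tree assume "size a \<le> S"
    thus "Inv S 0 a" using size_hd_tree[of a] size_tl_tree[of a] by (simp add: Inv_def)
  next
    fix S j :: nat and a x :: tree assume "Inv S j a" "j < S"
    thus "Inv S (Suc j) (g (Node a x))" by (auto simp: Inv_def g_def)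
  next
    fix S j :: nat and a :: tree assume I: "Inv S j a" and j: "j \<le> S"
    have "size a \<le> 1 + (S + j) + (S + j * (2 * S + 1))"
      using size_le_hd_tl[of a] I by (simp add: Inv_def)
    also have "\<dots> \<le> 1 + (S + S) + (S + S * (2 * S + 1))"
      using j by (intro add_mono mult_le_mono1) auto
    finally show "size a \<le> poly [:1, 4, 2:] S" by (simp add: algebra_simps)
  qed
  from ptime_tl'[OF ptime_comp[OF this, of "\<lambda>v. Node (Node Leaf Leaf) (f v)"]]
  show ?thesis unfolding upto_tree_def g_def[symmetric] by (simp add: ptime_basic f)
qed

lemma tree_of_nat_0 [simp]: "tree_of_nat 0 = Leaf"
  and tree_of_nat_Suc [simp]: "tree_of_nat (Suc n) = Node Leaf (tree_of_nat n)"
  by (simp_all add: tree_of_nat_def)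

lemma size_tree_of_nat: "size (tree_of_nat n) = n"
  by (induction n) auto

lemma rapp_nat: "rapp (Node (tree_of_nat a) (tree_of_nat b)) = tree_of_nat (a + b)"
  unfolding tree_of_nat_def rapp_list by (simp add: add.commute flip: replicate_add)

lemma monus_nat: "monus (Node (tree_of_nat a) (tree_of_nat b)) = tree_of_nat (a - b)"
proof -
  have "tl_tree (tree_of_nat a) = tree_of_nat (a - 1)" for a by (cases a) auto
  thus ?thesis unfolding monus_def by (induction b arbitrary: a) auto
qed

lemma mult_nat: "mult_tree (Node (tree_of_nat a) (tree_of_nat b)) = tree_of_nat (a * b)"
proof -
  have rep: "concat (replicate b (replicate a x)) = replicate (b * a) x" for x :: tree
    by (induction b) (simp_all add: replicate_add)
  have "mult_tree (Node (tree_of_nat a) (tree_of_nat b)) =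
    tree_of_list (rev (concat (map (\<lambda>_. replicate a Leaf) (replicate b Leaf))))"
    unfolding mult_tree_def tree_of_nat_def hd_tree.simps tl_tree.simps by (rule cmap_list) simp
  thus ?thesis by (simp add: tree_of_nat_def map_replicate rep mult.commute)
qed

lemma upto_nat: "upto_tree (tree_of_nat n) = tree_of_list (map tree_of_nat (rev [0..<n]))"
proof -
  have "tfold (\<lambda>u. Node (Node Leaf (hd_tree (hd_tree u)))
     (Node (hd_tree (hd_tree u)) (tl_tree (hd_tree u)))) (Node (tree_of_nat i) (tree_of_list (map tree_of_nat (rev [0..<i])))) (tree_of_nat n) =
     Node (tree_of_nat (i + n)) (tree_of_list (map tree_of_nat (rev [0..<i + n])))" for i
  proof (induction n arbitrary: i)
    case (Suc n)
    show ?case using Suc.IH[of "Suc i"] by simp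
  qed simp
  from this[of 0] show ?thesis by (simp add: upto_tree_def)
qed

text \<open>The state is the pair of \<open>n\<close> and a candidate \<open>m\<close>, which grows
  as long as \<open>(m + 1)\<^sup>2 * q\<close> does not exceed \<open>n\<close>; neither division
  nor root extraction has to be programmed.\<close>

definition isqrt_step :: "nat \<Rightarrow> tree \<Rightarrow> tree" where
  "isqrt_step q u = Node (hd_tree (hd_tree u))
     (if monus (Node (mult_tree (Node (mult_tree (Node (Node Leaf (tl_tree (hd_tree u))) (Node Leaf (tl_tree (hd_tree u)))))
         (tree_of_nat q))) (hd_tree (hd_tree u))) = Leaf
      then Node Leaf (tl_tree (hd_tree u)) else tl_tree (hd_tree u))"

definition isqrt :: "nat \<Rightarrow> tree \<Rightarrow> tree" where
  "isqrt q v = tl_tree (tfold (isqrt_step q) (Node v Leaf) v)"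

lemma ptime_isqrt: "ptime (isqrt q)"
proof -
  have pg: "ptime (isqrt_step q)" unfolding isqrt_step_def
    by (intro ptime_basic ptime_if ptime_monus ptime_mult)
  define Inv where "Inv = (\<lambda>S j (a :: tree). size (hd_tree a) \<le> S \<and> size (tl_tree a) \<le> S + j)"
  have "ptime (\<lambda>v. tfold (isqrt_step q) (hd_tree v) (tl_tree v))"
  proof (rule ptime_tfold[OF pg, where Inv = Inv and pb = "[:1, 3:]"])
    fix S :: nat and a :: tree assume "size a \<le> S"
    thus "Inv S 0 a" using size_hd_tree[of a] size_tl_tree[of a] by (simp add: Inv_def)
  next
    fix S j :: nat and a x :: tree assume "Inv S j a"
    thus "Inv S (Suc j) (isqrt_step q (Node a x))" by (auto simp: Inv_def isqrt_step_def)
  next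
    fix S j :: nat and a :: tree assume I: "Inv S j a" and j: "j \<le> S"
    thus "size a \<le> poly [:1, 3:] S" using size_le_hd_tl[of a] by (simp add: Inv_def)
  qed
  from ptime_tl'[OF ptime_comp[OF this, of "\<lambda>v. Node (Node v Leaf) v"]]
  show ?thesis unfolding isqrt_def by (simp add: ptime_basic)
qed

lemma isqrt_nat:
  assumes q: "q > 0"
  obtains m where "isqrt q (tree_of_nat n) = tree_of_nat m" "m * m * q \<le> n" "n < (m + 1) * (m + 1) * q"
proof -
  have st: "isqrt_step q (Node (Node (tree_of_nat n) (tree_of_nat m)) x) =
      Node (tree_of_nat n) (tree_of_nat (if (m + 1) * (m + 1) * q \<le> n then m + 1 else m))" for m x
  proof -
    have leaf: "tree_of_nat a = Leaf \<longleftrightarrow> a = 0" for a by (cases a) auto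
    have "Node Leaf (tree_of_nat m) = tree_of_nat (Suc m)" by simp
    thus ?thesis unfolding isqrt_step_def hd_tree.simps tl_tree.simps
      by (simp only: mult_nat monus_nat leaf diff_is_0_eq Suc_eq_plus1) simp
  qed
  \<comment> \<open>Either the candidate grew in each of the \<open>j\<close> rounds or it is
    already maximal. So \<open>n\<close> rounds suffice, because
    \<open>n < (n + 1)\<^sup>2 * q\<close>.\<close>
  have "\<exists>m'. tfold (isqrt_step q) (Node (tree_of_nat n) (tree_of_nat m)) (tree_of_nat j) = Node (tree_of_nat n) (tree_of_nat m')
      \<and> m' * m' * q \<le> n \<and> (m' = m + j \<or> n < (m' + 1) * (m' + 1) * q)"
    if "m * m * q \<le> n" for m j
    using that
  proof (induction j arbitrary: m)
    case 0
    thus ?case by auto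
  next
    case (Suc j)
    show ?case
    proof (cases "(m + 1) * (m + 1) * q \<le> n")
      case True
      thus ?thesis using Suc.IH[of "m + 1"] by (simp add: st)
    next
      case False
      obtain m' where m': "tfold (isqrt_step q) (Node (tree_of_nat n) (tree_of_nat m)) (tree_of_nat j) = Node (tree_of_nat n) (tree_of_nat m')"
        "m' * m' * q \<le> n" "m' = m + j \<or> n < (m' + 1) * (m' + 1) * q" using Suc.IH[OF Suc.prems] by blast
      have "n < (m' + 1) * (m' + 1) * q"
      proof (rule ccontr)
        assume *: "\<not> n < (m' + 1) * (m' + 1) * q"
        have "m + 1 \<le> m' + 1" using m'(3) * by auto
        hence "(m + 1) * (m + 1) * q \<le> (m' + 1) * (m' + 1) * q" by (intro mult_le_mono mult_le_mono1)
        thus False using * False by linarith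
      qed
      moreover have "tfold (isqrt_step q) (Node (tree_of_nat n) (tree_of_nat m)) (tree_of_nat (Suc j)) = Node (tree_of_nat n) (tree_of_nat m')"
        using False m'(1) by (simp add: st)
      ultimately show ?thesis using m'(2) by blast
    qed
  qed
  from this[of 0 n] obtain m where m: "tfold (isqrt_step q) (Node (tree_of_nat n) Leaf) (tree_of_nat n) = Node (tree_of_nat n) (tree_of_nat m)"
    "m * m * q \<le> n" "m = n \<or> n < (m + 1) * (m + 1) * q" by auto
  have "n < (n + 1) * (n + 1) * q" using q by (cases q) (auto simp: algebra_simps)
  thus thesis using m that[of m] by (auto simp: isqrt_def)
qed

definition addmod :: "tree \<Rightarrow> tree" where
  "addmod v = (if monus (Node (tl_tree v) (rapp (hd_tree v))) = Leaf
     then monus (Node (rapp (hd_tree v)) (tl_tree v)) else rapp (hd_tree v))"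

lemma ptime_addmod: "ptime f \<Longrightarrow> ptime (\<lambda>v. addmod (f v))"
  unfolding addmod_def by (intro ptime_if ptime_monus ptime_rapp ptime_basic)

text \<open>A sum below \<open>2 * m\<close> needs at most one subtraction of \<open>m\<close>.
  Allowing \<open>b = m\<close> covers the translation by 1 when \<open>m = 1\<close>.\<close>

lemma addmod_nat:
  assumes "a < m" "b \<le> m"
  shows "addmod (Node (Node (tree_of_nat a) (tree_of_nat b)) (tree_of_nat m)) = tree_of_nat ((a + b) mod m)"
proof -
  have leaf: "tree_of_nat a = Leaf \<longleftrightarrow> a = 0" for a by (cases a) auto
  have "(a + b) mod m = (if m \<le> a + b then a + b - m else a + b)"
    using assms by (simp add: le_mod_geq)
  thus ?thesis by (simp add: addmod_def rapp_nat monus_nat leaf)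
qed

section \<open>Programs for torus points, walks and the lifted relations\<close>

definition enc :: "nat \<Rightarrow> nat \<times> nat \<Rightarrow> tree" where
  "enc m v = Node (Node (tree_of_nat (fst v)) (tree_of_nat (snd v))) (tree_of_nat m)"

text \<open>The shears call \<open>addmod\<close> twice, since a single call subtracts the modulus
  at most once.\<close>

definition tgen :: "nat \<Rightarrow> tree \<Rightarrow> tree" where
  "tgen a v = (let x = hd_tree (hd_tree v); y = tl_tree (hd_tree v); m = tl_tree v in
     if a = 0 then v else
     if a = 1 then Node (Node (addmod (Node (Node x (tree_of_nat 1)) m)) y) m else
     if a = 2 then Node (Node x (addmod (Node (Node y (tree_of_nat 1)) m))) m else
     if a = 3 then Node (Node (addmod (Node (Node (addmod (Node (Node x y) m)) y) m)) y) m
     else Node (Node x (addmod (Node (Node (addmod (Node (Node y x) m)) x) m))) m)"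

text \<open>\<open>P\<close> does not depend on \<open>v\<close>: it selects one of two programs and
  is not tested at run time.\<close>

lemma ptime_cond: "ptime f \<Longrightarrow> ptime g \<Longrightarrow> ptime (\<lambda>v. if P then f v else g v)"
  by (cases P) simp_all

lemma ptime_tgen: "ptime f \<Longrightarrow> ptime (\<lambda>v. tgen a (f v))"
  unfolding tgen_def Let_def by (intro ptime_cond ptime_addmod ptime_basic)

lemma tgen_enc:
  assumes "v \<in> torus m"
  shows "tgen a (enc m v) = enc m (gen m a v)"
proof -
  obtain x y where v: "v = (x, y)" by force
  have xy: "x < m" "y < m" using assms by (auto simp: v torus_def)
  have 1: "addmod (Node (Node (tree_of_nat z) (tree_of_nat 1)) (tree_of_nat m)) = tree_of_nat ((z + 1) mod m)"
    if "z < m" for z using that by (intro addmod_nat) auto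
  have 2: "addmod (Node (Node (addmod (Node (Node (tree_of_nat z) (tree_of_nat w)) (tree_of_nat m))) (tree_of_nat w)) (tree_of_nat m))
    = tree_of_nat ((z + (w + w)) mod m)" if "z < m" "w < m" for z w
  proof -
    have "addmod (Node (Node (tree_of_nat z) (tree_of_nat w)) (tree_of_nat m)) = tree_of_nat ((z + w) mod m)"
      using that by (intro addmod_nat) auto
    moreover have "addmod (Node (Node (tree_of_nat ((z + w) mod m)) (tree_of_nat w)) (tree_of_nat m)) =
      tree_of_nat (((z + w) mod m + w) mod m)" using that by (intro addmod_nat) auto
    moreover have "((z + w) mod m + w) mod m = (z + (w + w)) mod m" by (simp add: mod_add_left_eq add.assoc)
    ultimately show ?thesis by simp
  qed
  show ?thesis unfolding tgen_def gen_def enc_def v Let_def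
    using 1 2 xy by (simp del: tree_of_nat_Suc One_nat_def)
qed

text \<open>The recursion is over the word \<open>w\<close>, a constant of the algorithm, and
  unrolls into a program of fixed length. The same holds for \<open>ttuple\<close>,
  \<open>trel\<close> and \<open>trels\<close>.\<close>

fun tact :: "nat list \<Rightarrow> tree \<Rightarrow> tree" where
  "tact [] v = v"
| "tact (a # w) v = tact w (tgen a v)"

lemma ptime_tact: "ptime f \<Longrightarrow> ptime (\<lambda>v. tact w (f v))"
  by (induction w arbitrary: f) (auto intro: ptime_tgen)

lemma tact_enc: "v \<in> torus m \<Longrightarrow> tact w (enc m v) = enc m (act m w v)"
proof (induction w arbitrary: v)
  case (Cons a w)
  have "gen m a v \<in> torus m" using bij_betw_gen[of m a] Cons.prems by (auto simp: bij_betw_def)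
  thus ?case using Cons by (simp add: tgen_enc)
qed simp

definition tcode :: "nat \<Rightarrow> nat \<Rightarrow> tree \<Rightarrow> tree" where
  "tcode q j v = rapp (Node (mult_tree (Node (rapp (Node (mult_tree (Node (hd_tree (hd_tree v)) (tl_tree v)))
     (tl_tree (hd_tree v)))) (tree_of_nat q))) (tree_of_nat j))"

lemma ptime_tcode: "ptime f \<Longrightarrow> ptime (\<lambda>v. tcode q j (f v))"
  unfolding tcode_def by (intro ptime_rapp ptime_mult ptime_basic)

lemma tcode_enc: "tcode q j (enc m v) = tree_of_nat (code m q v j)"
  by (simp add: tcode_def enc_def mult_nat rapp_nat code_def)

fun ttuple :: "nat \<Rightarrow> nat list list \<Rightarrow> nat list \<Rightarrow> tree \<Rightarrow> tree" where
  "ttuple q (w # ws) (j # js) v = Node (tcode q j v) (ttuple q ws js (tact w v))"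
| "ttuple q _ _ v = Leaf"

lemma ptime_ttuple: "ptime f \<Longrightarrow> ptime (\<lambda>v. ttuple q ws js (f v))"
proof (induction ws arbitrary: js f)
  case (Cons w ws)
  thus ?case by (cases js) (auto intro!: ptime_basic ptime_tcode ptime_tact)
qed (simp add: ptime_const)

lemma ttuple_enc:
  "v \<in> torus m \<Longrightarrow> ttuple q ws js (enc m v) = tree_of_tuple (map2 (code m q) (walk m ws v) js)"
proof (induction ws arbitrary: js v)
  case (Cons w ws)
  have "act m w v \<in> torus m" using bij_betw_act[of m w] Cons.prems by (auto simp: bij_betw_def)
  thus ?case using Cons by (cases js) (auto simp: tree_of_tuple_def tcode_enc tact_enc)
qed (simp add: tree_of_tuple_def)

text \<open>Two nested loops over the coordinates of the torus. The environment \<open>u\<close> of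
  the inner loop is the pair of \<open>x\<close> and \<open>m\<close>, and \<open>u'\<close> is
  rearranged into the shape of \<open>enc\<close>.\<close>

definition tblock :: "nat \<Rightarrow> nat list list \<Rightarrow> nat list \<Rightarrow> tree \<Rightarrow> tree" where
  "tblock q ws js v = cmap (\<lambda>u. cmap (\<lambda>u'.
     Node (ttuple q ws js (Node (Node (hd_tree (tl_tree u')) (hd_tree u')) (tl_tree (tl_tree u')))) Leaf)
     (Node (upto_tree (tl_tree u)) u)) (Node (upto_tree v) v)"

lemma ptime_tblock: "ptime f \<Longrightarrow> ptime (\<lambda>v. tblock q ws js (f v))"
  unfolding tblock_def by (intro ptime_cmap ptime_ttuple ptime_upto ptime_basic)

text \<open>The order in which the loops of \<open>tblock\<close> emit the points, including the
  reversals made by \<open>cmap\<close> and \<open>upto_tree\<close>.\<close>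

definition vlist :: "nat \<Rightarrow> (nat \<times> nat) list" where
  "vlist m = rev (concat (map (\<lambda>x. map (Pair x) [0..<m]) (rev [0..<m])))"

lemma set_vlist: "set (vlist m) = torus m"
  by (auto simp: vlist_def torus_def)

lemma distinct_vlist: "distinct (vlist m)"
  unfolding vlist_def distinct_rev
  by (rule distinct_concat) (auto simp: distinct_map inj_on_def)

lemma tblock_nat:
  "tblock q ws js (tree_of_nat m) =
    tree_of_list (map tree_of_tuple (map (\<lambda>v. map2 (code m q) (walk m ws v) js) (vlist m)))"
proof -
  let ?T = "\<lambda>v. tree_of_tuple (map2 (code m q) (walk m ws v) js)"
  let ?h = "\<lambda>u'. Node (ttuple q ws js (Node (Node (hd_tree (tl_tree u')) (hd_tree u')) (tl_tree (tl_tree u')))) Leaf"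
  let ?k = "\<lambda>u. cmap ?h (Node (upto_tree (tl_tree u)) u)"
  \<comment> \<open>\<open>cmap_list\<close> wants the output as a function of the encoded element;
    the size of a unary tree recovers the number.\<close>
  define dec where "dec = (\<lambda>t. size (t :: tree))"
  have dec: "dec (tree_of_nat i) = i" for i by (simp add: dec_def size_tree_of_nat)
  have in1: "?k (Node (tree_of_nat x) (tree_of_nat m)) = tree_of_list (map (\<lambda>y. ?T (x, y)) [0..<m])"
    if x: "x < m" for x
  proof -
    have "?k (Node (tree_of_nat x) (tree_of_nat m)) =
      tree_of_list (rev (concat (map (\<lambda>y. [?T (x, dec y)]) (map tree_of_nat (rev [0..<m])))))"
      unfolding tl_tree.simps upto_nat
    proof (rule cmap_list)
      fix y assume "y \<in> set (map tree_of_nat (rev [0..<m]))"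
      then obtain i where i: "y = tree_of_nat i" "i < m" by auto
      have "(x, i) \<in> torus m" using x i by (simp add: torus_def)
      from ttuple_enc[OF this, of q ws js]
      show "?h (Node y (Node (tree_of_nat x) (tree_of_nat m))) = tree_of_list [?T (x, dec y)]"
        by (simp add: i dec enc_def)
    qed
    thus ?thesis by (simp add: comp_def dec rev_map)
  qed
  have "tblock q ws js (tree_of_nat m) =
    tree_of_list (rev (concat (map (\<lambda>x. map (\<lambda>y. ?T (dec x, y)) [0..<m]) (map tree_of_nat (rev [0..<m])))))"
    unfolding tblock_def upto_nat
    by (rule cmap_list) (auto simp: in1[simplified] dec)
  thus ?thesis by (simp add: comp_def dec vlist_def rev_map[symmetric] map_concat)
qed

fun trel :: "nat \<Rightarrow> (nat list list \<times> nat list) list \<Rightarrow> tree \<Rightarrow> tree" where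
  "trel q [] v = Leaf"
| "trel q (b # bs) v = rapp (Node (trel q bs v) (tblock q (fst b) (snd b) v))"

lemma ptime_trel: "ptime f \<Longrightarrow> ptime (\<lambda>v. trel q bs (f v))"
  by (induction bs) (auto intro!: ptime_basic ptime_rapp ptime_tblock)

text \<open>Mirrors \<open>trel\<close>, where \<open>rapp\<close> reverses each block.\<close>

fun ilist :: "nat \<Rightarrow> 'b list \<Rightarrow> ('b \<times> (nat \<times> nat)) list" where
  "ilist m [] = []"
| "ilist m (b # bs) = rev (map (Pair b) (vlist m)) @ ilist m bs"

lemma set_ilist: "set (ilist m bs) = set bs \<times> torus m"
  by (induction bs) (auto simp: set_vlist)

lemma distinct_ilist: "distinct bs \<Longrightarrow> distinct (ilist m bs)"
  by (induction bs) (auto simp: distinct_map distinct_vlist set_ilist inj_on_def)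

lemma trel_nat:
  "trel q bs (tree_of_nat m) = tree_of_list (map tree_of_tuple
     (map (\<lambda>(b, v). map2 (code m q) (walk m (fst b) v) (snd b)) (ilist m bs)))"
  by (induction bs) (simp_all add: tblock_nat rapp_list rev_map comp_def)

fun trels :: "nat \<Rightarrow> (nat list list \<times> nat list) list list \<Rightarrow> tree \<Rightarrow> tree" where
  "trels q [] v = Leaf"
| "trels q (bs # bss) v = Node (trel q bs v) (trels q bss v)"

lemma ptime_trels: "ptime f \<Longrightarrow> ptime (\<lambda>v. trels q bss (f v))"
  by (induction bss) (auto intro!: ptime_basic ptime_trel)

lemma trels_eq: "trels q bss v = tree_of_list (map (\<lambda>bs. trel q bs v) bss)"
  by (induction bss) auto

lemma ptime_algorithm: "ptime (\<lambda>v. Node (upto_tree v) (trels q bss (isqrt q v)))"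
  by (intro ptime_basic ptime_upto ptime_trels ptime_isqrt)

text \<open>The first points of a walk depend on the first words only, so truncated tuples can be
  computed from truncated colours.\<close>

lemma take_walk: "take a (walk m ws v) = walk m (take a ws) v"
proof (induction ws arbitrary: a v)
  case (Cons w ws)
  thus ?case by (cases a) auto
qed simp

lemma ilist_map: "ilist m (map g bs) = map (\<lambda>(b, v). (g b, v)) (ilist m bs)"
  by (induction bs) (simp_all add: rev_map)

text \<open>The finite system enters the program as the constant \<open>map bs syms\<close>, already
  truncated to the arities. The emitted lists have no repetitions because of
  \<open>inj_take\<close>.\<close>

lemma encodes_algorithm:
  fixes f :: "('r \<times> nat list list) \<times> nat \<Rightarrow> nat list"
  assumes sys: "tuple_system \<tau> ar r k M N n (lift_indices t r m0 m) (lift m q snd f)"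
    and syms: "set syms = \<tau>"
    and bl: "\<And>R. distinct (bl R)" "\<And>R. set (bl R) = ({R} \<times> walk_colours t r) \<times> {..<m0}"
    and m: "isqrt q (tree_of_nat n) = tree_of_nat m"
  defines "bs \<equiv> \<lambda>R. if 2 \<le> ar R
      then map (\<lambda>i. (take (ar R) (snd (fst i)), take (ar R) (f i))) (bl R) else []"
  shows "encodes syms (Node (upto_tree (tree_of_nat n)) (trels q (map bs syms) (isqrt q (tree_of_nat n))))
     (tuple_system.struct \<tau> ar n (lift_indices t r m0 m) (lift m q snd f))"
proof -
  interpret tuple_system \<tau> ar r k M N n "lift_indices t r m0 m" "lift m q snd f" by (rule sys)
  define ts where "ts = (\<lambda>R. map (\<lambda>(b, v). map2 (code m q) (walk m (fst b) v) (snd b)) (ilist m (bs R)))"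
  have ts: "ts R = map (\<lambda>x. take (ar R) (lift m q snd f x)) (ilist m (bl R))" if "2 \<le> ar R" for R
    using that by (simp add: ts_def bs_def ilist_map lift_def case_prod_beta comp_def take_map take_zip take_walk)
  have ts0: "ts R = []" if "\<not> 2 \<le> ar R" for R
    using that by (simp add: ts_def bs_def)
  have il: "set (ilist m (bl R)) = lift_indices t r m0 m R" for R
    by (simp add: set_ilist bl lift_indices_def)
  have "distinct (ts R) \<and> set (ts R) = rel struct R" if R: "R \<in> \<tau>" for R
  proof (cases "2 \<le> ar R")
    case True
    thus ?thesis using R inj_take[OF R True] by (simp add: ts il distinct_map distinct_ilist bl rel_struct)
  next
    case False
    thus ?thesis by (simp add: ts0 rel_struct)
  qed
  hence "list_all2 (\<lambda>R ts. distinct ts \<and> set ts = rel struct R) syms (map ts syms)"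
    using syms by (auto simp: list_all2_conv_all_nth)
  moreover have "distinct (rev [0..<n])" "set (rev [0..<n]) = base struct" by auto
  moreover have "Node (upto_tree (tree_of_nat n)) (trels q (map bs syms) (isqrt q (tree_of_nat n))) =
     Node (tree_of_tuple (rev [0..<n]))
       (tree_of_list (map (\<lambda>ts. tree_of_list (map tree_of_tuple ts)) (map ts syms)))"
    unfolding m by (simp add: upto_nat tree_of_tuple_def trels_eq trel_nat ts_def comp_def)
  ultimately show ?thesis unfolding encodes_def by blast
qed

theorem theorem1p1:
  fixes \<tau> :: "'r set" and ar :: "'r \<Rightarrow> nat" and \<epsilon> :: real
  assumes "finite \<tau>" and "\<epsilon> > 0"
  shows "\<exists>M::nat. \<forall>k::nat. k > 0 \<longrightarrow>
    (\<exists>(N::nat) (S :: nat \<Rightarrow> ('r, nat) rel_structure).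
       (\<forall>n\<ge>N. is_structure \<tau> ar (S n) \<and> card (base (S n)) = n \<and> expander \<tau> ar \<epsilon> (S n) \<and>
              max_degree \<tau> (S n) \<le> M \<and> girth \<tau> (S n) \<ge> enat k) \<and>
       poly_time_constructible \<tau> N S)"
proof -
  \<comment> \<open>Inserting 2 makes the maximum defined for empty \<tau> and \<open>r\<close>
    positive in any case.\<close>
  define r where "r = Max (insert 2 (ar ` \<tau>))"
  have r2: "r \<ge> 2" and ar_r: "\<And>R. R \<in> \<tau> \<Longrightarrow> ar R \<le> r" using assms(1) by (auto simp: r_def)
  \<comment> \<open>The error budget: \<open>\<epsilon> / 4\<close> for the finite system,
    \<open>r * \<delta> = \<epsilon> / 4\<close> for the walks, and \<open>r * \<delta>\<close> once
    more for the isolated points.\<close>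
  define \<delta> where "\<delta> = \<epsilon> / (4 * r)"
  have \<delta>: "\<delta> > 0" "r * \<delta> = \<epsilon> / 4" using assms(2) r2 by (auto simp: \<delta>_def)
  \<comment> \<open>For \<open>lift_mixing\<close> with \<open>\<kappa> = \<delta>\<close>. Since
    \<open>t\<close> is chosen before \<open>k\<close>, so are the colours and with them
    \<open>M\<close>.\<close>
  obtain t where t: "(799 / 800 :: real) ^ t < \<delta>\<^sup>2"
    using real_arch_pow_inv[of "\<delta>\<^sup>2" "799 / 800"] \<delta> by auto
  define Col where "Col = \<tau> \<times> walk_colours t r"
  have finCol: "finite Col" using assms(1) by (simp add: Col_def)
  obtain M :: nat where M: "\<And>k. \<exists>n>0. \<exists>m>0. \<exists>f :: ('r \<times> nat list list) \<times> nat \<Rightarrow> nat list.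
        sparse_system Col r (\<epsilon> / 4) M k n m f"
    by (rule base_system[OF finCol, of "\<epsilon> / 4" r]) (use assms(2) in auto)
  show ?thesis
  proof (rule exI[of _ M], intro allI impI)
    fix k :: nat assume "k > 0"
    \<comment> \<open>Asking for \<open>k + 3\<close> fulfils the requirement of
      \<open>tuple_system\<close> that excludes cycles of length 1 and 2.\<close>
    obtain q m0 and f :: "('r \<times> nat list list) \<times> nat \<Rightarrow> nat list" where q: "q > 0" and m0: "m0 > 0"
      and base: "sparse_system Col r (\<epsilon> / 4) M (k + 3) q m0 f" using M[of "k + 3"] by blast
    have len: "\<forall>i\<in>Col \<times> {..<m0}. length (f i) = r \<and> set (f i) \<subseteq> {..<q}"
      and cf: "cycle_free (k + 3) (Col \<times> {..<m0}) r f"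
      and deg: "\<forall>x. card {u\<in>(Col \<times> {..<m0}) \<times> {..<r}. f (fst u) ! snd u = x} \<le> M"
      and mix: "\<forall>c\<in>Col. mixing (\<epsilon> / 4) {..<q} r ({c} \<times> {..<m0}) f"
      using base unfolding sparse_system_def by blast+
    have "\<exists>m. isqrt q (tree_of_nat n) = tree_of_nat m \<and> m * m * q \<le> n \<and> n < (m + 1) * (m + 1) * q" for n
      by (rule isqrt_nat[OF q, of n]) blast
    then obtain ms where ms: "\<And>n. isqrt q (tree_of_nat n) = tree_of_nat (ms n)"
      "\<And>n. ms n * ms n * q \<le> n" "\<And>n. n < (ms n + 1) * (ms n + 1) * q" by metis
    \<comment> \<open>For \<open>m \<ge> 3 / \<delta>\<close> the isolated points are few: their
      number is at most \<open>(2 * m + 1) * q \<le> 3 * m * q \<le> \<delta> * m\<^sup>2 *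
      q\<close>.\<close>
    obtain m1 :: nat where m1: "real m1 > max 1 (3 / \<delta>)" using reals_Archimedean2 by blast
    define N where "N = m1 * m1 * q"
    have ms_ge: "ms n \<ge> m1" if "n \<ge> N" for n
    proof (rule ccontr)
      assume "\<not> ms n \<ge> m1"
      hence "ms n + 1 \<le> m1" by simp
      hence "(ms n + 1) * (ms n + 1) * q \<le> m1 * m1 * q" by (intro mult_le_mono mult_le_mono1)
      thus False using ms(3)[of n] that by (simp add: N_def)
    qed
    define S where "S = (\<lambda>n. tuple_system.struct \<tau> ar n (lift_indices t r m0 (ms n)) (lift (ms n) q snd f))"
    have len': "length (f i) = r \<and> set (f i) \<subseteq> {..<q} \<and> length (snd (fst i)) = r" if "i \<in> Col \<times> {..<m0}" for i
      using len that by (auto simp: Col_def walk_colours_def lists_of_def)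
    have J: "(\<Union>R\<in>\<tau>. lift_indices t r m0 m R) = (Col \<times> {..<m0}) \<times> torus m" for m
      by (auto simp: lift_indices_def Col_def)
    have sys: "tuple_system \<tau> ar r (k + 3) M (ms n * ms n * q) n (lift_indices t r m0 (ms n)) (lift (ms n) q snd f)"
      if n: "n \<ge> N" for n
    proof
      let ?m = "ms n"
      have m: "?m > 0" using ms_ge[OF n] m1 by linarith
      show "finite (lift_indices t r m0 ?m R)" for R by (simp add: lift_indices_def)
      have "walk_colours t r \<noteq> {}" using card_walk_colours[of t r] by auto
      thus "lift_indices t r m0 ?m R \<noteq> {}" for R using m m0 by (auto simp: lift_indices_def torus_def)
      show "lift_indices t r m0 ?m R \<inter> lift_indices t r m0 ?m R' = {}" if "R \<noteq> R'" for R R'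
        using that by (auto simp: lift_indices_def)
      have in_I: "fst x \<in> Col \<times> {..<m0}" "snd x \<in> torus ?m" if "R \<in> \<tau>" "x \<in> lift_indices t r m0 ?m R" for x R
        using that by (auto simp: lift_indices_def Col_def)
      have lin: "length (lift ?m q snd f x) = r \<and> set (lift ?m q snd f x) \<subseteq> {..<?m * ?m * q}"
        if "R \<in> \<tau>" "x \<in> lift_indices t r m0 ?m R" for x R
        using lift_in[of "Col \<times> {..<m0}" f r q snd "fst x" "snd x" ?m] len' in_I[OF that] by simp
      show "length (lift ?m q snd f x) = r" "set (lift ?m q snd f x) \<subseteq> {..<?m * ?m * q}"
        if "R \<in> \<tau>" "x \<in> lift_indices t r m0 ?m R" for x R using lin[OF that] by auto
      show "0 < ?m * ?m * q" using m q by simp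
      show "?m * ?m * q \<le> n" by (rule ms(2))
      show "cycle_free (k + 3) (\<Union>R\<in>\<tau>. lift_indices t r m0 ?m R) r (lift ?m q snd f)"
        unfolding J by (rule lift_cycle_free[where q = q and wd = snd, OF len' cf])
      show "card {u\<in>(\<Union>R\<in>\<tau>. lift_indices t r m0 ?m R) \<times> {..<r}. lift ?m q snd f (fst u) ! snd u = x} \<le> M" for x
        unfolding J using finCol deg
        by (intro lift_degree[where I = "Col \<times> {..<m0}" and f = f and r = r and q = q and wd = snd, OF len']) auto
    qed (use assms(1) ar_r in auto)
    have good: "is_structure \<tau> ar (S n) \<and> card (base (S n)) = n \<and> expander \<tau> ar \<epsilon> (S n) \<and>
              max_degree \<tau> (S n) \<le> M \<and> girth \<tau> (S n) \<ge> enat k" if n: "n \<ge> N" for n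
    proof -
      let ?m = "ms n"
      interpret tuple_system \<tau> ar r "k + 3" M "ms n * ms n * q" n "lift_indices t r m0 (ms n)" "lift (ms n) q snd f"
        by (rule sys[OF n])
      have m: "?m > 0" "real ?m \<ge> 3 / \<delta>" using ms_ge[OF n] m1 by linarith+
      have "expander \<tau> ar \<epsilon> struct"
      proof (rule expander_struct[where \<eta> = "\<epsilon> / 4 + r * \<delta>" and \<delta> = \<delta>])
        fix R assume R: "R \<in> \<tau>"
        show "mixing (\<epsilon> / 4 + r * \<delta>) {..<?m * ?m * q} r (lift_indices t r m0 ?m R) (lift ?m q snd f)"
          using R len mix t \<delta>(1) m(1) q by (intro lift_mixing) (auto simp: Col_def)
      next
        have "real n \<le> real ((?m + 1) * (?m + 1) * q)" using ms(3)[of n] by (simp only: of_nat_le_iff less_imp_le)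
        hence "real n - real (?m * ?m * q) \<le> (2 * real ?m + 1) * q" by (simp add: algebra_simps)
        also have "\<dots> \<le> (3 * real ?m) * q" using m(1) by (intro mult_right_mono) auto
        also have "\<dots> \<le> (\<delta> * real ?m * real ?m) * q"
        proof (rule mult_right_mono)
          have "3 \<le> \<delta> * real ?m" using m(2) \<delta>(1) by (simp add: divide_le_eq mult.commute)
          thus "3 * real ?m \<le> \<delta> * real ?m * real ?m" by (intro mult_right_mono) auto
        qed simp
        also have "\<dots> = \<delta> * real (?m * ?m * q)" by (simp add: mult_ac)
        also have "\<dots> \<le> \<delta> * n" using ms(2)[of n] \<delta>(1) by (intro mult_left_mono) (simp_all only: of_nat_le_iff less_imp_le)
        finally show "real n - real (?m * ?m * q) \<le> \<delta> * n" .
      next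
        show "\<epsilon> / 4 + r * \<delta> + r * \<delta> < \<epsilon>" using \<delta>(2) assms(2) by linarith
      qed
      moreover have "enat k \<le> girth \<tau> struct" using girth_struct by (rule order_trans[rotated]) simp
      ultimately show ?thesis unfolding S_def using is_structure_struct max_degree_struct by simp
    qed
    have "poly_time_constructible \<tau> N S"
    proof -
      obtain syms where syms: "set syms = \<tau>" "distinct syms" using finite_distinct_list[OF assms(1)] by blast
      have "\<exists>xs. set xs = ({R} \<times> walk_colours t r) \<times> {..<m0} \<and> distinct xs" for R :: 'r
        by (rule finite_distinct_list) simp
      then obtain bl where bl: "\<And>R :: 'r. set (bl R) = ({R} \<times> walk_colours t r) \<times> {..<m0}" "\<And>R :: 'r. distinct (bl R)"
        by metis
      define bs where "bs = (\<lambda>R. if 2 \<le> ar R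
        then map (\<lambda>i. (take (ar R) (snd (fst i)), take (ar R) (f i))) (bl R) else [])"
      define alg where "alg = (\<lambda>v. Node (upto_tree v) (trels q (map bs syms) (isqrt q v)))"
      have "ptime alg" unfolding alg_def by (rule ptime_algorithm)
      then obtain c p where c: "\<And>s. \<exists>t s'. exec c s t s' \<and> s' 0 = alg (s 0) \<and> t \<le> poly p (size (s 0))"
        unfolding ptime_def runs_def by blast
      have "\<exists>t v. computes c (tree_of_nat n) t v \<and> t \<le> poly p n \<and> encodes syms v (S n)" if n: "n \<ge> N" for n
      proof -
        obtain t' s' where "exec c ((\<lambda>_. Leaf)(0 := tree_of_nat n)) t' s'" "s' 0 = alg (tree_of_nat n)"
          "t' \<le> poly p n" using c[of "(\<lambda>_. Leaf)(0 := tree_of_nat n)"] by (auto simp: size_tree_of_nat)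
        moreover have "encodes syms (alg (tree_of_nat n)) (S n)"
          unfolding alg_def S_def bs_def by (rule encodes_algorithm[OF sys[OF n] syms(1) bl(2,1) ms(1)])
        ultimately show ?thesis unfolding computes_def by blast
      qed
      thus ?thesis unfolding poly_time_constructible_def using syms by blast
    qed
    thus "\<exists>N S. (\<forall>n\<ge>N. is_structure \<tau> ar (S n) \<and> card (base (S n)) = n \<and> expander \<tau> ar \<epsilon> (S n) \<and>
              max_degree \<tau> (S n) \<le> M \<and> girth \<tau> (S n) \<ge> enat k) \<and> poly_time_constructible \<tau> N S"
      using good by blast
  qed
qed

end
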